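(* Let $k$ be a field of characteristic $\neq 2$, $n$ a positive integer, $\xi$ a generator of $U_n(k)$ and let $\nu(n) = p_1^{\alpha_1} \cdots p_r^{\alpha_r}$ be the prime decomposition of $\nu(n)$. Then: (1) There exists an isomorphism of Hopf algebras $H_{4n, \xi^t} \simeq H_{4n, \xi^{\gcd(t, \nu(n))}}$, for all $t = 0, \ldots, \nu(n)-1$. In particular, $H_{4n, \xi^i} \simeq H_{4n, \xi^{n - i}}$, for any $i = 0, \ldots, \nu(n) - 1$. (2) Assume that $\nu(n)$ is odd. Then the set of types of Hopf algebras that factorize through $H_4$ and $k[C_n]$ is in bijection with the set of all Hopf algebras $H_{4n, \xi^{d}}$, where $d$ is running over all positive divisors of $\nu(n)$. In particular, the number of types of such Hopf algebras is $$(\alpha_1 + 1)(\alpha_2 + 1) \cdots (\alpha_r + 1).$$ (3) Assume that $\nu(n) = 2^{\alpha_1} p_2^{\alpha_2} \cdots p_r^{\alpha_r}$ is even. Then the set of types of Hopf algebras that factorize through $H_4$ and $k[C_n]$ is in bijection with the set of all Hopf algebras $H_{4n, \xi^{d}}$, where $d$ is running over all positive divisors of $\frac{\nu(n)}{2}$. In particular, the number of types of such Hopf algebras is $$\alpha_1(\alpha_2 + 1) \cdots (\alpha_r + 1).$$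
   Context: $U_n(k) = \{\omega \in k \mid \omega^n = 1\}$ is the cyclic group of $n$-th roots of unity in $k$ and $\nu(n) = |U_n(k)|$ is its order. $C_n$ is the cyclic group of order $n$ generated by $c$, and $k[C_n]$ is its group Hopf algebra. $H_4$ is Sweedler's $4$-dimensional Hopf algebra over $k$ with basis $\{1, g, x, gx\}$, relations $g^2 = 1$, $x^2 = 0$, $xg = -gx$, and $\Delta(g) = g \otimes g$, $\Delta(x) = x \otimes 1 + g \otimes x$, $\varepsilon(g) = 1$, $\varepsilon(x) = 0$, $S(g) = g$, $S(x) = -gx$. For $\omega \in U_n(k)$, $H_{4n, \omega}$ is the $4n$-dimensional Hopf algebra over $k$ generated by $g, x, c$ subject to the relations $g^2 = c^n = 1$, $x^2 = 0$, $xg = -gx$, $cg = gc$, $cx = \omega\, xc$, with $\Delta(g) = g \otimes g$, $\Delta(c) = c \otimes c$, $\Delta(x) = x \otimes 1 + g \otimes x$, $\varepsilon(c) = \varepsilon(g) = 1$, $\varepsilon(x) = 0$, $S(c) = c^{n-1}$, $S(g) = g$, $S(x) = -gx$. A Hopf algebra $E$ factorizes through two Hopf algebras $A$ and $H$ if there exist injective Hopf algebra maps $i : A \to E$ and $j : H \to E$ such that the map $A \otimes H \to E$, $a \otimes h \mapsto i(a) j(h)$ is bijective. "Type" means isomorphism class of Hopf algebras. In (1), $\gcd(0, \nu(n)) = \nu(n)$. *)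

theory Defs
  imports
    "HOL-Algebra.Algebra"
    "HOL-Algebra.Algebraic_Closure_Type"
    "HOL-Library.Poly_Mapping"
begin

section \<open>Algebras over a field\<close>

text \<open>
  The ground field is a type \<open>'k\<close> of class \<open>field\<close>; it is turned into a HOL-Algebra ring by
  \<open>ring_of_type_algebra\<close>, so that vector spaces over \<open>'k\<close> are HOL-Algebra modules.
  The library locale \<open>algebra\<close> is about commutative algebras, hence the following one.
\<close>

locale unital_algebra = ring A + module "ring_of_type_algebra :: 'k ring" A
  for A :: "('k::field, 'a, 'm) module_scheme" (structure) +
  assumes smult_mult_left:
      "x \<in> carrier A \<Longrightarrow> y \<in> carrier A \<Longrightarrow> (a \<odot> x) \<otimes> y = a \<odot> (x \<otimes> y)"
    and smult_mult_right:
      "x \<in> carrier A \<Longrightarrow> y \<in> carrier A \<Longrightarrow> x \<otimes> (a \<odot> y) = a \<odot> (x \<otimes> y)"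

definition scalars :: "('k::field, 'k) module" where
  "scalars = ring.extend ring_of_type_algebra (module.fields (*))"

definition linear_maps ::
    "('k, 'a, 'm) module_scheme \<Rightarrow> ('k, 'b, 'n) module_scheme \<Rightarrow> ('a \<Rightarrow> 'b) set" where
  "linear_maps V W = {f \<in> carrier V \<rightarrow> carrier W.
     (\<forall>x\<in>carrier V. \<forall>y\<in>carrier V. f (x \<oplus>\<^bsub>V\<^esub> y) = f x \<oplus>\<^bsub>W\<^esub> f y) \<and>
     (\<forall>a. \<forall>x\<in>carrier V. f (a \<odot>\<^bsub>V\<^esub> x) = a \<odot>\<^bsub>W\<^esub> f x)}"

definition algebra_homs ::
    "('k, 'a, 'm) module_scheme \<Rightarrow> ('k, 'b, 'n) module_scheme \<Rightarrow> ('a \<Rightarrow> 'b) set" where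
  "algebra_homs A B = ring_hom A B \<inter> linear_maps A B"

definition opposite :: "('k, 'a, 'm) module_scheme \<Rightarrow> ('k, 'a, 'm) module_scheme" where
  "opposite A = A\<lparr>monoid.mult := (\<lambda>x y. y \<otimes>\<^bsub>A\<^esub> x)\<rparr>"

text \<open>
  The monoid algebra \<open>k[M]\<close>. An element is a finitely supported function; the basis vector given
  by \<open>m\<close> is \<open>Poly_Mapping.single m 1\<close>.
\<close>

definition monoid_algebra :: "('g, 'm) monoid_scheme \<Rightarrow> ('k::field, 'g \<Rightarrow>\<^sub>0 'k) module" where
  "monoid_algebra M =
    \<lparr>carrier = {p. Poly_Mapping.keys p \<subseteq> carrier M},
     monoid.mult = (\<lambda>p q. \<Sum>u\<in>Poly_Mapping.keys p. \<Sum>v\<in>Poly_Mapping.keys q.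
       Poly_Mapping.single (u \<otimes>\<^bsub>M\<^esub> v) (Poly_Mapping.lookup p u * Poly_Mapping.lookup q v)),
     one = Poly_Mapping.single \<one>\<^bsub>M\<^esub> 1,
     ring.zero = 0,
     add = (+),
     module.smult = (\<lambda>a. Poly_Mapping.map ((*) a))\<rparr>"

definition lin_ext ::
    "('k::field, 'a, 'm) module_scheme \<Rightarrow> ('g \<Rightarrow> 'a) \<Rightarrow> ('g \<Rightarrow>\<^sub>0 'k) \<Rightarrow> 'a" where
  "lin_ext U f p = (\<Oplus>\<^bsub>U\<^esub>g\<in>Poly_Mapping.keys p. Poly_Mapping.lookup p g \<odot>\<^bsub>U\<^esub> f g)"

definition quotient_algebra ::
    "('k, 'a, 'm) module_scheme \<Rightarrow> 'a set \<Rightarrow> ('k, 'a set) module" where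
  "quotient_algebra A I =
    ring.extend (A Quot I) (module.fields (\<lambda>a Q. \<Union>q\<in>Q. I +>\<^bsub>A\<^esub> (a \<odot>\<^bsub>A\<^esub> q)))"

text \<open>
  The map induced by \<open>lin_ext U f\<close> on cosets. It does not depend on the chosen representative
  whenever \<open>lin_ext U f\<close> vanishes on the subspace that is divided out.
\<close>

definition coset_ext ::
    "('k::field, 'a, 'm) module_scheme \<Rightarrow> ('g \<Rightarrow> 'a) \<Rightarrow> ('g \<Rightarrow>\<^sub>0 'k) set \<Rightarrow> 'a" where
  "coset_ext U f Q = lin_ext U f (SOME p. p \<in> Q)"


section \<open>Tensor products\<close>

text \<open>
  The tensor product is the vector space with basis \<open>carrier A \<times> carrier B\<close> modulo the subspace
  spanned by the bilinearity relations. The multiplication inherited from the monoid algebra of the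
  product of the multiplicative monoids of \<open>A\<close> and \<open>B\<close> is \<open>(a \<otimes> b)(a' \<otimes> b') = aa' \<otimes> bb'\<close>.
\<close>

type_synonym ('k, 'a, 'b) tensor = "('a \<times> 'b \<Rightarrow>\<^sub>0 'k) set"

inductive_set tensor_null ::
    "('k::field, 'a, 'm) module_scheme \<Rightarrow> ('k, 'b, 'n) module_scheme \<Rightarrow> ('a \<times> 'b \<Rightarrow>\<^sub>0 'k) set"
  for A B where
  zero: "0 \<in> tensor_null A B"
| add: "p \<in> tensor_null A B \<Longrightarrow> q \<in> tensor_null A B \<Longrightarrow> p + q \<in> tensor_null A B"
| add_left: "u \<in> carrier A \<Longrightarrow> v \<in> carrier A \<Longrightarrow> w \<in> carrier B \<Longrightarrow>
    Poly_Mapping.single (u \<oplus>\<^bsub>A\<^esub> v, w) c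
      - Poly_Mapping.single (u, w) c - Poly_Mapping.single (v, w) c \<in> tensor_null A B"
| add_right: "u \<in> carrier A \<Longrightarrow> v \<in> carrier B \<Longrightarrow> w \<in> carrier B \<Longrightarrow>
    Poly_Mapping.single (u, v \<oplus>\<^bsub>B\<^esub> w) c
      - Poly_Mapping.single (u, v) c - Poly_Mapping.single (u, w) c \<in> tensor_null A B"
| smult_left: "u \<in> carrier A \<Longrightarrow> w \<in> carrier B \<Longrightarrow>
    Poly_Mapping.single (a \<odot>\<^bsub>A\<^esub> u, w) c - Poly_Mapping.single (u, w) (a * c) \<in> tensor_null A B"
| smult_right: "u \<in> carrier A \<Longrightarrow> w \<in> carrier B \<Longrightarrow>
    Poly_Mapping.single (u, a \<odot>\<^bsub>B\<^esub> w) c - Poly_Mapping.single (u, w) (a * c) \<in> tensor_null A B"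

definition tensor_algebra ::
    "('k::field, 'a, 'm) module_scheme \<Rightarrow> ('k, 'b, 'n) module_scheme \<Rightarrow>
      ('k, ('k, 'a, 'b) tensor) module" where
  "tensor_algebra A B = quotient_algebra (monoid_algebra (A \<times>\<times> B)) (tensor_null A B)"

definition pure_tensor ::
    "('k::field, 'a, 'm) module_scheme \<Rightarrow> ('k, 'b, 'n) module_scheme \<Rightarrow> 'a \<Rightarrow> 'b \<Rightarrow>
      ('k, 'a, 'b) tensor" where
  "pure_tensor A B a b =
    tensor_null A B +>\<^bsub>monoid_algebra (A \<times>\<times> B)\<^esub> Poly_Mapping.single (a, b) 1"

text \<open>The linear map \<open>a \<otimes> b \<mapsto> f a b\<close> into \<open>U\<close>, for a bilinear map \<open>f\<close>.\<close>

definition tensor_lift ::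
    "('k::field, 'c, 'l) module_scheme \<Rightarrow> ('a \<Rightarrow> 'b \<Rightarrow> 'c) \<Rightarrow> ('k, 'a, 'b) tensor \<Rightarrow> 'c" where
  "tensor_lift U f = coset_ext U (\<lambda>(a, b). f a b)"

text \<open>The map \<open>f \<otimes> g\<close> with values in the tensor product of \<open>A\<close> and \<open>B\<close>.\<close>

definition tensor_map ::
    "('k::field, 'c, 'm) module_scheme \<Rightarrow> ('k, 'd, 'n) module_scheme \<Rightarrow>
      ('a \<Rightarrow> 'c) \<Rightarrow> ('b \<Rightarrow> 'd) \<Rightarrow> ('k, 'a, 'b) tensor \<Rightarrow> ('k, 'c, 'd) tensor" where
  "tensor_map A B f g = tensor_lift (tensor_algebra A B) (\<lambda>a b. pure_tensor A B (f a) (g b))"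

text \<open>The canonical isomorphism \<open>(a \<otimes> b) \<otimes> c \<mapsto> a \<otimes> (b \<otimes> c)\<close>.\<close>

definition tensor_assoc ::
    "('k::field, 'a, 'l) module_scheme \<Rightarrow> ('k, 'b, 'm) module_scheme \<Rightarrow> ('k, 'c, 'n) module_scheme \<Rightarrow>
      ('k, ('k, 'a, 'b) tensor, 'c) tensor \<Rightarrow> ('k, 'a, ('k, 'b, 'c) tensor) tensor" where
  "tensor_assoc A B C =
    (let BC = tensor_algebra B C; T = tensor_algebra A BC
     in tensor_lift T (\<lambda>t c. tensor_lift T (\<lambda>a b. pure_tensor A BC a (pure_tensor B C b c)) t))"


section \<open>Hopf algebras\<close>

record (overloaded) ('k::zero, 'a) hopf = "('k, 'a) module" +
  comult :: "'a \<Rightarrow> ('k, 'a, 'a) tensor"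
  counit :: "'a \<Rightarrow> 'k"
  antipode :: "'a \<Rightarrow> 'a"

locale hopf_algebra = unital_algebra H
  for H :: "('k::field, 'a) hopf" (structure) +
  assumes comult_algebra_hom: "comult H \<in> algebra_homs H (tensor_algebra H H)"
    and counit_algebra_hom: "counit H \<in> algebra_homs H scalars"
    and antipode_linear: "antipode H \<in> linear_maps H H"
    and coassoc: "h \<in> carrier H \<Longrightarrow>
      tensor_assoc H H H (tensor_map (tensor_algebra H H) H (comult H) id (comult H h)) =
      tensor_map H (tensor_algebra H H) id (comult H) (comult H h)"
    and counit_left: "h \<in> carrier H \<Longrightarrow> tensor_lift H (\<lambda>a b. counit H a \<odot> b) (comult H h) = h"
    and counit_right: "h \<in> carrier H \<Longrightarrow> tensor_lift H (\<lambda>a b. counit H b \<odot> a) (comult H h) = h"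
    and antipode_left: "h \<in> carrier H \<Longrightarrow>
      tensor_lift H (\<lambda>a b. antipode H a \<otimes> b) (comult H h) = counit H h \<odot> \<one>"
    and antipode_right: "h \<in> carrier H \<Longrightarrow>
      tensor_lift H (\<lambda>a b. a \<otimes> antipode H b) (comult H h) = counit H h \<odot> \<one>"

text \<open>
  A Hopf algebra map is a bialgebra map; compatibility with the antipodes is then automatic.
\<close>

definition hopf_homs :: "('k::field, 'a) hopf \<Rightarrow> ('k, 'b) hopf \<Rightarrow> ('a \<Rightarrow> 'b) set" where
  "hopf_homs H L = {f \<in> algebra_homs H L.
     (\<forall>h\<in>carrier H. comult L (f h) = tensor_map L L f f (comult H h)) \<and>
     (\<forall>h\<in>carrier H. counit L (f h) = counit H h)}"

definition hopf_isomorphic :: "('k::field, 'a) hopf \<Rightarrow> ('k, 'b) hopf \<Rightarrow> bool" where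
  "hopf_isomorphic H L \<longleftrightarrow> hopf_algebra H \<and> hopf_algebra L \<and>
     (\<exists>f\<in>hopf_homs H L. bij_betw f (carrier H) (carrier L))"

definition factorizes_through ::
    "('k::field, 'e) hopf \<Rightarrow> ('k, 'a) hopf \<Rightarrow> ('k, 'h) hopf \<Rightarrow> bool" where
  "factorizes_through E A H \<longleftrightarrow> hopf_algebra E \<and> hopf_algebra A \<and> hopf_algebra H \<and>
     (\<exists>i\<in>hopf_homs A E. \<exists>j\<in>hopf_homs H E.
        inj_on i (carrier A) \<and> inj_on j (carrier H) \<and>
        bij_betw (tensor_lift E (\<lambda>a h. i a \<otimes>\<^bsub>E\<^esub> j h))
          (carrier (tensor_algebra A H)) (carrier E))"

text \<open>The isomorphism class of \<open>E\<close> among the Hopf algebras with elements in the type \<open>'a\<close>.\<close>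

definition hopf_type :: "('k::field, 'a) hopf \<Rightarrow> ('k, 'a) hopf set" where
  "hopf_type E = {F. hopf_isomorphic E F}"

definition factorizing_types ::
    "('k::field, 'b) hopf \<Rightarrow> ('k, 'c) hopf \<Rightarrow> ('k, 'a) hopf set set" where
  "factorizing_types A H = hopf_type ` {E. factorizes_through E A H}"


section \<open>Group Hopf algebras\<close>

definition group_hopf :: "('g, 'm) monoid_scheme \<Rightarrow> ('k::field, 'g \<Rightarrow>\<^sub>0 'k) hopf" where
  "group_hopf G =
    (let A = monoid_algebra G; e = (\<lambda>g. Poly_Mapping.single g 1)
     in module.extend A (hopf.fields
          (lin_ext (tensor_algebra A A) (\<lambda>g. pure_tensor A A (e g) (e g)))
          (lin_ext scalars (\<lambda>g. 1))
          (lin_ext A (\<lambda>g. e (inv\<^bsub>G\<^esub> g)))))"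

abbreviation cyclic_hopf :: "nat \<Rightarrow> ('k::field, int \<Rightarrow>\<^sub>0 'k) hopf" where
  "cyclic_hopf n \<equiv> group_hopf (integer_mod_group n)"


section \<open>Hopf algebras given by generators and relations\<close>

definition free_algebra :: "'g set \<Rightarrow> ('k::field, 'g list \<Rightarrow>\<^sub>0 'k) module" where
  "free_algebra S = monoid_algebra \<lparr>carrier = lists S, monoid.mult = (@), one = []\<rparr>"

definition word :: "'g list \<Rightarrow> 'g list \<Rightarrow>\<^sub>0 'k::field" where
  "word w = Poly_Mapping.single w 1"

definition word_eval :: "('a, 'm) monoid_scheme \<Rightarrow> ('g \<Rightarrow> 'a) \<Rightarrow> 'g list \<Rightarrow> 'a" where
  "word_eval A f w = foldr (\<lambda>x y. f x \<otimes>\<^bsub>A\<^esub> y) w \<one>\<^bsub>A\<^esub>"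

text \<open>
  The quotient of the free algebra on \<open>S\<close> by the two-sided ideal generated by \<open>R\<close>.
  Comultiplication and counit are the algebra maps, and the antipode is the algebra
  anti-homomorphism, with the values \<open>d\<close>, \<open>e\<close> and \<open>s\<close> on the generators. The value of the
  comultiplication on a generator is written as a formal linear combination of pairs of words,
  the pair \<open>(v, w)\<close> standing for \<open>v \<otimes> w\<close>.
\<close>

definition presented_hopf ::
    "'g set \<Rightarrow> ('g list \<Rightarrow>\<^sub>0 'k) set \<Rightarrow> ('g \<Rightarrow> ('g list \<times> 'g list \<Rightarrow>\<^sub>0 'k)) \<Rightarrow> ('g \<Rightarrow> 'k) \<Rightarrow>
      ('g \<Rightarrow> ('g list \<Rightarrow>\<^sub>0 'k)) \<Rightarrow> ('k::field, ('g list \<Rightarrow>\<^sub>0 'k) set) hopf" where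
  "presented_hopf S R d e s =
    (let F = free_algebra S; I = genideal F R; A = quotient_algebra F I; T = tensor_algebra A A;
         cls = (\<lambda>p. I +>\<^bsub>F\<^esub> p);
         d' = (\<lambda>x. lin_ext T (\<lambda>(v, w). pure_tensor A A (cls (word v)) (cls (word w))) (d x))
     in module.extend A (hopf.fields
          (coset_ext T (word_eval T d'))
          (coset_ext scalars (word_eval scalars e))
          (coset_ext A (word_eval (opposite A) (\<lambda>x. cls (s x))))))"

datatype gen = gG | gX | gC

fun gen_comult :: "gen \<Rightarrow> (gen list \<times> gen list \<Rightarrow>\<^sub>0 'k::field)" where
  "gen_comult gG = Poly_Mapping.single ([gG], [gG]) 1"
| "gen_comult gX = Poly_Mapping.single ([gX], []) 1 + Poly_Mapping.single ([gG], [gX]) 1"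
| "gen_comult gC = Poly_Mapping.single ([gC], [gC]) 1"

fun gen_counit :: "gen \<Rightarrow> 'k::field" where
  "gen_counit gG = 1"
| "gen_counit gX = 0"
| "gen_counit gC = 1"

fun gen_antipode :: "nat \<Rightarrow> gen \<Rightarrow> (gen list \<Rightarrow>\<^sub>0 'k::field)" where
  "gen_antipode n gG = word [gG]"
| "gen_antipode n gX = - word [gG, gX]"
| "gen_antipode n gC = word (replicate (n - 1) gC)"

definition sweedler_relations :: "(gen list \<Rightarrow>\<^sub>0 'k::field) set" where
  "sweedler_relations = {word [gG, gG] - word [], word [gX, gX], word [gX, gG] + word [gG, gX]}"

text \<open>
  The argument of \<open>gen_antipode\<close> in Sweedler's Hopf algebra is irrelevant, as \<open>gC\<close> is not among
  its generators.
\<close>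

definition H4 :: "('k::field, (gen list \<Rightarrow>\<^sub>0 'k) set) hopf" where
  "H4 = presented_hopf {gG, gX} sweedler_relations gen_comult gen_counit (gen_antipode 1)"

definition H4n :: "nat \<Rightarrow> 'k::field \<Rightarrow> ('k, (gen list \<Rightarrow>\<^sub>0 'k) set) hopf" where
  "H4n n \<omega> = presented_hopf {gG, gX, gC}
     (sweedler_relations \<union>
       {word (replicate n gC) - word [], word [gC, gG] - word [gG, gC],
        word [gC, gX] - Poly_Mapping.single [gX, gC] \<omega>})
     gen_comult gen_counit (gen_antipode n)"

definition roots_of_unity :: "nat \<Rightarrow> 'k::field set" where
  "roots_of_unity n = {\<omega>. \<omega> ^ n = 1}"

end

theory Submission
  imports Defs
begin

text \<open>
  Let \<open>E\<close> factorize through \<open>H4\<close> and \<open>k[C\<^sub>n]\<close>, and let \<open>g\<close>, \<open>x\<close>, \<open>c\<close> be the images of the three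
  generators in \<open>E\<close>. The factorization says that the monomials \<open>g^a x^b c^i\<close> form a basis of \<open>E\<close>, and the
  comultiplication is known on them: \<open>g^a c^i\<close> is group-like and \<open>g^a x c^i\<close> is a group-like element times
  a skew-primitive one. All that is left open is how \<open>c\<close> commutes with \<open>g\<close> and \<open>x\<close>, and the coalgebra
  decides this. The functionals dual to the monomials have very simple convolution products, and
  evaluating these products shows that \<open>E\<close> has no group-like elements other than the \<open>g^a c^i\<close>
  (\<open>grouplike_cases\<close>) and that an element \<open>y\<close> with comultiplication \<open>y \<otimes> 1 + w \<otimes> y\<close> is a multiple of
  \<open>1 - w\<close>, unless \<open>w = g\<close>, when a multiple of \<open>x\<close> can be added (\<open>skew_primitive_cases\<close>). Now
  \<open>c x c^(-1)\<close> is such an element for \<open>w = c g c^(-1)\<close>, and it does not lie in the span of the group-like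
  elements. Hence \<open>c g c^(-1) = g\<close> and \<open>c x c^(-1) = \<omega> x + s (1 - g)\<close>; anticommutation with \<open>g\<close> gives
  \<open>2 s = 0\<close>, so \<open>s = 0\<close>, and \<open>c^n = 1\<close> gives \<open>\<omega>^n = 1\<close> (\<open>smash_relations\<close>). So \<open>E\<close> satisfies the relations of
  \<open>H4n n \<omega>\<close>, and the homomorphism from \<open>H4n n \<omega>\<close> to \<open>E\<close> that this provides is bijective because it sends
  monomials to monomials.

  The last step, as well as the fact that every \<open>H4n n \<omega>\<close> does factorize, needs that the monomials are a
  basis of \<open>H4n n \<omega>\<close> itself (\<open>dual_basis_H4n\<close>). They span because left multiplication by a generator
  sends a monomial to a multiple of a monomial, and they are independent because \<open>H4n n \<omega>\<close> acts on the
  functions of the exponents in the way in which it should act on the coordinates with respect to them.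

  It remains to see which \<open>\<omega>\<close> give isomorphic algebras. Replacing \<open>c\<close> by \<open>c^s\<close> with \<open>s\<close> coprime to \<open>n\<close>
  replaces \<open>\<omega>\<close> by \<open>\<omega>^s\<close>, and for even \<open>n\<close> replacing \<open>c\<close> by \<open>g c\<close> replaces \<open>\<omega>\<close> by \<open>- \<omega>\<close>
  (\<open>H4n_power_isomorphic\<close>, \<open>H4n_minus_isomorphic\<close>). Conversely, by the description of the group-like and
  skew-primitive elements, an isomorphism sends \<open>g\<close> to \<open>g\<close>, \<open>x\<close> to a multiple of \<open>x\<close> and \<open>c\<close> to some
  \<open>g^a c^i\<close>, where \<open>a = 0\<close> if \<open>n\<close> is odd, so that no further identifications occur
  (\<open>H4n_isomorphic_imp\<close>). As \<open>- 1\<close> differs from \<open>1\<close>, the number \<open>n\<close> is even exactly when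
  \<open>- 1\<close> is among the \<open>\<nu>\<close> roots of unity, that is when \<open>\<nu>\<close> is even. So the isomorphism type depends exactly on the
  subgroup generated by \<open>\<omega>\<close> if \<open>\<nu>\<close> is odd, and on the one generated by \<open>\<omega>\<close> and \<open>- 1\<close> if \<open>\<nu>\<close> is even; these
  subgroups of a cyclic group of order \<open>\<nu>\<close> correspond to the divisors of \<open>\<nu>\<close> and of \<open>\<nu> / 2\<close>.

  All maps between the algebras come from universal properties: linear maps on a tensor
  product are given on pure tensors, algebra homomorphisms on a presented algebra are given on generators
  that satisfy the relations, and the Hopf algebra axioms are inherited from generators to products
  (\<open>hopf_generators\<close>).
\<close>

section \<open>Linear maps and algebra homomorphisms\<close>

lemma ring_of_type_algebra_simps [simp]:
  "carrier (ring_of_type_algebra :: 'a::field ring) = UNIV"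
  "x \<oplus>\<^bsub>ring_of_type_algebra\<^esub> y = x + y" "x \<otimes>\<^bsub>ring_of_type_algebra\<^esub> y = x * y"
  "\<zero>\<^bsub>ring_of_type_algebra\<^esub> = (0::'a)" "\<one>\<^bsub>ring_of_type_algebra\<^esub> = (1::'a)"
  for x y :: "'a::field"
  by (simp_all add: ring_of_type_algebra_def)

text \<open>
  The same notion as \<open>unital_algebra\<close> (see \<open>unital_algebra_iff\<close>), but without the locale of modules over a
  ring record. That locale brings in a second copy of every ring fact, for the ring of scalars, under
  the names of the facts about \<open>A\<close>.
\<close>

locale k_algebra = ring A for A :: "('k::field, 'a, 'm) module_scheme" (structure) +
  assumes scale_closed [simp, intro]: "x \<in> carrier A \<Longrightarrow> a \<odot> x \<in> carrier A"
    and scale_add_left: "x \<in> carrier A \<Longrightarrow> (a + b) \<odot> x = a \<odot> x \<oplus> b \<odot> x"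
    and scale_add_right: "x \<in> carrier A \<Longrightarrow> y \<in> carrier A \<Longrightarrow> a \<odot> (x \<oplus> y) = a \<odot> x \<oplus> a \<odot> y"
    and scale_scale [simp]: "x \<in> carrier A \<Longrightarrow> a \<odot> (b \<odot> x) = (a * b) \<odot> x"
    and scale_one [simp]: "x \<in> carrier A \<Longrightarrow> 1 \<odot> x = x"
    and scale_mult_left [simp]: "x \<in> carrier A \<Longrightarrow> y \<in> carrier A \<Longrightarrow> (a \<odot> x) \<otimes> y = a \<odot> (x \<otimes> y)"
    and scale_mult_right [simp]: "x \<in> carrier A \<Longrightarrow> y \<in> carrier A \<Longrightarrow> x \<otimes> (a \<odot> y) = a \<odot> (x \<otimes> y)"

lemma unital_algebra_iff: "unital_algebra A \<longleftrightarrow> k_algebra A"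
proof
  assume A: "unital_algebra A"
  note mod = unital_algebra.axioms(2)[OF A]
  show "k_algebra A"
  proof (intro k_algebra.intro k_algebra_axioms.intro)
    show "ring A" by (rule unital_algebra.axioms(1)[OF A])
    fix a b x y
    assume x: "x \<in> carrier A"
    show "a \<odot>\<^bsub>A\<^esub> x \<in> carrier A" using module.smult_closed[OF mod, of a x] x by simp
    show "(a + b) \<odot>\<^bsub>A\<^esub> x = a \<odot>\<^bsub>A\<^esub> x \<oplus>\<^bsub>A\<^esub> b \<odot>\<^bsub>A\<^esub> x" using module.smult_l_distr[OF mod, of a b x] x by simp
    show "a \<odot>\<^bsub>A\<^esub> (b \<odot>\<^bsub>A\<^esub> x) = (a * b) \<odot>\<^bsub>A\<^esub> x" using module.smult_assoc1[OF mod, of a b x] x by simp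
    show "1 \<odot>\<^bsub>A\<^esub> x = x" using module.smult_one[OF mod, of x] x by simp
    assume y: "y \<in> carrier A"
    show "a \<odot>\<^bsub>A\<^esub> (x \<oplus>\<^bsub>A\<^esub> y) = a \<odot>\<^bsub>A\<^esub> x \<oplus>\<^bsub>A\<^esub> a \<odot>\<^bsub>A\<^esub> y"
      using module.smult_r_distr[OF mod, of a x y] x y by simp
    show "(a \<odot>\<^bsub>A\<^esub> x) \<otimes>\<^bsub>A\<^esub> y = a \<odot>\<^bsub>A\<^esub> (x \<otimes>\<^bsub>A\<^esub> y)" "x \<otimes>\<^bsub>A\<^esub> (a \<odot>\<^bsub>A\<^esub> y) = a \<odot>\<^bsub>A\<^esub> (x \<otimes>\<^bsub>A\<^esub> y)"
      using x y by (simp_all add: unital_algebra.smult_mult_left[OF A] unital_algebra.smult_mult_right[OF A])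
  qed
next
  assume "k_algebra A"
  then interpret k_algebra A .
  show "unital_algebra A"
  proof (intro unital_algebra.intro moduleI unital_algebra_axioms.intro)
    show "cring (ring_of_type_algebra :: 'b ring)" by (rule cring_from_type_algebra)
  qed (simp_all add: scale_add_left scale_add_right ring_axioms is_abelian_group)
qed

context k_algebra
begin

lemma scale_zero_left [simp]: "x \<in> carrier A \<Longrightarrow> 0 \<odot> x = \<zero>"
  using scale_add_left[of x 0 0] add.l_cancel_one'[of "0 \<odot> x" "0 \<odot> x"] by simp

lemma scale_zero_right [simp]: "a \<odot> \<zero> = \<zero>"
  using scale_add_right[of \<zero> \<zero> a] add.l_cancel_one'[of "a \<odot> \<zero>" "a \<odot> \<zero>"] by simp

lemma scale_minus_one: "x \<in> carrier A \<Longrightarrow> (- 1) \<odot> x = \<ominus> x"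
proof -
  assume x: "x \<in> carrier A"
  then have eq: "(- 1) \<odot> x \<oplus> x = \<zero>" using scale_add_left[of x "-1" 1] by simp
  show ?thesis using minus_equality[OF eq] x by simp
qed

lemma scale_minus_right: "x \<in> carrier A \<Longrightarrow> a \<odot> (\<ominus> x) = (- a) \<odot> x"
  by (simp flip: scale_minus_one)

lemma scale_minus_left: "x \<in> carrier A \<Longrightarrow> (- a) \<odot> x = \<ominus> (a \<odot> x)"
  by (simp flip: scale_minus_one)

lemma finsum_scale:
  assumes "finite I" "f \<in> I \<rightarrow> carrier A"
  shows "a \<odot> (\<Oplus>i\<in>I. f i) = (\<Oplus>i\<in>I. a \<odot> f i)"
  using assms by (induct I rule: finite_induct) (auto simp: scale_add_right Pi_iff)

end

lemma linear_mapsI: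
  assumes "\<And>x. x \<in> carrier V \<Longrightarrow> f x \<in> carrier W"
    and "\<And>x y. x \<in> carrier V \<Longrightarrow> y \<in> carrier V \<Longrightarrow> f (x \<oplus>\<^bsub>V\<^esub> y) = f x \<oplus>\<^bsub>W\<^esub> f y"
    and "\<And>a x. x \<in> carrier V \<Longrightarrow> f (a \<odot>\<^bsub>V\<^esub> x) = a \<odot>\<^bsub>W\<^esub> f x"
  shows "f \<in> linear_maps V W"
  using assms by (auto simp: linear_maps_def)

lemma linear_map_closed: "f \<in> linear_maps V W \<Longrightarrow> x \<in> carrier V \<Longrightarrow> f x \<in> carrier W"
  and linear_map_add: "f \<in> linear_maps V W \<Longrightarrow> x \<in> carrier V \<Longrightarrow> y \<in> carrier V \<Longrightarrow>
    f (x \<oplus>\<^bsub>V\<^esub> y) = f x \<oplus>\<^bsub>W\<^esub> f y"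
  and linear_map_scale: "f \<in> linear_maps V W \<Longrightarrow> x \<in> carrier V \<Longrightarrow> f (a \<odot>\<^bsub>V\<^esub> x) = a \<odot>\<^bsub>W\<^esub> f x"
  by (auto simp: linear_maps_def)

lemma linear_map_zero:
  assumes "f \<in> linear_maps V W" "k_algebra V" "k_algebra W"
  shows "f \<zero>\<^bsub>V\<^esub> = \<zero>\<^bsub>W\<^esub>"
proof -
  interpret V: k_algebra V by fact
  interpret W: k_algebra W by fact
  show ?thesis
    using linear_map_scale[OF assms(1), of "\<zero>\<^bsub>V\<^esub>" 0] linear_map_closed[OF assms(1), of "\<zero>\<^bsub>V\<^esub>"] by simp
qed

lemma linear_map_minus:
  assumes "f \<in> linear_maps V W" "k_algebra V" "k_algebra W" "x \<in> carrier V"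
  shows "f (\<ominus>\<^bsub>V\<^esub> x) = \<ominus>\<^bsub>W\<^esub> f x"
proof -
  interpret V: k_algebra V by fact
  interpret W: k_algebra W by fact
  show ?thesis
    using linear_map_scale[OF assms(1,4), of "-1"] linear_map_closed[OF assms(1,4)] assms(4)
    by (simp add: V.scale_minus_one W.scale_minus_one)
qed

lemma linear_map_id: "id \<in> linear_maps V V" and linear_map_ident: "(\<lambda>x. x) \<in> linear_maps V V"
  by (auto simp: linear_maps_def)

lemma linear_map_comp:
  "f \<in> linear_maps V W \<Longrightarrow> g \<in> linear_maps W Z \<Longrightarrow> (\<lambda>x. g (f x)) \<in> linear_maps V Z"
  by (auto simp: linear_maps_def Pi_iff)

lemma algebra_homsI:
  assumes "f \<in> linear_maps A B"
    and "\<And>x y. x \<in> carrier A \<Longrightarrow> y \<in> carrier A \<Longrightarrow> f (x \<otimes>\<^bsub>A\<^esub> y) = f x \<otimes>\<^bsub>B\<^esub> f y"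
    and "f \<one>\<^bsub>A\<^esub> = \<one>\<^bsub>B\<^esub>"
  shows "f \<in> algebra_homs A B"
  using assms unfolding algebra_homs_def linear_maps_def by (auto intro!: ring_hom_memI)

lemma algebra_hom_linear: "f \<in> algebra_homs A B \<Longrightarrow> f \<in> linear_maps A B"
  and algebra_hom_mult: "f \<in> algebra_homs A B \<Longrightarrow> x \<in> carrier A \<Longrightarrow> y \<in> carrier A \<Longrightarrow>
    f (x \<otimes>\<^bsub>A\<^esub> y) = f x \<otimes>\<^bsub>B\<^esub> f y"
  and algebra_hom_one: "f \<in> algebra_homs A B \<Longrightarrow> f \<one>\<^bsub>A\<^esub> = \<one>\<^bsub>B\<^esub>"
  and algebra_hom_closed: "f \<in> algebra_homs A B \<Longrightarrow> x \<in> carrier A \<Longrightarrow> f x \<in> carrier B"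
  and algebra_hom_add: "f \<in> algebra_homs A B \<Longrightarrow> x \<in> carrier A \<Longrightarrow> y \<in> carrier A \<Longrightarrow>
    f (x \<oplus>\<^bsub>A\<^esub> y) = f x \<oplus>\<^bsub>B\<^esub> f y"
  and algebra_hom_scale: "f \<in> algebra_homs A B \<Longrightarrow> x \<in> carrier A \<Longrightarrow> f (a \<odot>\<^bsub>A\<^esub> x) = a \<odot>\<^bsub>B\<^esub> f x"
  by (auto simp: algebra_homs_def ring_hom_def linear_maps_def)

lemma algebra_hom_id: "id \<in> algebra_homs A A"
  by (auto simp: algebra_homs_def linear_map_id)

lemma algebra_hom_comp:
  "f \<in> algebra_homs A B \<Longrightarrow> g \<in> algebra_homs B C \<Longrightarrow> (\<lambda>x. g (f x)) \<in> algebra_homs A C"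
  by (auto simp: algebra_homs_def ring_hom_def linear_maps_def Pi_iff)

lemma pow_0: "x [^]\<^bsub>A\<^esub> (0::nat) = \<one>\<^bsub>A\<^esub>" and pow_Suc: "x [^]\<^bsub>A\<^esub> Suc m = x [^]\<^bsub>A\<^esub> m \<otimes>\<^bsub>A\<^esub> x"
  by (simp_all add: nat_pow_def)

lemma algebra_hom_pow:
  assumes "f \<in> algebra_homs A B" "k_algebra A" "x \<in> carrier A"
  shows "f (x [^]\<^bsub>A\<^esub> (m::nat)) = f x [^]\<^bsub>B\<^esub> m"
proof -
  interpret A: k_algebra A by fact
  show ?thesis
    by (induct m) (use assms(3) in \<open>simp_all add: pow_0 pow_Suc algebra_hom_one[OF assms(1)] algebra_hom_mult[OF assms(1)] del: A.nat_pow_Suc\<close>)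
qed

text \<open>
  Products are built by multiplying with a generator from the left only. This still gives the whole
  subalgebra, and it is the form in which the antipode identities pass from factors to products.
\<close>

inductive generated ::
    "('k::field, 'a, 'm) module_scheme \<Rightarrow> 'a set \<Rightarrow> 'a \<Rightarrow> bool" for A S where
  gen: "x \<in> S \<Longrightarrow> generated A S x"
| one: "generated A S \<one>\<^bsub>A\<^esub>"
| mult: "x \<in> S \<Longrightarrow> generated A S y \<Longrightarrow> generated A S (x \<otimes>\<^bsub>A\<^esub> y)"
| add: "generated A S x \<Longrightarrow> generated A S y \<Longrightarrow> generated A S (x \<oplus>\<^bsub>A\<^esub> y)"
| scale: "generated A S x \<Longrightarrow> generated A S (a \<odot>\<^bsub>A\<^esub> x)"

lemma generated_closed:
  assumes "k_algebra A" "S \<subseteq> carrier A" "generated A S x"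
  shows "x \<in> carrier A"
proof -
  interpret A: k_algebra A by fact
  show ?thesis using assms(3) by induct (use assms(2) in auto)
qed

lemma algebra_hom_eqI:
  assumes "k_algebra A" "S \<subseteq> carrier A" "\<And>x. x \<in> carrier A \<Longrightarrow> generated A S x"
    and "f \<in> algebra_homs A B" "g \<in> algebra_homs A B" "\<And>x. x \<in> S \<Longrightarrow> f x = g x" "x \<in> carrier A"
  shows "f x = g x"
proof -
  have "generated A S x" using assms by auto
  then show ?thesis
    by induct (use assms(2,6) in \<open>auto simp: algebra_hom_one[OF assms(4)] algebra_hom_one[OF assms(5)]
      algebra_hom_mult[OF assms(4)] algebra_hom_mult[OF assms(5)] algebra_hom_add[OF assms(4)]
      algebra_hom_add[OF assms(5)] algebra_hom_scale[OF assms(4)] algebra_hom_scale[OF assms(5)]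
      generated_closed[OF assms(1,2)] subset_iff\<close>)
qed

lemma scalars_simps [simp]:
  "carrier scalars = UNIV" "x \<otimes>\<^bsub>scalars\<^esub> y = x * y" "x \<oplus>\<^bsub>scalars\<^esub> y = x + y"
  "\<zero>\<^bsub>scalars\<^esub> = (0::'k::field)" "\<one>\<^bsub>scalars\<^esub> = (1::'k)" "x \<odot>\<^bsub>scalars\<^esub> y = x * y" for x y :: "'k::field"
  by (simp_all add: scalars_def ring.defs module.defs ring_of_type_algebra_def)

lemma k_algebra_scalars: "k_algebra (scalars :: ('k::field, 'k) module)"
proof (rule k_algebra.intro[OF _ k_algebra_axioms.intro])
  have "\<exists>y. x + y = 0" for x :: 'k
    by (rule exI[of _ "-x"]) simp
  then show "ring (scalars :: ('k, 'k) module)"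
    by unfold_locales (auto simp: algebra_simps Units_def)
qed (auto simp: algebra_simps)

lemma scalars_minus [simp]: "\<ominus>\<^bsub>scalars\<^esub> x = - (x::'k::field)"
proof -
  interpret k: k_algebra "scalars :: ('k, 'k) module" by (rule k_algebra_scalars)
  show ?thesis using k.minus_equality[of "-x" x] by simp
qed

lemma scalars_pow [simp]: "x [^]\<^bsub>scalars\<^esub> (m::nat) = (x::'k::field) ^ m"
  by (induct m) (simp_all add: pow_0 pow_Suc)


section \<open>The opposite algebra\<close>

lemma opposite_simps [simp]:
  "carrier (opposite A) = carrier A" "x \<otimes>\<^bsub>opposite A\<^esub> y = y \<otimes>\<^bsub>A\<^esub> x" "x \<oplus>\<^bsub>opposite A\<^esub> y = x \<oplus>\<^bsub>A\<^esub> y"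
  "\<zero>\<^bsub>opposite A\<^esub> = \<zero>\<^bsub>A\<^esub>" "\<one>\<^bsub>opposite A\<^esub> = \<one>\<^bsub>A\<^esub>" "a \<odot>\<^bsub>opposite A\<^esub> x = a \<odot>\<^bsub>A\<^esub> x"
  by (simp_all add: opposite_def)

lemma k_algebra_opposite:
  assumes "k_algebra A"
  shows "k_algebra (opposite A)"
proof -
  interpret A: k_algebra A by fact
  have *: "\<exists>y\<in>carrier A. y \<oplus>\<^bsub>A\<^esub> x = \<zero>\<^bsub>A\<^esub>" if "x \<in> carrier A" for x
    using that by (intro bexI[of _ "\<ominus>\<^bsub>A\<^esub> x"]) (auto simp: A.l_neg)
  show ?thesis
  proof (rule k_algebra.intro[OF _ k_algebra_axioms.intro])
    show "ring (opposite A)"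
      by (rule ringI, rule abelian_groupI)
        (auto simp: A.a_ac A.l_distr A.r_distr A.m_assoc * intro!: monoidI)
  qed (auto simp: A.scale_add_left A.scale_add_right)
qed

lemma opposite_pow:
  assumes "k_algebra A" "x \<in> carrier A"
  shows "x [^]\<^bsub>opposite A\<^esub> (m::nat) = x [^]\<^bsub>A\<^esub> m"
proof -
  interpret A: k_algebra A by fact
  show ?thesis
  proof (induct m)
    case (Suc m)
    then show ?case using A.nat_pow_Suc2[OF assms(2)] by (simp add: pow_Suc[of _ "opposite A"] del: A.nat_pow_Suc)
  qed (simp add: pow_0)
qed


section \<open>Monoid algebras\<close>

lemma monoid_algebra_simps [simp]:
  "carrier (monoid_algebra M) = {p. Poly_Mapping.keys p \<subseteq> carrier M}"
  "\<one>\<^bsub>monoid_algebra M\<^esub> = Poly_Mapping.single \<one>\<^bsub>M\<^esub> 1"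
  "\<zero>\<^bsub>monoid_algebra M\<^esub> = 0"
  "p \<oplus>\<^bsub>monoid_algebra M\<^esub> q = p + q"
  "a \<odot>\<^bsub>monoid_algebra M\<^esub> p = Poly_Mapping.map ((*) a) p"
  by (simp_all add: monoid_algebra_def)

lemma lookup_scale: "Poly_Mapping.lookup (Poly_Mapping.map ((*) a) p) x =
    (a::'k::field) * Poly_Mapping.lookup p x"
  by (simp add: Poly_Mapping.map.rep_eq when_def)

lemma scale_poly_mapping_zero [simp]: "Poly_Mapping.map ((*) (a::'k::field)) 0 = 0"
  by (intro poly_mapping_eqI) (simp add: lookup_scale)

lemma keys_scale: "Poly_Mapping.keys (Poly_Mapping.map ((*) (a::'k::field)) p) \<subseteq> Poly_Mapping.keys p"
  by (auto simp: in_keys_iff lookup_scale)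

lemma keys_add_subset:
  "Poly_Mapping.keys p \<subseteq> S \<Longrightarrow> Poly_Mapping.keys q \<subseteq> S \<Longrightarrow> Poly_Mapping.keys (p + q) \<subseteq> S"
  using keys_add[of p q] by blast

lemma poly_mapping_induct_on_keys [consumes 1, case_names zero single add]:
  fixes p :: "'g \<Rightarrow>\<^sub>0 'k::ab_group_add"
  assumes "Poly_Mapping.keys p \<subseteq> S"
    and "P 0"
    and "\<And>g c. g \<in> S \<Longrightarrow> P (Poly_Mapping.single g c)"
    and "\<And>p q. Poly_Mapping.keys p \<subseteq> S \<Longrightarrow> Poly_Mapping.keys q \<subseteq> S \<Longrightarrow> P p \<Longrightarrow> P q \<Longrightarrow> P (p + q)"
  shows "P p"
  using assms(1)
proof (induct p rule: update_induct)
  case const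
  show ?case by fact
next
  case (update p g c)
  have "Poly_Mapping.update g c p = p + Poly_Mapping.single g c"
    using update(1) by (intro poly_mapping_eqI)
      (auto simp: lookup_update lookup_add lookup_single when_def in_keys_iff)
  moreover have "insert g (Poly_Mapping.keys p) \<subseteq> S"
    using update by (simp add: keys_update)
  ultimately show ?case
    using update assms(4)[of p "Poly_Mapping.single g c"] assms(3)[of g c] by auto
qed

text \<open>
  The keys of a sum of two elements may cancel, so additivity of the product is only visible once both
  supports are enlarged to common finite sets.
\<close>

lemma monoid_algebra_mult_eq_sum:
  assumes "finite S" "finite Y" "Poly_Mapping.keys p \<subseteq> S" "Poly_Mapping.keys q \<subseteq> Y"
  shows "p \<otimes>\<^bsub>monoid_algebra M\<^esub> q = (\<Sum>u\<in>S. \<Sum>v\<in>Y.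
    Poly_Mapping.single (u \<otimes>\<^bsub>M\<^esub> v) (Poly_Mapping.lookup p u * Poly_Mapping.lookup q v))"
proof -
  have "p \<otimes>\<^bsub>monoid_algebra M\<^esub> q = (\<Sum>u\<in>Poly_Mapping.keys p. \<Sum>v\<in>Y.
      Poly_Mapping.single (u \<otimes>\<^bsub>M\<^esub> v) (Poly_Mapping.lookup p u * Poly_Mapping.lookup q v))"
    unfolding monoid_algebra_def using assms
    by simp (intro sum.cong[OF refl] sum.mono_neutral_left, auto simp: in_keys_iff)
  also have "\<dots> = (\<Sum>u\<in>S. \<Sum>v\<in>Y.
    Poly_Mapping.single (u \<otimes>\<^bsub>M\<^esub> v) (Poly_Mapping.lookup p u * Poly_Mapping.lookup q v))"
    using assms by (intro sum.mono_neutral_left) (auto simp: in_keys_iff)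
  finally show ?thesis .
qed

lemma monoid_algebra_mult_single [simp]:
  "Poly_Mapping.single u a \<otimes>\<^bsub>monoid_algebra M\<^esub> Poly_Mapping.single v b =
    Poly_Mapping.single (u \<otimes>\<^bsub>M\<^esub> v) (a * b)"
  by (subst monoid_algebra_mult_eq_sum[of "{u}" "{v}"]) auto

lemma monoid_algebra_mult_add_left:
  "(p + q) \<otimes>\<^bsub>monoid_algebra M\<^esub> r = p \<otimes>\<^bsub>monoid_algebra M\<^esub> r + q \<otimes>\<^bsub>monoid_algebra M\<^esub> r"
proof -
  let ?S = "Poly_Mapping.keys p \<union> Poly_Mapping.keys q" and ?Y = "Poly_Mapping.keys r"
  have "Poly_Mapping.keys (p + q) \<subseteq> ?S" by (rule keys_add)
  then show ?thesis
    by (simp add: monoid_algebra_mult_eq_sum[of ?S ?Y] lookup_add distrib_right single_add sum.distrib)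
qed

lemma monoid_algebra_mult_add_right:
  "r \<otimes>\<^bsub>monoid_algebra M\<^esub> (p + q) = r \<otimes>\<^bsub>monoid_algebra M\<^esub> p + r \<otimes>\<^bsub>monoid_algebra M\<^esub> q"
proof -
  let ?S = "Poly_Mapping.keys p \<union> Poly_Mapping.keys q" and ?Y = "Poly_Mapping.keys r"
  have "Poly_Mapping.keys (p + q) \<subseteq> ?S" by (rule keys_add)
  then show ?thesis
    by (simp add: monoid_algebra_mult_eq_sum[of ?Y ?S] lookup_add distrib_left single_add sum.distrib)
qed

lemma monoid_algebra_mult_zero [simp]:
  "0 \<otimes>\<^bsub>monoid_algebra M\<^esub> p = 0" "p \<otimes>\<^bsub>monoid_algebra M\<^esub> 0 = 0"
  by (simp_all add: monoid_algebra_def)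

lemma monoid_algebra_mult_closed:
  assumes "monoid M" "Poly_Mapping.keys p \<subseteq> carrier M" "Poly_Mapping.keys q \<subseteq> carrier M"
  shows "Poly_Mapping.keys (p \<otimes>\<^bsub>monoid_algebra M\<^esub> q) \<subseteq> carrier M"
proof -
  interpret monoid M by fact
  have "Poly_Mapping.keys (Poly_Mapping.single u a \<otimes>\<^bsub>monoid_algebra M\<^esub> q) \<subseteq> carrier M"
    if "u \<in> carrier M" for u a
    using assms(3)
    by (induct q rule: poly_mapping_induct_on_keys)
      (use that in \<open>simp_all add: monoid_algebra_mult_add_right keys_add_subset\<close>)
  with assms(2) show ?thesis
    by (induct p rule: poly_mapping_induct_on_keys)
      (simp_all add: monoid_algebra_mult_add_left keys_add_subset)
qed

lemma monoid_algebra_mult_assoc: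
  fixes p q r :: "'g \<Rightarrow>\<^sub>0 'k::field"
  assumes "monoid M" "Poly_Mapping.keys p \<subseteq> carrier M" "Poly_Mapping.keys q \<subseteq> carrier M"
    "Poly_Mapping.keys r \<subseteq> carrier M"
  shows "(p \<otimes>\<^bsub>monoid_algebra M\<^esub> q) \<otimes>\<^bsub>monoid_algebra M\<^esub> r =
    p \<otimes>\<^bsub>monoid_algebra M\<^esub> (q \<otimes>\<^bsub>monoid_algebra M\<^esub> r)"
proof -
  interpret monoid M by fact
  let ?A = "monoid_algebra M :: ('k, 'g \<Rightarrow>\<^sub>0 'k) module"
  note distr = monoid_algebra_mult_add_left monoid_algebra_mult_add_right
  have 1: "(Poly_Mapping.single u a \<otimes>\<^bsub>?A\<^esub> Poly_Mapping.single v b) \<otimes>\<^bsub>?A\<^esub> r =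
      Poly_Mapping.single u a \<otimes>\<^bsub>?A\<^esub> (Poly_Mapping.single v b \<otimes>\<^bsub>?A\<^esub> r)"
    if uv: "u \<in> carrier M" "v \<in> carrier M" for u v a b
    using assms(4)
  proof (induct r rule: poly_mapping_induct_on_keys)
    case (single w c)
    with uv show ?case by (simp add: m_assoc mult.assoc)
  next
    case (add p q)
    then show ?case by (simp only: distr)
  qed simp
  have 2: "(Poly_Mapping.single u a \<otimes>\<^bsub>?A\<^esub> q) \<otimes>\<^bsub>?A\<^esub> r =
      Poly_Mapping.single u a \<otimes>\<^bsub>?A\<^esub> (q \<otimes>\<^bsub>?A\<^esub> r)" if u: "u \<in> carrier M" for u a
    using assms(3)
  proof (induct q rule: poly_mapping_induct_on_keys)
    case (single w c)
    with u show ?case by (simp only: 1)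
  next
    case (add p q)
    then show ?case by (simp only: distr)
  qed simp
  from assms(2) show ?thesis
  proof (induct p rule: poly_mapping_induct_on_keys)
    case (single w c)
    then show ?case by (simp only: 2)
  next
    case (add p q)
    then show ?case by (simp only: distr)
  qed simp
qed

lemma monoid_algebra_mult_one:
  assumes "monoid M" "Poly_Mapping.keys p \<subseteq> carrier M"
  shows "Poly_Mapping.single \<one>\<^bsub>M\<^esub> 1 \<otimes>\<^bsub>monoid_algebra M\<^esub> p = p"
    "p \<otimes>\<^bsub>monoid_algebra M\<^esub> Poly_Mapping.single \<one>\<^bsub>M\<^esub> 1 = p"
proof -
  interpret monoid M by fact
  show "Poly_Mapping.single \<one>\<^bsub>M\<^esub> 1 \<otimes>\<^bsub>monoid_algebra M\<^esub> p = p" using assms(2)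
    by (induct p rule: poly_mapping_induct_on_keys) (auto simp: monoid_algebra_mult_add_right)
  show "p \<otimes>\<^bsub>monoid_algebra M\<^esub> Poly_Mapping.single \<one>\<^bsub>M\<^esub> 1 = p" using assms(2)
    by (induct p rule: poly_mapping_induct_on_keys) (auto simp: monoid_algebra_mult_add_left)
qed

lemma scale_poly_mapping_add:
  "Poly_Mapping.map ((*) (a::'k::field)) (p + q) = Poly_Mapping.map ((*) a) p + Poly_Mapping.map ((*) a) q"
  by (intro poly_mapping_eqI) (simp add: lookup_scale lookup_add algebra_simps)

lemma k_algebra_monoid_algebra:
  assumes "monoid M"
  shows "k_algebra (monoid_algebra M :: ('k::field, 'g \<Rightarrow>\<^sub>0 'k) module)"
proof -
  interpret monoid M by fact
  let ?A = "monoid_algebra M :: ('k::field, 'g \<Rightarrow>\<^sub>0 'k) module"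
  have neg: "\<exists>q. Poly_Mapping.keys q \<subseteq> carrier M \<and> q + p = 0"
    if "Poly_Mapping.keys p \<subseteq> carrier M" for p :: "'g \<Rightarrow>\<^sub>0 'k"
    using that by (intro exI[of _ "-p"]) (auto simp: in_keys_iff)
  have scale_left: "Poly_Mapping.map ((*) a) p \<otimes>\<^bsub>?A\<^esub> q = Poly_Mapping.map ((*) a) (p \<otimes>\<^bsub>?A\<^esub> q)"
    if "Poly_Mapping.keys p \<subseteq> carrier M" "Poly_Mapping.keys q \<subseteq> carrier M" for a p q
  proof -
    have "Poly_Mapping.map ((*) a) (Poly_Mapping.single u b) \<otimes>\<^bsub>?A\<^esub> q =
      Poly_Mapping.map ((*) a) (Poly_Mapping.single u b \<otimes>\<^bsub>?A\<^esub> q)" for u b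
      using that(2) by (induct q rule: poly_mapping_induct_on_keys)
        (auto simp: monoid_algebra_mult_add_right scale_poly_mapping_add mult.assoc)
    with that(1) show ?thesis
      by (induct p rule: poly_mapping_induct_on_keys)
        (auto simp: monoid_algebra_mult_add_left scale_poly_mapping_add)
  qed
  have scale_right: "p \<otimes>\<^bsub>?A\<^esub> Poly_Mapping.map ((*) a) q = Poly_Mapping.map ((*) a) (p \<otimes>\<^bsub>?A\<^esub> q)"
    if "Poly_Mapping.keys p \<subseteq> carrier M" "Poly_Mapping.keys q \<subseteq> carrier M" for a p q
  proof -
    have "Poly_Mapping.single u b \<otimes>\<^bsub>?A\<^esub> Poly_Mapping.map ((*) a) q =
      Poly_Mapping.map ((*) a) (Poly_Mapping.single u b \<otimes>\<^bsub>?A\<^esub> q)" for u b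
      using that(2) by (induct q rule: poly_mapping_induct_on_keys)
        (auto simp: monoid_algebra_mult_add_right scale_poly_mapping_add mult.left_commute)
    with that(1) show ?thesis
      by (induct p rule: poly_mapping_induct_on_keys)
        (auto simp: monoid_algebra_mult_add_left scale_poly_mapping_add)
  qed
  show ?thesis
  proof (rule k_algebra.intro[OF _ k_algebra_axioms.intro])
    show "ring ?A"
    proof (rule ringI)
      show "abelian_group ?A"
        by (rule abelian_groupI) (use neg in \<open>simp_all add: ac_simps keys_add_subset\<close>)
      show "monoid ?A"
        by (rule monoidI) (use assms in \<open>simp_all add: monoid_algebra_mult_assoc monoid_algebra_mult_one
          monoid_algebra_mult_closed\<close>)
    qed (simp_all add: monoid_algebra_mult_add_left monoid_algebra_mult_add_right)
    show "a \<odot>\<^bsub>?A\<^esub> x \<in> carrier ?A" if "x \<in> carrier ?A" for a x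
      using that keys_scale[of a x] by (simp add: subset_trans)
    show "(a + b) \<odot>\<^bsub>?A\<^esub> x = a \<odot>\<^bsub>?A\<^esub> x \<oplus>\<^bsub>?A\<^esub> b \<odot>\<^bsub>?A\<^esub> x" for a b x
      by (simp, intro poly_mapping_eqI) (simp add: lookup_scale lookup_add algebra_simps)
    show "a \<odot>\<^bsub>?A\<^esub> (b \<odot>\<^bsub>?A\<^esub> x) = (a * b) \<odot>\<^bsub>?A\<^esub> x" for a b x
      by (simp, intro poly_mapping_eqI) (simp add: lookup_scale)
    show "1 \<odot>\<^bsub>?A\<^esub> x = x" for x
      by (simp, intro poly_mapping_eqI) (simp add: lookup_scale)
  qed (simp_all add: scale_poly_mapping_add scale_left scale_right)
qed

lemma linear_map_eqI_monoid_algebra: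
  fixes f g :: "('m \<Rightarrow>\<^sub>0 'k::field) \<Rightarrow> 'a"
  assumes U: "k_algebra U" and M: "monoid M"
    and f: "f \<in> linear_maps (monoid_algebra M) U" and g: "g \<in> linear_maps (monoid_algebra M) U"
    and eq: "\<And>m. m \<in> carrier M \<Longrightarrow> f (Poly_Mapping.single m 1) = g (Poly_Mapping.single m 1)"
    and p: "Poly_Mapping.keys p \<subseteq> carrier M"
  shows "f p = g p"
  using p
proof (induct p rule: poly_mapping_induct_on_keys)
  case zero
  show ?case
    using linear_map_zero[OF f _ U] linear_map_zero[OF g _ U] M
    by (simp add: k_algebra_monoid_algebra)
next
  case (single m c)
  then show ?case
    using linear_map_scale[OF f, of "Poly_Mapping.single m 1" c]
      linear_map_scale[OF g, of "Poly_Mapping.single m 1" c] eq by simp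
next
  case (add p q)
  then show ?case using linear_map_add[OF f, of p q] linear_map_add[OF g, of p q] by simp
qed

text \<open>
  As for the product, sums over a common finite set containing the supports make additivity visible.
\<close>

lemma lin_ext_eq_finsum:
  assumes "k_algebra U" "f \<in> S \<rightarrow> carrier U" "finite S" "Poly_Mapping.keys p \<subseteq> S"
  shows "lin_ext U f p = (\<Oplus>\<^bsub>U\<^esub>g\<in>S. Poly_Mapping.lookup p g \<odot>\<^bsub>U\<^esub> f g)"
proof -
  interpret U: k_algebra U by fact
  show ?thesis
    unfolding lin_ext_def
    by (rule U.add.finprod_mono_neutral_cong_left) (use assms in \<open>auto simp: in_keys_iff Pi_iff subset_iff\<close>)
qed

lemma lin_ext_single:
  assumes "k_algebra U" "f g \<in> carrier U"
  shows "lin_ext U f (Poly_Mapping.single g c) = c \<odot>\<^bsub>U\<^esub> f g"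
proof -
  interpret U: k_algebra U by fact
  show ?thesis
    by (subst lin_ext_eq_finsum[of U f "{g}"]) (use assms in auto)
qed

lemma lin_ext_linear:
  fixes U :: "('k::field, 'a, 'm) module_scheme" and f :: "'g \<Rightarrow> 'a"
  assumes "k_algebra U" "f \<in> carrier M \<rightarrow> carrier U"
  shows "lin_ext U f \<in> linear_maps (monoid_algebra M) U"
proof (rule linear_mapsI)
  interpret U: k_algebra U by fact
  fix p q :: "'g \<Rightarrow>\<^sub>0 'k" and a
  assume p: "p \<in> carrier (monoid_algebra M)"
  have f: "f \<in> Poly_Mapping.keys p \<rightarrow> carrier U" using p assms(2) by auto
  then show "lin_ext U f p \<in> carrier U"
    unfolding lin_ext_def by (auto intro!: U.finsum_closed)
  have "Poly_Mapping.keys (Poly_Mapping.map ((*) a) p) \<subseteq> Poly_Mapping.keys p" by (rule keys_scale)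
  with f show "lin_ext U f (a \<odot>\<^bsub>monoid_algebra M\<^esub> p) = a \<odot>\<^bsub>U\<^esub> lin_ext U f p"
    by (simp add: lin_ext_eq_finsum[OF assms(1) f] U.finsum_scale lookup_scale Pi_iff
      cong: U.finsum_cong')
       (intro U.finsum_cong', auto simp: lookup_scale)
  assume q: "q \<in> carrier (monoid_algebra M)"
  let ?S = "Poly_Mapping.keys p \<union> Poly_Mapping.keys q"
  have f: "f \<in> ?S \<rightarrow> carrier U" using p q assms(2) by auto
  have "Poly_Mapping.keys (p + q) \<subseteq> ?S" by (rule keys_add)
  then have "lin_ext U f (p + q) = (\<Oplus>\<^bsub>U\<^esub>g\<in>?S. Poly_Mapping.lookup (p + q) g \<odot>\<^bsub>U\<^esub> f g)"
    by (intro lin_ext_eq_finsum assms(1) f) auto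
  also have "\<dots> = (\<Oplus>\<^bsub>U\<^esub>g\<in>?S. Poly_Mapping.lookup p g \<odot>\<^bsub>U\<^esub> f g \<oplus>\<^bsub>U\<^esub> Poly_Mapping.lookup q g \<odot>\<^bsub>U\<^esub> f g)"
    using f by (intro U.finsum_cong') (auto simp: lookup_add U.scale_add_left Pi_iff)
  also have "\<dots> = lin_ext U f p \<oplus>\<^bsub>U\<^esub> lin_ext U f q"
    using f by (subst (1 2) lin_ext_eq_finsum[OF assms(1) f]) (auto intro!: U.finsum_addf simp: Pi_iff)
  finally show "lin_ext U f (p \<oplus>\<^bsub>monoid_algebra M\<^esub> q) = lin_ext U f p \<oplus>\<^bsub>U\<^esub> lin_ext U f q" by simp
qed

lemma lin_ext_algebra_hom:
  fixes U :: "('k::field, 'a, 'm) module_scheme" and f :: "'g \<Rightarrow> 'a" and M :: "('g, 'n) monoid_scheme"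
  assumes "k_algebra U" "monoid M" "f \<in> carrier M \<rightarrow> carrier U" "f \<one>\<^bsub>M\<^esub> = \<one>\<^bsub>U\<^esub>"
    and mult: "\<And>g h. g \<in> carrier M \<Longrightarrow> h \<in> carrier M \<Longrightarrow> f (g \<otimes>\<^bsub>M\<^esub> h) = f g \<otimes>\<^bsub>U\<^esub> f h"
  shows "lin_ext U f \<in> algebra_homs (monoid_algebra M) U"
proof (rule algebra_homsI)
  interpret U: k_algebra U by fact
  interpret M: monoid M by fact
  let ?A = "monoid_algebra M :: ('k, 'g \<Rightarrow>\<^sub>0 'k) module" and ?F = "lin_ext U f"
  show lin: "?F \<in> linear_maps ?A U" using assms by (intro lin_ext_linear)
  note Fadd = linear_map_add[OF lin, simplified] and closed = linear_map_closed[OF lin, simplified]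
  show "?F \<one>\<^bsub>?A\<^esub> = \<one>\<^bsub>U\<^esub>" using assms by (simp add: lin_ext_single)
  have F0: "?F 0 = \<zero>\<^bsub>U\<^esub>"
    using linear_map_zero[OF lin k_algebra_monoid_algebra[OF assms(2)] assms(1)] by simp
  have F1: "?F (Poly_Mapping.single g c) = c \<odot>\<^bsub>U\<^esub> f g" if "g \<in> carrier M" for g c
    using that assms by (intro lin_ext_single) auto
  have keys: "Poly_Mapping.keys (p \<otimes>\<^bsub>?A\<^esub> q) \<subseteq> carrier M"
    if "Poly_Mapping.keys p \<subseteq> carrier M" "Poly_Mapping.keys q \<subseteq> carrier M" for p q
    using that assms(2) by (rule monoid_algebra_mult_closed[rotated])
  fix p q :: "'g \<Rightarrow>\<^sub>0 'k" assume p: "p \<in> carrier ?A" and q: "q \<in> carrier ?A"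
  have 1: "?F (Poly_Mapping.single g c \<otimes>\<^bsub>?A\<^esub> q) = ?F (Poly_Mapping.single g c) \<otimes>\<^bsub>U\<^esub> ?F q"
    if g: "g \<in> carrier M" for g c
  proof -
    have fg: "f g \<in> carrier U" using assms(3) g by auto
    have ks: "Poly_Mapping.keys (Poly_Mapping.single g c \<otimes>\<^bsub>?A\<^esub> r) \<subseteq> carrier M"
      if "Poly_Mapping.keys r \<subseteq> carrier M" for r
      using that g by (intro keys) auto
    from q[simplified] show ?thesis
    proof (induct q rule: poly_mapping_induct_on_keys)
      case zero
      then show ?case using fg by (simp add: F0 F1 g)
    next
      case (single h d)
      then have "f h \<in> carrier U" using assms(3) by auto
      then show ?case using g fg F1 single
        by (simp add: mult mult.commute)
    next
      case (add r s)
      then show ?case using g fg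
        by (simp add: monoid_algebra_mult_add_right Fadd
          closed F1 U.r_distr ks)
    qed
  qed
  from p[simplified] show "?F (p \<otimes>\<^bsub>?A\<^esub> q) = ?F p \<otimes>\<^bsub>U\<^esub> ?F q"
  proof (induct p rule: poly_mapping_induct_on_keys)
    case zero
    then show ?case using q by (simp add: F0 closed)
  next
    case (single h d)
    then show ?case using 1 by simp
  next
    case (add r s)
    with q show ?case
      by (simp add: monoid_algebra_mult_add_left Fadd
          closed U.l_distr keys)
  qed
qed

section \<open>Quotients\<close>

lemma ring_extend_simps [simp]:
  "carrier (ring.extend R m) = carrier R" "x \<otimes>\<^bsub>ring.extend R m\<^esub> y = x \<otimes>\<^bsub>R\<^esub> y"
  "x \<oplus>\<^bsub>ring.extend R m\<^esub> y = x \<oplus>\<^bsub>R\<^esub> y" "\<one>\<^bsub>ring.extend R m\<^esub> = \<one>\<^bsub>R\<^esub>" "\<zero>\<^bsub>ring.extend R m\<^esub> = \<zero>\<^bsub>R\<^esub>"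
  by (simp_all add: ring.defs)

lemma ring_extend:
  assumes "ring R"
  shows "ring (ring.extend R m)"
proof -
  interpret R: ring R by fact
  have neg: "\<exists>y\<in>carrier R. y \<oplus>\<^bsub>R\<^esub> x = \<zero>\<^bsub>R\<^esub>" if "x \<in> carrier R" for x
    using that by (intro bexI[of _ "\<ominus>\<^bsub>R\<^esub> x"]) (auto simp: R.l_neg)
  show ?thesis
    by (rule ringI, rule abelian_groupI)
      (auto simp: R.a_ac R.l_distr R.r_distr R.m_assoc neg intro!: monoidI)
qed

lemma quotient_algebra_simps [simp]:
  "\<one>\<^bsub>quotient_algebra A I\<^esub> = I +>\<^bsub>A\<^esub> \<one>\<^bsub>A\<^esub>" "\<zero>\<^bsub>quotient_algebra A I\<^esub> = I"
  by (simp_all add: quotient_algebra_def FactRing_def)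

locale algebra_ideal = k_algebra A + ideal I A for A :: "('k::field, 'a, 'm) module_scheme" (structure) and I
begin

lemma scale_in_ideal: "i \<in> I \<Longrightarrow> a \<odot> i \<in> I"
  using I_l_closed[of i "a \<odot> \<one>"] a_Hcarr[of i] by simp

lemma coset_eq_iff: "x \<in> carrier A \<Longrightarrow> y \<in> carrier A \<Longrightarrow> I +> x = I +> y \<longleftrightarrow> x \<ominus> y \<in> I"
  using quotient_eq_iff_same_a_r_cos[OF ideal_axioms] by blast

lemma quotient_carrier: "carrier (quotient_algebra A I) = (\<lambda>p. I +> p) ` carrier A"
  by (auto simp: quotient_algebra_def FactRing_def A_RCOSETS_def RCOSETS_def a_r_coset_def)

lemma coset_closed [simp, intro]: "p \<in> carrier A \<Longrightarrow> I +> p \<in> carrier (quotient_algebra A I)"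
  by (simp add: quotient_carrier)

lemma quotient_add: "p \<in> carrier A \<Longrightarrow> q \<in> carrier A \<Longrightarrow>
    (I +> p) \<oplus>\<^bsub>quotient_algebra A I\<^esub> (I +> q) = I +> (p \<oplus> q)"
  by (simp add: quotient_algebra_def FactRing_def a_rcos_sum)

lemma quotient_mult: "p \<in> carrier A \<Longrightarrow> q \<in> carrier A \<Longrightarrow>
    (I +> p) \<otimes>\<^bsub>quotient_algebra A I\<^esub> (I +> q) = I +> (p \<otimes> q)"
  by (simp add: quotient_algebra_def FactRing_def rcoset_mult_add)

lemma quotient_scale:
  assumes p: "p \<in> carrier A"
  shows "a \<odot>\<^bsub>quotient_algebra A I\<^esub> (I +> p) = I +> (a \<odot> p)"
proof -
  have "I +> (a \<odot> q) = I +> (a \<odot> p)" if q: "q \<in> I +> p" for q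
  proof -
    from q obtain i where i: "i \<in> I" "q = i \<oplus> p" by (auto simp: a_r_coset_def')
    then have "i \<in> carrier A" by (simp add: a_Hcarr)
    with i p have "a \<odot> q \<ominus> a \<odot> p = a \<odot> i"
      by (simp add: scale_add_right minus_eq a_assoc r_neg)
    with i p \<open>i \<in> carrier A\<close> show ?thesis by (simp add: coset_eq_iff scale_in_ideal)
  qed
  moreover have "p \<in> I +> p" using p by (rule a_rcos_self)
  ultimately have "(\<Union>q\<in>I +> p. I +> (a \<odot> q)) = I +> (a \<odot> p)" by blast
  then show ?thesis by (simp add: quotient_algebra_def ring.defs module.defs)
qed

lemma coset_hom: "(\<lambda>p. I +> p) \<in> algebra_homs A (quotient_algebra A I)"
  by (intro algebra_homsI linear_mapsI) (auto simp: quotient_add quotient_mult quotient_scale)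

lemma k_algebra_quotient: "k_algebra (quotient_algebra A I)"
proof (intro k_algebra.intro k_algebra_axioms.intro)
  show "ring (quotient_algebra A I)"
    unfolding quotient_algebra_def by (intro ring_extend quotient_is_ring)
qed (auto simp: quotient_carrier quotient_add quotient_mult quotient_scale
  scale_add_left scale_add_right)

text \<open>
  Maps on a quotient are defined by an arbitrary choice of a representative. For a linear map that vanishes
  on the ideal the choice is harmless: the chosen element differs from \<open>p\<close> by a member of \<open>I\<close>.
\<close>

lemma linear_map_coset_rep:
  assumes "k_algebra U" and h: "h \<in> linear_maps A U" and van: "\<And>i. i \<in> I \<Longrightarrow> h i = \<zero>\<^bsub>U\<^esub>"
    and p: "p \<in> carrier A"
  shows "h (SOME q. q \<in> I +> p) = h p"
proof -
  interpret U: k_algebra U by fact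
  have "(SOME q. q \<in> I +> p) \<in> I +> p" using a_rcos_self[OF p] by (rule someI)
  then obtain i where "i \<in> I" "(SOME q. q \<in> I +> p) = i \<oplus> p" by (auto simp: a_r_coset_def')
  then show ?thesis
    using p linear_map_add[OF h, of i p] linear_map_closed[OF h p] by (simp add: van a_Hcarr)
qed

end

locale monoid_algebra_ideal =
  M: monoid M + algebra_ideal "monoid_algebra M :: ('k::field, 'g \<Rightarrow>\<^sub>0 'k) module" I
  for M :: "('g, 'n) monoid_scheme" and I :: "('g \<Rightarrow>\<^sub>0 'k::field) set" +
  fixes U :: "('k, 'a, 'm) module_scheme" and f :: "'g \<Rightarrow> 'a"
  assumes target: "k_algebra U" and f_closed: "f \<in> carrier M \<rightarrow> carrier U"
    and vanishes: "\<And>i. i \<in> I \<Longrightarrow> lin_ext U f i = \<zero>\<^bsub>U\<^esub>"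
begin

lemma coset_ext_coset:
  assumes "p \<in> carrier (monoid_algebra M)"
  shows "coset_ext U f (I +>\<^bsub>monoid_algebra M\<^esub> p) = lin_ext U f p"
  unfolding coset_ext_def
  by (rule linear_map_coset_rep[OF target lin_ext_linear[OF target f_closed] vanishes assms])

lemma coset_ext_linear: "coset_ext U f \<in> linear_maps (quotient_algebra (monoid_algebra M) I) U"
proof -
  note lin = lin_ext_linear[OF target f_closed]
  note ext = coset_ext_coset[simplified]
  have c: "Poly_Mapping.keys (p + q) \<subseteq> carrier M" "Poly_Mapping.keys (Poly_Mapping.map ((*) a) p) \<subseteq> carrier M"
    if "Poly_Mapping.keys p \<subseteq> carrier M" "Poly_Mapping.keys q \<subseteq> carrier M" for p q :: "'g \<Rightarrow>\<^sub>0 'k" and a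
    using that keys_scale[of a p] keys_add_subset by blast+
  show ?thesis
    using linear_map_closed[OF lin] linear_map_add[OF lin] linear_map_scale[OF lin] c
    by (intro linear_mapsI) (auto simp: quotient_carrier quotient_add[simplified]
      quotient_scale[simplified] ext)
qed

lemma coset_ext_hom:
  assumes one: "f \<one>\<^bsub>M\<^esub> = \<one>\<^bsub>U\<^esub>"
    and mult: "\<And>g h. g \<in> carrier M \<Longrightarrow> h \<in> carrier M \<Longrightarrow> f (g \<otimes>\<^bsub>M\<^esub> h) = f g \<otimes>\<^bsub>U\<^esub> f h"
  shows "coset_ext U f \<in> algebra_homs (quotient_algebra (monoid_algebra M) I) U"
proof (rule algebra_homsI[OF coset_ext_linear])
  have hom: "lin_ext U f \<in> algebra_homs (monoid_algebra M) U"
    by (intro lin_ext_algebra_hom target M.monoid_axioms f_closed one mult)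
  note ext = coset_ext_coset[simplified]
  show "coset_ext U f \<one>\<^bsub>quotient_algebra (monoid_algebra M) I\<^esub> = \<one>\<^bsub>U\<^esub>"
    using ext[of "Poly_Mapping.single \<one>\<^bsub>M\<^esub> 1"] algebra_hom_one[OF hom] by simp
  fix x y assume "x \<in> carrier (quotient_algebra (monoid_algebra M) I)"
    "y \<in> carrier (quotient_algebra (monoid_algebra M) I)"
  then show "coset_ext U f (x \<otimes>\<^bsub>quotient_algebra (monoid_algebra M) I\<^esub> y) = coset_ext U f x \<otimes>\<^bsub>U\<^esub> coset_ext U f y"
    using algebra_hom_mult[OF hom]
    by (auto simp: quotient_carrier quotient_mult[simplified] ext monoid_algebra_mult_closed[OF M.monoid_axioms])
qed

end


section \<open>Tensor products\<close>

definition bilinear_maps ::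
    "('k, 'a, 'm) module_scheme \<Rightarrow> ('k, 'b, 'n) module_scheme \<Rightarrow> ('k, 'c, 'l) module_scheme \<Rightarrow>
      ('a \<Rightarrow> 'b \<Rightarrow> 'c) set" where
  "bilinear_maps A B U = {f. (\<forall>a\<in>carrier A. f a \<in> linear_maps B U) \<and>
     (\<forall>b\<in>carrier B. (\<lambda>a. f a b) \<in> linear_maps A U)}"

lemma bilinear_mapsI:
  assumes "\<And>a. a \<in> carrier A \<Longrightarrow> f a \<in> linear_maps B U"
    and "\<And>b. b \<in> carrier B \<Longrightarrow> (\<lambda>a. f a b) \<in> linear_maps A U"
  shows "f \<in> bilinear_maps A B U"
  using assms by (simp add: bilinear_maps_def)

lemma bilinear_map_right: "f \<in> bilinear_maps A B U \<Longrightarrow> a \<in> carrier A \<Longrightarrow> f a \<in> linear_maps B U"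
  and bilinear_map_left: "f \<in> bilinear_maps A B U \<Longrightarrow> b \<in> carrier B \<Longrightarrow> (\<lambda>a. f a b) \<in> linear_maps A U"
  by (simp_all add: bilinear_maps_def)

lemma keys_diff_subset:
  fixes p q :: "'g \<Rightarrow>\<^sub>0 'k::ab_group_add"
  shows "Poly_Mapping.keys p \<subseteq> S \<Longrightarrow> Poly_Mapping.keys q \<subseteq> S \<Longrightarrow> Poly_Mapping.keys (p - q) \<subseteq> S"
  using keys_add_subset[of p S "- q"] by (simp add: in_keys_iff subset_iff)

lemma monoid_algebra_mult_diff:
  "(p - q) \<otimes>\<^bsub>monoid_algebra M\<^esub> r = p \<otimes>\<^bsub>monoid_algebra M\<^esub> r - q \<otimes>\<^bsub>monoid_algebra M\<^esub> r"
  "r \<otimes>\<^bsub>monoid_algebra M\<^esub> (p - q) = r \<otimes>\<^bsub>monoid_algebra M\<^esub> p - r \<otimes>\<^bsub>monoid_algebra M\<^esub> q"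
  using monoid_algebra_mult_add_left[of M "p - q" q r] monoid_algebra_mult_add_right[of M r "p - q" q]
  by simp_all

lemma linear_map_diff:
  assumes U: "k_algebra U" and h: "h \<in> linear_maps (monoid_algebra M) U"
    and p: "Poly_Mapping.keys p \<subseteq> carrier M" "Poly_Mapping.keys q \<subseteq> carrier M"
  shows "h (p - q) = h p \<ominus>\<^bsub>U\<^esub> h q"
proof -
  interpret U: k_algebra U by fact
  have d: "Poly_Mapping.keys (p - q) \<subseteq> carrier M" using p by (rule keys_diff_subset)
  then have "h p = h (p - q) \<oplus>\<^bsub>U\<^esub> h q"
    using linear_map_add[OF h, of "p - q" q] p by simp
  moreover have "h (p - q) \<in> carrier U" "h q \<in> carrier U"
    using linear_map_closed[OF h] p d by auto
  ultimately show ?thesis by (simp add: U.minus_eq U.a_assoc U.r_neg)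
qed

locale tensor = A: k_algebra A + B: k_algebra B
  for A :: "('k::field, 'a, 'm) module_scheme" and B :: "('k, 'b, 'n) module_scheme"
begin

abbreviation "N \<equiv> tensor_null A B"
abbreviation "Free \<equiv> monoid_algebra (A \<times>\<times> B) :: ('k, 'a \<times> 'b \<Rightarrow>\<^sub>0 'k) module"
abbreviation "T \<equiv> tensor_algebra A B"
abbreviation "pure \<equiv> pure_tensor A B"

lemma monoid_prod: "monoid (A \<times>\<times> B)"
  by (intro DirProd_monoid A.monoid_axioms B.monoid_axioms)

lemma null_keys: "p \<in> N \<Longrightarrow> Poly_Mapping.keys p \<subseteq> carrier A \<times> carrier B"
  by (induct rule: tensor_null.induct) (simp_all add: keys_add_subset keys_diff_subset)

lemma null_uminus: "p \<in> N \<Longrightarrow> - p \<in> N"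
proof (induct rule: tensor_null.induct)
  case (add p q)
  then show ?case using tensor_null.add[of "-p" A B "-q"] by (simp add: algebra_simps)
next
  case (add_left u v w c)
  then show ?case using tensor_null.add_left[of u A v w B "-c"] by (simp add: single_uminus algebra_simps)
next
  case (add_right u v w c)
  then show ?case using tensor_null.add_right[of u A v B w "-c"] by (simp add: single_uminus algebra_simps)
next
  case (smult_left u w a c)
  then show ?case using tensor_null.smult_left[of u A w B a "-c"] by (simp add: single_uminus algebra_simps)
next
  case (smult_right u w a c)
  then show ?case using tensor_null.smult_right[of u A w B a "-c"] by (simp add: single_uminus algebra_simps)
qed (simp add: tensor_null.zero)

lemma null_mult_single:
  assumes ab: "a \<in> carrier A" "b \<in> carrier B" and p: "p \<in> N"
  shows "Poly_Mapping.single (a, b) d \<otimes>\<^bsub>Free\<^esub> p \<in> N" "p \<otimes>\<^bsub>Free\<^esub> Poly_Mapping.single (a, b) d \<in> N"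
  using p
proof (induct rule: tensor_null.induct)
  case (add_left u v w c)
  case 1 show ?case using ab add_left tensor_null.add_left[of "a \<otimes>\<^bsub>A\<^esub> u" A "a \<otimes>\<^bsub>A\<^esub> v" "b \<otimes>\<^bsub>B\<^esub> w" B "d * c"]
    by (simp add: monoid_algebra_mult_diff A.r_distr)
  case 2 show ?case using ab add_left tensor_null.add_left[of "u \<otimes>\<^bsub>A\<^esub> a" A "v \<otimes>\<^bsub>A\<^esub> a" "w \<otimes>\<^bsub>B\<^esub> b" B "c * d"]
    by (simp add: monoid_algebra_mult_diff A.l_distr)
next
  case (add_right u v w c)
  case 1 show ?case using ab add_right tensor_null.add_right[of "a \<otimes>\<^bsub>A\<^esub> u" A "b \<otimes>\<^bsub>B\<^esub> v" B "b \<otimes>\<^bsub>B\<^esub> w" "d * c"]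
    by (simp add: monoid_algebra_mult_diff B.r_distr)
  case 2 show ?case using ab add_right tensor_null.add_right[of "u \<otimes>\<^bsub>A\<^esub> a" A "v \<otimes>\<^bsub>B\<^esub> b" B "w \<otimes>\<^bsub>B\<^esub> b" "c * d"]
    by (simp add: monoid_algebra_mult_diff B.l_distr)
next
  case (smult_left u w e c)
  case 1 show ?case using ab smult_left tensor_null.smult_left[of "a \<otimes>\<^bsub>A\<^esub> u" A "b \<otimes>\<^bsub>B\<^esub> w" B e "d * c"]
    by (simp add: monoid_algebra_mult_diff mult.left_commute)
  case 2 show ?case using ab smult_left tensor_null.smult_left[of "u \<otimes>\<^bsub>A\<^esub> a" A "w \<otimes>\<^bsub>B\<^esub> b" B e "c * d"]
    by (simp add: monoid_algebra_mult_diff mult.assoc)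
next
  case (smult_right u w e c)
  case 1 show ?case using ab smult_right tensor_null.smult_right[of "a \<otimes>\<^bsub>A\<^esub> u" A "b \<otimes>\<^bsub>B\<^esub> w" B e "d * c"]
    by (simp add: monoid_algebra_mult_diff mult.left_commute)
  case 2 show ?case using ab smult_right tensor_null.smult_right[of "u \<otimes>\<^bsub>A\<^esub> a" A "w \<otimes>\<^bsub>B\<^esub> b" B e "c * d"]
    by (simp add: monoid_algebra_mult_diff mult.assoc)
qed (simp_all add: tensor_null.zero tensor_null.add monoid_algebra_mult_add_left monoid_algebra_mult_add_right)

text \<open>
  Multiplying a bilinearity relation by a basis vector \<open>(a, b)\<close> gives another bilinearity relation, because
  multiplication by \<open>a\<close> and by \<open>b\<close> is linear. So the span of the relations is an ideal, and the tensor product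
  is the quotient by this ideal.
\<close>

lemma ideal_null: "ideal N Free"
proof (rule idealI)
  interpret Free: k_algebra Free by (intro k_algebra_monoid_algebra monoid_prod)
  show "ring Free" by (rule Free.ring_axioms)
  show "subgroup N (add_monoid Free)"
  proof (rule group.subgroupI[OF Free.a_group])
    fix p assume p: "p \<in> N"
    have "- p \<oplus>\<^bsub>Free\<^esub> p = \<zero>\<^bsub>Free\<^esub>" by simp
    then have "\<ominus>\<^bsub>Free\<^esub> p = - p"
      by (rule Free.minus_equality) (use null_keys[OF p] null_keys[OF null_uminus[OF p]] in auto)
    then show "inv\<^bsub>add_monoid Free\<^esub> p \<in> N" using null_uminus[OF p] by (simp add: a_inv_def)
  qed (auto dest: null_keys intro: tensor_null.zero tensor_null.add simp: ex_in_conv[symmetric])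
  fix p q assume p: "p \<in> N" and q: "q \<in> carrier Free"
  from q have "Poly_Mapping.keys q \<subseteq> carrier A \<times> carrier B" by simp
  then have "q \<otimes>\<^bsub>Free\<^esub> p \<in> N \<and> p \<otimes>\<^bsub>Free\<^esub> q \<in> N"
    by (induct q rule: poly_mapping_induct_on_keys)
      (use p in \<open>auto simp: null_mult_single tensor_null.zero tensor_null.add
        monoid_algebra_mult_add_left monoid_algebra_mult_add_right\<close>)
  then show "q \<otimes>\<^bsub>Free\<^esub> p \<in> N" "p \<otimes>\<^bsub>Free\<^esub> q \<in> N" by auto
qed

sublocale Q: algebra_ideal Free N
  by (intro algebra_ideal.intro k_algebra_monoid_algebra monoid_prod ideal_null)

lemma k_algebra_tensor: "k_algebra T"
  unfolding tensor_algebra_def by (rule Q.k_algebra_quotient)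

sublocale T: k_algebra T by (rule k_algebra_tensor)

lemma pure_eq: "pure a b = N +>\<^bsub>Free\<^esub> Poly_Mapping.single (a, b) 1"
  by (simp add: pure_tensor_def)

lemma pure_closed [simp, intro]: "a \<in> carrier A \<Longrightarrow> b \<in> carrier B \<Longrightarrow> pure a b \<in> carrier T"
  unfolding pure_eq tensor_algebra_def by (rule Q.coset_closed) simp

lemma coset_eqI:
  "p - q \<in> N \<Longrightarrow> Poly_Mapping.keys p \<subseteq> carrier A \<times> carrier B \<Longrightarrow> Poly_Mapping.keys q \<subseteq> carrier A \<times> carrier B \<Longrightarrow>
    N +>\<^bsub>Free\<^esub> p = N +>\<^bsub>Free\<^esub> q"
  using linear_map_diff[OF Q.k_algebra_axioms linear_map_ident, of p q]
  by (subst Q.coset_eq_iff) simp_all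

lemma coset_single:
  assumes "a \<in> carrier A" "b \<in> carrier B"
  shows "N +>\<^bsub>Free\<^esub> Poly_Mapping.single (a, b) c = c \<odot>\<^bsub>T\<^esub> pure a b"
    "N +>\<^bsub>Free\<^esub> Poly_Mapping.single (a, b) c = pure (c \<odot>\<^bsub>A\<^esub> a) b"
    "N +>\<^bsub>Free\<^esub> Poly_Mapping.single (a, b) c = pure a (c \<odot>\<^bsub>B\<^esub> b)"
proof -
  show "N +>\<^bsub>Free\<^esub> Poly_Mapping.single (a, b) c = c \<odot>\<^bsub>T\<^esub> pure a b"
    using Q.quotient_scale[of "Poly_Mapping.single (a, b) 1" c] assms
    by (simp add: pure_eq tensor_algebra_def)
  show "N +>\<^bsub>Free\<^esub> Poly_Mapping.single (a, b) c = pure (c \<odot>\<^bsub>A\<^esub> a) b"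
    unfolding pure_eq
    by (rule coset_eqI[symmetric]) (use tensor_null.smult_left[of a A b B c 1] assms in auto)
  show "N +>\<^bsub>Free\<^esub> Poly_Mapping.single (a, b) c = pure a (c \<odot>\<^bsub>B\<^esub> b)"
    unfolding pure_eq
    by (rule coset_eqI[symmetric]) (use tensor_null.smult_right[of a A b B c 1] assms in auto)
qed

lemma pure_scale:
  assumes "a \<in> carrier A" "b \<in> carrier B"
  shows "pure (c \<odot>\<^bsub>A\<^esub> a) b = c \<odot>\<^bsub>T\<^esub> pure a b" "pure a (c \<odot>\<^bsub>B\<^esub> b) = c \<odot>\<^bsub>T\<^esub> pure a b"
  using coset_single[OF assms] by simp_all

lemma pure_add_left:
  assumes "a \<in> carrier A" "a' \<in> carrier A" "b \<in> carrier B"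
  shows "pure (a \<oplus>\<^bsub>A\<^esub> a') b = pure a b \<oplus>\<^bsub>T\<^esub> pure a' b"
proof -
  have "N +>\<^bsub>Free\<^esub> Poly_Mapping.single (a \<oplus>\<^bsub>A\<^esub> a', b) 1 =
      N +>\<^bsub>Free\<^esub> (Poly_Mapping.single (a, b) 1 + Poly_Mapping.single (a', b) 1)"
    by (rule coset_eqI) (use tensor_null.add_left[of a A a' b B 1] assms
      in \<open>simp_all add: diff_diff_add keys_add_subset\<close>)
  then show ?thesis
    using Q.quotient_add[of "Poly_Mapping.single (a, b) 1" "Poly_Mapping.single (a', b) 1"] assms
    by (simp add: pure_eq tensor_algebra_def)
qed

lemma pure_add_right:
  assumes "a \<in> carrier A" "b \<in> carrier B" "b' \<in> carrier B"
  shows "pure a (b \<oplus>\<^bsub>B\<^esub> b') = pure a b \<oplus>\<^bsub>T\<^esub> pure a b'"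
proof -
  have "N +>\<^bsub>Free\<^esub> Poly_Mapping.single (a, b \<oplus>\<^bsub>B\<^esub> b') 1 =
      N +>\<^bsub>Free\<^esub> (Poly_Mapping.single (a, b) 1 + Poly_Mapping.single (a, b') 1)"
    by (rule coset_eqI) (use tensor_null.add_right[of a A b B b' 1] assms
      in \<open>simp_all add: diff_diff_add keys_add_subset\<close>)
  then show ?thesis
    using Q.quotient_add[of "Poly_Mapping.single (a, b) 1" "Poly_Mapping.single (a, b') 1"] assms
    by (simp add: pure_eq tensor_algebra_def)
qed

lemma pure_bilinear: "pure \<in> bilinear_maps A B T"
  by (intro bilinear_mapsI linear_mapsI) (auto simp: pure_add_left pure_add_right pure_scale)

lemma pure_zero: "b \<in> carrier B \<Longrightarrow> pure \<zero>\<^bsub>A\<^esub> b = \<zero>\<^bsub>T\<^esub>" "a \<in> carrier A \<Longrightarrow> pure a \<zero>\<^bsub>B\<^esub> = \<zero>\<^bsub>T\<^esub>"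
  using pure_scale(1)[of "\<zero>\<^bsub>A\<^esub>" b 0] pure_scale(2)[of a "\<zero>\<^bsub>B\<^esub>" 0] by simp_all

lemma pure_minus: "a \<in> carrier A \<Longrightarrow> b \<in> carrier B \<Longrightarrow> pure (\<ominus>\<^bsub>A\<^esub> a) b = \<ominus>\<^bsub>T\<^esub> pure a b"
  "a \<in> carrier A \<Longrightarrow> b \<in> carrier B \<Longrightarrow> pure a (\<ominus>\<^bsub>B\<^esub> b) = \<ominus>\<^bsub>T\<^esub> pure a b"
  by (simp_all add: pure_scale flip: A.scale_minus_one B.scale_minus_one T.scale_minus_one)

lemma pure_mult:
  assumes "a \<in> carrier A" "a' \<in> carrier A" "b \<in> carrier B" "b' \<in> carrier B"
  shows "pure a b \<otimes>\<^bsub>T\<^esub> pure a' b' = pure (a \<otimes>\<^bsub>A\<^esub> a') (b \<otimes>\<^bsub>B\<^esub> b')"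
  using Q.quotient_mult[of "Poly_Mapping.single (a, b) 1" "Poly_Mapping.single (a', b') 1"] assms
  by (simp add: pure_eq tensor_algebra_def)

lemma one_eq_pure: "\<one>\<^bsub>T\<^esub> = pure \<one>\<^bsub>A\<^esub> \<one>\<^bsub>B\<^esub>"
  by (simp add: pure_eq tensor_algebra_def)

text \<open>
  Every tensor is a sum of pure tensors: a scalar in front of a pure tensor can be absorbed by its first
  factor.
\<close>

lemma tensor_induct [consumes 1, case_names pure add]:
  assumes t: "t \<in> carrier T"
    and pure: "\<And>a b. a \<in> carrier A \<Longrightarrow> b \<in> carrier B \<Longrightarrow> P (pure a b)"
    and add: "\<And>s t. s \<in> carrier T \<Longrightarrow> t \<in> carrier T \<Longrightarrow> P s \<Longrightarrow> P t \<Longrightarrow> P (s \<oplus>\<^bsub>T\<^esub> t)"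
  shows "P t"
proof -
  obtain p where p: "Poly_Mapping.keys p \<subseteq> carrier A \<times> carrier B" and t: "t = N +>\<^bsub>Free\<^esub> p"
    using t by (auto simp: tensor_algebra_def Q.quotient_carrier)
  from p have "P (N +>\<^bsub>Free\<^esub> p)"
  proof (induct p rule: poly_mapping_induct_on_keys)
    case zero
    have "N +>\<^bsub>Free\<^esub> 0 = pure \<zero>\<^bsub>A\<^esub> \<zero>\<^bsub>B\<^esub>" using coset_single(2)[of "\<zero>\<^bsub>A\<^esub>" "\<zero>\<^bsub>B\<^esub>" 0] by simp
    with pure show ?case by simp
  next
    case (single g c)
    with pure show ?case by (auto simp: coset_single(2))
  next
    case (add p q)
    then have "(N +>\<^bsub>Free\<^esub> p) \<oplus>\<^bsub>T\<^esub> (N +>\<^bsub>Free\<^esub> q) = N +>\<^bsub>Free\<^esub> (p + q)"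
      using Q.quotient_add[of p q] by (simp add: tensor_algebra_def)
    moreover have "N +>\<^bsub>Free\<^esub> p \<in> carrier T" "N +>\<^bsub>Free\<^esub> q \<in> carrier T"
      using add by (auto simp: tensor_algebra_def Q.quotient_carrier)
    ultimately show ?case using add assms(3) by metis
  qed
  with t show ?thesis by simp
qed

lemma linear_map_eqI:
  assumes "F \<in> linear_maps T U" "G \<in> linear_maps T U"
    and "\<And>a b. a \<in> carrier A \<Longrightarrow> b \<in> carrier B \<Longrightarrow> F (pure a b) = G (pure a b)" "t \<in> carrier T"
  shows "F t = G t"
  using assms(4)
  by (induct rule: tensor_induct)
    (simp_all add: assms(3) linear_map_add[OF assms(1)] linear_map_add[OF assms(2)])

lemma algebra_homI:
  assumes F: "F \<in> linear_maps T U" and U: "k_algebra U"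
    and mult: "\<And>a a' b b'. a \<in> carrier A \<Longrightarrow> a' \<in> carrier A \<Longrightarrow> b \<in> carrier B \<Longrightarrow> b' \<in> carrier B \<Longrightarrow>
      F (pure (a \<otimes>\<^bsub>A\<^esub> a') (b \<otimes>\<^bsub>B\<^esub> b')) = F (pure a b) \<otimes>\<^bsub>U\<^esub> F (pure a' b')"
    and one: "F (pure \<one>\<^bsub>A\<^esub> \<one>\<^bsub>B\<^esub>) = \<one>\<^bsub>U\<^esub>"
  shows "F \<in> algebra_homs T U"
proof (rule algebra_homsI[OF F])
  interpret U: k_algebra U by fact
  show "F \<one>\<^bsub>T\<^esub> = \<one>\<^bsub>U\<^esub>" by (simp add: one_eq_pure one)
  note Fc = linear_map_closed[OF F] and Fa = linear_map_add[OF F]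
  have 1: "F (pure a b \<otimes>\<^bsub>T\<^esub> t) = F (pure a b) \<otimes>\<^bsub>U\<^esub> F t"
    if ab: "a \<in> carrier A" "b \<in> carrier B" and t: "t \<in> carrier T" for a b t
    using t by (induct rule: tensor_induct) (use ab in \<open>simp_all add: pure_mult mult Fc Fa T.r_distr U.r_distr\<close>)
  fix s t assume s: "s \<in> carrier T" and t: "t \<in> carrier T"
  show "F (s \<otimes>\<^bsub>T\<^esub> t) = F s \<otimes>\<^bsub>U\<^esub> F t"
    using s by (induct rule: tensor_induct) (use t in \<open>simp_all add: 1 Fc Fa T.l_distr U.l_distr\<close>)
qed

text \<open>
  For a bilinear map each of the four kinds of relations is sent to zero. This is all that the universal
  property \<open>lift_linear\<close>, \<open>lift_pure\<close> needs.
\<close>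

lemma null_vanishes:
  assumes U: "k_algebra U" and f: "f \<in> bilinear_maps A B U" and p: "p \<in> N"
  shows "lin_ext U (\<lambda>(a, b). f a b) p = \<zero>\<^bsub>U\<^esub>"
proof -
  interpret U: k_algebra U by fact
  let ?f = "\<lambda>(a, b). f a b"
  let ?F = "lin_ext U ?f"
  have fc: "f a b \<in> carrier U" if "a \<in> carrier A" "b \<in> carrier B" for a b
    using linear_map_closed[OF bilinear_map_right[OF f that(1)] that(2)] .
  have lin: "?F \<in> linear_maps Free U" using fc by (intro lin_ext_linear U) auto
  have F1: "?F (Poly_Mapping.single (a, b) c) = c \<odot>\<^bsub>U\<^esub> f a b" if "a \<in> carrier A" "b \<in> carrier B" for a b c
    by (subst lin_ext_single) (use fc that U in auto)
  have Fd: "?F (p - q) = ?F p \<ominus>\<^bsub>U\<^esub> ?F q"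
    if "Poly_Mapping.keys p \<subseteq> carrier A \<times> carrier B" "Poly_Mapping.keys q \<subseteq> carrier A \<times> carrier B" for p q
    using linear_map_diff[OF U lin] that by simp
  note l = linear_map_add[OF bilinear_map_left[OF f]] linear_map_scale[OF bilinear_map_left[OF f]]
    linear_map_add[OF bilinear_map_right[OF f]] linear_map_scale[OF bilinear_map_right[OF f]]
  have cancel: "x \<oplus>\<^bsub>U\<^esub> y \<ominus>\<^bsub>U\<^esub> x \<ominus>\<^bsub>U\<^esub> y = \<zero>\<^bsub>U\<^esub>" if "x \<in> carrier U" "y \<in> carrier U" for x y
  proof -
    have "x \<oplus>\<^bsub>U\<^esub> y \<ominus>\<^bsub>U\<^esub> x = y" using that U.a_comm[of x y] by (simp add: U.minus_eq U.a_assoc U.r_neg)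
    with that show ?thesis by (simp add: U.minus_eq U.r_neg)
  qed
  have s: "Poly_Mapping.keys (Poly_Mapping.single (a, b) c :: 'a \<times> 'b \<Rightarrow>\<^sub>0 'k) \<subseteq> carrier A \<times> carrier B"
    if "a \<in> carrier A" "b \<in> carrier B" for a b c using that by simp
  show ?thesis
    using p
  proof (induct rule: tensor_null.induct)
    case zero
    then show ?case using linear_map_zero[OF lin Q.k_algebra_axioms U] by simp
  next
    case (add p q)
    then show ?case using linear_map_add[OF lin, of p q] by (simp add: null_keys)
  next
    case (add_left u v w c)
    then show ?case
      by (simp add: Fd s keys_diff_subset F1 l U.scale_add_right fc cancel del: keys_single)
  next
    case (add_right u v w c)
    then show ?case
      by (simp add: Fd s keys_diff_subset F1 l U.scale_add_right fc cancel del: keys_single)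
  next
    case (smult_left u w a c)
    then show ?case
      by (simp add: Fd s F1 l fc U.minus_eq U.r_neg mult.commute del: keys_single)
  next
    case (smult_right u w a c)
    then show ?case
      by (simp add: Fd s F1 l fc U.minus_eq U.r_neg mult.commute del: keys_single)
  qed
qed

lemma
  assumes U: "k_algebra U" and f: "f \<in> bilinear_maps A B U"
  shows lift_linear: "tensor_lift U f \<in> linear_maps T U"
    and lift_pure: "a \<in> carrier A \<Longrightarrow> b \<in> carrier B \<Longrightarrow> tensor_lift U f (pure a b) = f a b"
proof -
  have fc: "f a b \<in> carrier U" if "a \<in> carrier A" "b \<in> carrier B" for a b
    using linear_map_closed[OF bilinear_map_right[OF f that(1)] that(2)] .
  interpret E: monoid_algebra_ideal "A \<times>\<times> B" N U "\<lambda>(a, b). f a b"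
    by (intro monoid_algebra_ideal.intro monoid_prod Q.algebra_ideal_axioms
      monoid_algebra_ideal_axioms.intro U null_vanishes[OF U f]) (use fc in auto)
  show "tensor_lift U f \<in> linear_maps T U"
    unfolding tensor_lift_def tensor_algebra_def by (rule E.coset_ext_linear)
  interpret U: k_algebra U by fact
  assume ab: "a \<in> carrier A" "b \<in> carrier B"
  then show "tensor_lift U f (pure a b) = f a b"
    unfolding tensor_lift_def pure_eq by (subst E.coset_ext_coset) (auto simp: lin_ext_single[OF U] fc)
qed

end

lemma tensorI: "k_algebra A \<Longrightarrow> k_algebra B \<Longrightarrow> tensor A B"
  by (rule tensor.intro)

lemma
  assumes C: "k_algebra C" and D: "k_algebra D" and A: "k_algebra A" and B: "k_algebra B"
    and f: "f \<in> linear_maps C A" and g: "g \<in> linear_maps D B"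
  shows tensor_map_linear: "tensor_map A B f g \<in> linear_maps (tensor_algebra C D) (tensor_algebra A B)"
    and tensor_map_pure: "c \<in> carrier C \<Longrightarrow> d \<in> carrier D \<Longrightarrow>
      tensor_map A B f g (pure_tensor C D c d) = pure_tensor A B (f c) (g d)"
proof -
  interpret S: tensor C D by (rule tensorI[OF C D])
  interpret T: tensor A B by (rule tensorI[OF A B])
  have "(\<lambda>c d. T.pure (f c) (g d)) \<in> bilinear_maps C D T.T"
    using linear_map_comp[OF f bilinear_map_left[OF T.pure_bilinear]]
      linear_map_comp[OF g bilinear_map_right[OF T.pure_bilinear]]
    by (intro bilinear_mapsI) (auto simp: linear_map_closed[OF f] linear_map_closed[OF g])
  from S.lift_linear[OF T.k_algebra_tensor this] S.lift_pure[OF T.k_algebra_tensor this]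
  show "tensor_map A B f g \<in> linear_maps (tensor_algebra C D) (tensor_algebra A B)"
    and "c \<in> carrier C \<Longrightarrow> d \<in> carrier D \<Longrightarrow>
      tensor_map A B f g (pure_tensor C D c d) = pure_tensor A B (f c) (g d)"
    by (simp_all add: tensor_map_def)
qed

lemma tensor_map_hom:
  assumes "k_algebra C" "k_algebra D" "k_algebra A" "k_algebra B"
    and f: "f \<in> algebra_homs C A" and g: "g \<in> algebra_homs D B"
  shows "tensor_map A B f g \<in> algebra_homs (tensor_algebra C D) (tensor_algebra A B)"
proof -
  interpret S: tensor C D by (intro tensorI assms)
  interpret T: tensor A B by (intro tensorI assms)
  note fg = algebra_hom_linear[OF f] algebra_hom_linear[OF g]
  note p = tensor_map_pure[OF assms(1-4) fg]
  show ?thesis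
    by (rule S.algebra_homI[OF tensor_map_linear[OF assms(1-4) fg] T.k_algebra_tensor])
      (simp_all add: p T.pure_mult algebra_hom_closed[OF f] algebra_hom_closed[OF g]
        algebra_hom_mult[OF f] algebra_hom_mult[OF g] algebra_hom_one[OF f] algebra_hom_one[OF g] T.one_eq_pure)
qed

lemma
  assumes A: "k_algebra A" and B: "k_algebra B" and C: "k_algebra C"
  shows tensor_assoc_hom: "tensor_assoc A B C \<in> algebra_homs
      (tensor_algebra (tensor_algebra A B) C) (tensor_algebra A (tensor_algebra B C))"
    and tensor_assoc_pure: "a \<in> carrier A \<Longrightarrow> b \<in> carrier B \<Longrightarrow> c \<in> carrier C \<Longrightarrow>
      tensor_assoc A B C (pure_tensor (tensor_algebra A B) C (pure_tensor A B a b) c) =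
      pure_tensor A (tensor_algebra B C) a (pure_tensor B C b c)"
proof -
  interpret AB: tensor A B by (rule tensorI[OF A B])
  interpret BC: tensor B C by (rule tensorI[OF B C])
  interpret ABC: tensor AB.T C by (rule tensorI[OF AB.k_algebra_tensor C])
  interpret ABC': tensor A BC.T by (rule tensorI[OF A BC.k_algebra_tensor])
  let ?f = "\<lambda>c a b. ABC'.pure a (BC.pure b c)"
  have f: "?f c \<in> bilinear_maps A B ABC'.T" if "c \<in> carrier C" for c
    using that linear_map_comp[OF bilinear_map_left[OF BC.pure_bilinear that]
      bilinear_map_right[OF ABC'.pure_bilinear]] bilinear_map_left[OF ABC'.pure_bilinear]
    by (intro bilinear_mapsI) auto
  note lin = AB.lift_linear[OF ABC'.k_algebra_tensor f]
    and pure = AB.lift_pure[OF ABC'.k_algebra_tensor f]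
  let ?g = "\<lambda>t c. tensor_lift ABC'.T (?f c) t"
  have closed: "?g t c \<in> carrier ABC'.T" if "t \<in> carrier AB.T" "c \<in> carrier C" for t c
    using linear_map_closed[OF lin] that by blast
  \<comment> \<open>For pure \<open>t\<close> linearity in the last factor is bilinearity of \<open>\<otimes>\<close>; it is then extended by additivity in \<open>t\<close>.\<close>
  have "?g t \<in> linear_maps C ABC'.T" if "t \<in> carrier AB.T" for t
  proof (rule linear_mapsI)
    fix a c d assume c: "c \<in> carrier C"
    show "?g t c \<in> carrier ABC'.T" using closed that c by blast
    show "?g t (a \<odot>\<^bsub>C\<^esub> c) = a \<odot>\<^bsub>ABC'.T\<^esub> ?g t c"
      using that c
      by (induct rule: AB.tensor_induct)
        (simp_all add: pure BC.pure_scale ABC'.pure_scale linear_map_add[OF lin] closed ABC'.T.scale_add_right)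
    assume d: "d \<in> carrier C"
    show "?g t (c \<oplus>\<^bsub>C\<^esub> d) = ?g t c \<oplus>\<^bsub>ABC'.T\<^esub> ?g t d"
      using that c d
      by (induct rule: AB.tensor_induct)
        (simp_all add: pure BC.pure_add_right ABC'.pure_add_right linear_map_add[OF lin] closed ABC'.T.a_ac)
  qed
  then have g: "?g \<in> bilinear_maps AB.T C ABC'.T"
    using lin by (intro bilinear_mapsI) auto
  have eq: "tensor_assoc A B C = tensor_lift ABC'.T ?g"
    by (simp add: tensor_assoc_def Let_def)
  note lin' = ABC.lift_linear[OF ABC'.k_algebra_tensor g, folded eq]
    and pure' = ABC.lift_pure[OF ABC'.k_algebra_tensor g, folded eq]
  show **: "tensor_assoc A B C (ABC.pure (AB.pure a b) c) = ABC'.pure a (BC.pure b c)"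
    if "a \<in> carrier A" "b \<in> carrier B" "c \<in> carrier C" for a b c
    using that by (simp add: pure' pure)
  show "tensor_assoc A B C \<in> algebra_homs ABC.T ABC'.T"
  proof (rule ABC.algebra_homI[OF lin' ABC'.k_algebra_tensor])
    show "tensor_assoc A B C (ABC.pure \<one>\<^bsub>AB.T\<^esub> \<one>\<^bsub>C\<^esub>) = \<one>\<^bsub>ABC'.T\<^esub>"
      by (simp add: AB.one_eq_pure ABC'.one_eq_pure BC.one_eq_pure **)
    fix s t c d assume s: "s \<in> carrier AB.T" and t: "t \<in> carrier AB.T" and c: "c \<in> carrier C" and d: "d \<in> carrier C"
    let ?L = "\<lambda>s t. tensor_assoc A B C (ABC.pure (s \<otimes>\<^bsub>AB.T\<^esub> t) (c \<otimes>\<^bsub>C\<^esub> d)) =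
      tensor_assoc A B C (ABC.pure s c) \<otimes>\<^bsub>ABC'.T\<^esub> tensor_assoc A B C (ABC.pure t d)"
    note cl = linear_map_closed[OF lin'] and ad = linear_map_add[OF lin']
    have 1: "?L (AB.pure a b) t" if ab: "a \<in> carrier A" "b \<in> carrier B" for a b
      using t by (induct rule: AB.tensor_induct)
        (use ab c d in \<open>simp_all add: AB.pure_mult ** ABC'.pure_mult BC.pure_mult AB.T.r_distr
          ABC.pure_add_left ad cl ABC'.T.r_distr\<close>)
    show "?L s t"
      using s by (induct rule: AB.tensor_induct)
        (use 1 t c d in \<open>simp_all add: AB.T.l_distr ABC.pure_add_left ad cl ABC'.T.l_distr\<close>)
  qed
qed

section \<open>Hopf algebras and their maps on generators\<close>

definition grouplike :: "('k::field, 'a) hopf \<Rightarrow> 'a \<Rightarrow> bool" where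
  "grouplike H g \<longleftrightarrow> g \<in> carrier H \<and> comult H g = pure_tensor H H g g \<and> counit H g = 1"

definition skew_primitive :: "('k::field, 'a) hopf \<Rightarrow> 'a \<Rightarrow> 'a \<Rightarrow> bool" where
  "skew_primitive H g y \<longleftrightarrow> y \<in> carrier H \<and> counit H y = 0 \<and>
     comult H y = pure_tensor H H y \<one>\<^bsub>H\<^esub> \<oplus>\<^bsub>tensor_algebra H H\<^esub> pure_tensor H H g y"

lemma hopf_k_algebra: "hopf_algebra H \<Longrightarrow> k_algebra H"
  by (simp add: hopf_algebra_def unital_algebra_iff)

lemma hopf_homs_algebra: "f \<in> hopf_homs H L \<Longrightarrow> f \<in> algebra_homs H L"
  by (simp add: hopf_homs_def)

text \<open>
  For an algebra with homomorphisms \<open>comult\<close>, \<open>counit\<close> and an anti-homomorphism \<open>antipode\<close>, all axioms of a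
  Hopf algebra can be tested on generators. The generators that occur here are of two kinds: group-like
  ones, with the inverse as antipode, and skew-primitive ones, whose antipode is then forced.
\<close>

locale hopf_generators = k_algebra H for H :: "('k::field, 'a) hopf" (structure) +
  fixes S :: "'a set"
  assumes comult: "comult H \<in> algebra_homs H (tensor_algebra H H)"
    and counit: "counit H \<in> algebra_homs H scalars"
    and antipode: "antipode H \<in> algebra_homs H (opposite H)"
    and gens: "S \<subseteq> carrier H" and generated: "\<And>h. h \<in> carrier H \<Longrightarrow> generated H S h"
    and cases: "\<And>y. y \<in> S \<Longrightarrow> grouplike H y \<and> antipode H y \<otimes> y = \<one> \<and> y \<otimes> antipode H y = \<one> \<or>
      (\<exists>g. grouplike H g \<and> antipode H g \<otimes> g = \<one> \<and> g \<otimes> antipode H g = \<one> \<and>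
        skew_primitive H g y \<and> antipode H y = \<ominus> (antipode H g \<otimes> y))"
begin

sublocale HH: tensor H H by (rule tensorI[OF k_algebra_axioms k_algebra_axioms])
sublocale L: tensor "HH.T" H by (rule tensorI[OF HH.k_algebra_tensor k_algebra_axioms])
sublocale R: tensor H "HH.T" by (rule tensorI[OF k_algebra_axioms HH.k_algebra_tensor])

lemmas counit_rules = algebra_hom_mult[OF counit, simplified] algebra_hom_add[OF counit, simplified]
  algebra_hom_scale[OF counit, simplified] algebra_hom_one[OF counit, simplified]

lemmas antipode_rules = algebra_hom_mult[OF antipode, simplified] algebra_hom_add[OF antipode, simplified]
  algebra_hom_scale[OF antipode, simplified] algebra_hom_one[OF antipode, simplified]

lemma antipode_closed [simp]: "x \<in> carrier H \<Longrightarrow> antipode H x \<in> carrier H"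
  using algebra_hom_closed[OF antipode] by simp

lemma comult_closed [simp]: "x \<in> carrier H \<Longrightarrow> comult H x \<in> carrier HH.T"
  using algebra_hom_closed[OF comult] by simp

text \<open>
  Both sides are algebra homomorphisms in \<open>h\<close>, so only generators have to be compared.
\<close>

lemma coassociative:
  assumes h: "h \<in> carrier H"
  shows "tensor_assoc H H H (tensor_map HH.T H (comult H) id (comult H h)) =
    tensor_map H HH.T id (comult H) (comult H h)"
proof (rule algebra_hom_eqI[where f = "\<lambda>h. tensor_assoc H H H (tensor_map HH.T H (comult H) id (comult H h))"
    and g = "\<lambda>h. tensor_map H HH.T id (comult H) (comult H h)", OF k_algebra_axioms gens generated _ _ _ h])
  note k = k_algebra_axioms HH.k_algebra_tensor
  note l1 = tensor_map_linear[OF k(1) k(1) k(2) k(1) algebra_hom_linear[OF comult] linear_map_id]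
    and r1 = tensor_map_linear[OF k(1) k(1) k(1) k(2) linear_map_id algebra_hom_linear[OF comult]]
    and a1 = algebra_hom_linear[OF tensor_assoc_hom[OF k(1) k(1) k(1)]]
  note l2 = tensor_map_pure[OF k(1) k(1) k(2) k(1) algebra_hom_linear[OF comult] linear_map_id]
    and r2 = tensor_map_pure[OF k(1) k(1) k(1) k(2) linear_map_id algebra_hom_linear[OF comult]]
    and a2 = tensor_assoc_pure[OF k(1) k(1) k(1)]
  show "(\<lambda>h. tensor_assoc H H H (tensor_map HH.T H (comult H) id (comult H h))) \<in> algebra_homs H R.T"
    by (intro algebra_hom_comp[OF algebra_hom_comp[OF comult tensor_map_hom[OF k(1) k(1) k(2) k(1) comult algebra_hom_id]]
      tensor_assoc_hom[OF k(1) k(1) k(1)]])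
  show "(\<lambda>h. tensor_map H HH.T id (comult H) (comult H h)) \<in> algebra_homs H R.T"
    by (intro algebra_hom_comp[OF comult tensor_map_hom[OF k(1) k(1) k(1) k(2) algebra_hom_id comult]])
  fix y assume y: "y \<in> S"
  have one: "comult H \<one> = HH.pure \<one> \<one>" using algebra_hom_one[OF comult] by (simp add: HH.one_eq_pure)
  from cases[OF y] show "tensor_assoc H H H (tensor_map HH.T H (comult H) id (comult H y)) =
    tensor_map H HH.T id (comult H) (comult H y)"
  proof (elim disjE exE conjE)
    assume "grouplike H y"
    then show ?thesis by (simp add: grouplike_def l2 r2 a2)
  next
    fix g assume "grouplike H g" "skew_primitive H g y"
    then show ?thesis
      by (simp add: grouplike_def skew_primitive_def linear_map_add[OF l1] linear_map_add[OF r1]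
          linear_map_add[OF a1] linear_map_closed[OF l1] L.pure_add_left R.pure_add_right
          R.T.a_assoc l2 r2 a2 one)
  qed
qed

lemma counital:
  assumes h: "h \<in> carrier H"
  shows "tensor_lift H (\<lambda>a b. counit H a \<odot> b) (comult H h) = h"
    and "tensor_lift H (\<lambda>a b. counit H b \<odot> a) (comult H h) = h"
proof -
  have 1: "(\<lambda>a b. counit H a \<odot> b) \<in> bilinear_maps H H H"
    by (intro bilinear_mapsI linear_mapsI) (simp_all add: counit_rules scale_add_left scale_add_right mult.commute)
  have 2: "(\<lambda>a b. counit H b \<odot> a) \<in> bilinear_maps H H H"
    by (intro bilinear_mapsI linear_mapsI) (simp_all add: counit_rules scale_add_left scale_add_right mult.commute)
  note l = HH.lift_linear[OF k_algebra_axioms 1] HH.lift_pure[OF k_algebra_axioms 1]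
    HH.lift_linear[OF k_algebra_axioms 2] HH.lift_pure[OF k_algebra_axioms 2]
  have h1: "tensor_lift H (\<lambda>a b. counit H a \<odot> b) \<in> algebra_homs HH.T H"
    by (rule HH.algebra_homI[OF l(1) k_algebra_axioms]) (simp_all add: l counit_rules mult.commute)
  have h2: "tensor_lift H (\<lambda>a b. counit H b \<odot> a) \<in> algebra_homs HH.T H"
    by (rule HH.algebra_homI[OF l(3) k_algebra_axioms]) (simp_all add: l counit_rules mult.commute)
  have "tensor_lift H (\<lambda>a b. counit H a \<odot> b) (comult H h) = id h"
  proof (rule algebra_hom_eqI[where f = "\<lambda>h. tensor_lift H (\<lambda>a b. counit H a \<odot> b) (comult H h)",
      OF k_algebra_axioms gens generated algebra_hom_comp[OF comult h1] algebra_hom_id _ h])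
    fix y assume y: "y \<in> S"
    from cases[OF y] show "tensor_lift H (\<lambda>a b. counit H a \<odot> b) (comult H y) = id y"
      by (elim disjE exE conjE) (simp_all add: grouplike_def skew_primitive_def l linear_map_add[OF l(1)])
  qed
  then show "tensor_lift H (\<lambda>a b. counit H a \<odot> b) (comult H h) = h" by simp
  have "tensor_lift H (\<lambda>a b. counit H b \<odot> a) (comult H h) = id h"
  proof (rule algebra_hom_eqI[where f = "\<lambda>h. tensor_lift H (\<lambda>a b. counit H b \<odot> a) (comult H h)",
      OF k_algebra_axioms gens generated algebra_hom_comp[OF comult h2] algebra_hom_id _ h])
    fix y assume y: "y \<in> S"
    from cases[OF y] show "tensor_lift H (\<lambda>a b. counit H b \<odot> a) (comult H y) = id y"
      by (elim disjE exE conjE) (simp_all add: grouplike_def skew_primitive_def l linear_map_add[OF l(3)] counit_rules)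
  qed
  then show "tensor_lift H (\<lambda>a b. counit H b \<odot> a) (comult H h) = h" by simp
qed

text \<open>
  The two sides are not multiplicative in \<open>h\<close>, but they behave well when \<open>h\<close> is multiplied by a generator \<open>y\<close>
  from the left. In the left identity the anti-multiplicative antipode puts the
  factors of \<open>comult y\<close> next to each other, where they collapse to \<open>counit y\<close>. In the right identity they
  surround the value at \<open>h\<close>, which is a scalar by induction and can be moved out of the way.
\<close>

lemma antipode_identities:
  assumes h: "h \<in> carrier H"
  shows "tensor_lift H (\<lambda>a b. antipode H a \<otimes> b) (comult H h) = counit H h \<odot> \<one>"
    and "tensor_lift H (\<lambda>a b. a \<otimes> antipode H b) (comult H h) = counit H h \<odot> \<one>"
proof -
  have 1: "(\<lambda>a b. antipode H a \<otimes> b) \<in> bilinear_maps H H H"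
    by (intro bilinear_mapsI linear_mapsI) (simp_all add: antipode_rules l_distr r_distr)
  have 2: "(\<lambda>a b. a \<otimes> antipode H b) \<in> bilinear_maps H H H"
    by (intro bilinear_mapsI linear_mapsI) (simp_all add: antipode_rules l_distr r_distr)
  let ?l = "tensor_lift H (\<lambda>a b. antipode H a \<otimes> b)" and ?r = "tensor_lift H (\<lambda>a b. a \<otimes> antipode H b)"
  note l = HH.lift_linear[OF k_algebra_axioms 1] and r = HH.lift_linear[OF k_algebra_axioms 2]
  note lp = HH.lift_pure[OF k_algebra_axioms 1] and rp = HH.lift_pure[OF k_algebra_axioms 2]
  note lin = linear_map_add[OF l] linear_map_add[OF r] linear_map_closed[OF l] linear_map_closed[OF r]
    linear_map_scale[OF l] linear_map_scale[OF r]
  have cancel: "antipode H g \<otimes> (g \<otimes> b) = b" "g \<otimes> (antipode H g \<otimes> b) = b"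
    if "antipode H g \<otimes> g = \<one>" "g \<otimes> antipode H g = \<one>" "g \<in> carrier H" "b \<in> carrier H" for g b
    using that by (simp_all flip: m_assoc)
  have l1: "?l (comult H y \<otimes>\<^bsub>HH.T\<^esub> t) = counit H y \<odot> ?l t" if y: "y \<in> S" and t: "t \<in> carrier HH.T" for y t
    using t
  proof (induct rule: HH.tensor_induct)
    case (pure a b)
    from cases[OF y] show ?case
    proof (elim disjE exE conjE)
      assume "grouplike H y" "antipode H y \<otimes> y = \<one>" "y \<otimes> antipode H y = \<one>"
      with pure show ?thesis
        by (simp add: grouplike_def HH.pure_mult lp antipode_rules m_assoc cancel)
    next
      fix g assume "grouplike H g" "antipode H g \<otimes> g = \<one>" "g \<otimes> antipode H g = \<one>" "skew_primitive H g y"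
        "antipode H y = \<ominus> (antipode H g \<otimes> y)"
      with pure show ?thesis
        by (simp add: grouplike_def skew_primitive_def HH.T.l_distr HH.pure_mult lp lin antipode_rules
          m_assoc l_minus r_minus l_neg)
    qed
  next
    case (add s t)
    moreover have "y \<in> carrier H" using y gens by auto
    ultimately show ?case by (simp add: HH.T.r_distr lin scale_add_right)
  qed
  from generated[OF h] show "?l (comult H h) = counit H h \<odot> \<one>"
  proof induct
    case (gen y)
    then have "y \<in> carrier H" using gens by auto
    then show ?case
      using l1[OF gen, of "\<one>\<^bsub>HH.T\<^esub>"] by (simp add: HH.one_eq_pure[symmetric], simp add: HH.one_eq_pure lp antipode_rules)
  next
    case one
    show ?case using algebra_hom_one[OF comult] by (simp add: HH.one_eq_pure lp antipode_rules counit_rules)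
  next
    case (mult x y)
    then have "x \<in> carrier H" "y \<in> carrier H" using gens generated_closed[OF k_algebra_axioms gens] by auto
    with mult show ?case by (simp add: algebra_hom_mult[OF comult] l1 counit_rules)
  next
    case (add x y)
    then have "x \<in> carrier H" "y \<in> carrier H" using generated_closed[OF k_algebra_axioms gens] by auto
    with add show ?case by (simp add: algebra_hom_add[OF comult] lin counit_rules scale_add_left)
  next
    case (scale x a)
    then have "x \<in> carrier H" using generated_closed[OF k_algebra_axioms gens] by auto
    with scale show ?case by (simp add: algebra_hom_scale[OF comult] lin counit_rules)
  qed
  have rg: "?r (HH.pure g g \<otimes>\<^bsub>HH.T\<^esub> t) = g \<otimes> ?r t \<otimes> antipode H g"
    if g: "g \<in> carrier H" and t: "t \<in> carrier HH.T" for g t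
    using t by (induct rule: HH.tensor_induct)
      (use g in \<open>simp_all add: HH.T.r_distr HH.pure_mult rp lin antipode_rules m_assoc l_distr r_distr\<close>)
  have rs: "?r ((HH.pure y \<one> \<oplus>\<^bsub>HH.T\<^esub> HH.pure g y) \<otimes>\<^bsub>HH.T\<^esub> t) = y \<otimes> ?r t \<oplus> g \<otimes> ?r t \<otimes> antipode H y"
    if g: "g \<in> carrier H" "y \<in> carrier H" and t: "t \<in> carrier HH.T" for g y t
    using t by (induct rule: HH.tensor_induct)
      (use g in \<open>simp_all add: HH.T.r_distr HH.T.l_distr HH.pure_mult rp lin antipode_rules m_assoc l_distr r_distr a_ac\<close>)
  have r1: "?r (comult H y \<otimes>\<^bsub>HH.T\<^esub> t) = (counit H y * c) \<odot> \<one>"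
    if y: "y \<in> S" and t: "t \<in> carrier HH.T" and rt: "?r t = c \<odot> \<one>" for y t c
    using cases[OF y]
  proof (elim disjE exE conjE)
    assume "grouplike H y" "antipode H y \<otimes> y = \<one>" "y \<otimes> antipode H y = \<one>"
    with t rt show ?thesis by (simp add: grouplike_def rg)
  next
    fix g assume "grouplike H g" "antipode H g \<otimes> g = \<one>" "g \<otimes> antipode H g = \<one>" "skew_primitive H g y"
      "antipode H y = \<ominus> (antipode H g \<otimes> y)"
    with t rt show ?thesis
      by (simp add: grouplike_def skew_primitive_def rs r_minus cancel scale_minus_right scale_minus_left r_neg)
  qed
  have r_one: "?r \<one>\<^bsub>HH.T\<^esub> = 1 \<odot> \<one>" by (simp add: HH.one_eq_pure rp antipode_rules)
  from generated[OF h] show "?r (comult H h) = counit H h \<odot> \<one>"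
  proof induct
    case (gen y)
    then have "y \<in> carrier H" using gens by auto
    then show ?case
      using r1[OF gen _ r_one] by (simp add: HH.one_eq_pure[symmetric])
  next
    case one
    show ?case using algebra_hom_one[OF comult] r_one by (simp add: counit_rules)
  next
    case (mult x y)
    then have "x \<in> carrier H" "y \<in> carrier H" using gens generated_closed[OF k_algebra_axioms gens] by auto
    with mult show ?case by (simp add: algebra_hom_mult[OF comult] r1 counit_rules)
  next
    case (add x y)
    then have "x \<in> carrier H" "y \<in> carrier H" using generated_closed[OF k_algebra_axioms gens] by auto
    with add show ?case by (simp add: algebra_hom_add[OF comult] lin counit_rules scale_add_left)
  next
    case (scale x a)
    then have "x \<in> carrier H" using generated_closed[OF k_algebra_axioms gens] by auto
    with scale show ?case by (simp add: algebra_hom_scale[OF comult] lin counit_rules)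
  qed
qed

lemma hopf_algebra: "hopf_algebra H"
proof (intro hopf_algebra.intro hopf_algebra_axioms.intro)
  show "antipode H \<in> linear_maps H H"
    using algebra_hom_linear[OF antipode] by (simp add: linear_maps_def)
qed (simp_all add: unital_algebra_iff k_algebra_axioms comult counit coassociative counital antipode_identities)

end

text \<open>
  Compatibility with comultiplication and counit is an equality of algebra homomorphisms.
\<close>

lemma hopf_homI_generators:
  assumes H: "hopf_algebra H" and L: "hopf_algebra L"
    and S: "S \<subseteq> carrier H" "\<And>h. h \<in> carrier H \<Longrightarrow> generated H S h"
    and f: "f \<in> algebra_homs H L"
    and gens: "\<And>y. y \<in> S \<Longrightarrow> grouplike H y \<and> grouplike L (f y) \<or>
      (\<exists>g\<in>carrier H. skew_primitive H g y \<and> skew_primitive L (f g) (f y))"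
  shows "f \<in> hopf_homs H L"
proof -
  note k = hopf_k_algebra[OF H] hopf_k_algebra[OF L]
  interpret H: k_algebra H by fact
  interpret L: k_algebra L by fact
  interpret HH: tensor H H by (intro tensorI k)
  interpret LL: tensor L L by (intro tensorI k)
  note m = tensor_map_hom[OF k(1) k(1) k(2) k(2) f f]
  note p = tensor_map_pure[OF k(1) k(1) k(2) k(2) algebra_hom_linear[OF f] algebra_hom_linear[OF f]]
  have 1: "comult L (f h) = tensor_map L L f f (comult H h)" if "h \<in> carrier H" for h
  proof (rule algebra_hom_eqI[where f = "\<lambda>h. comult L (f h)", OF k(1) S
      algebra_hom_comp[OF f hopf_algebra.comult_algebra_hom[OF L]]
      algebra_hom_comp[OF hopf_algebra.comult_algebra_hom[OF H] m] _ that])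
    fix y assume "y \<in> S"
    from gens[OF this] show "comult L (f y) = tensor_map L L f f (comult H y)"
      by (auto simp: grouplike_def skew_primitive_def p algebra_hom_add[OF m] algebra_hom_one[OF f])
  qed
  have 2: "counit L (f h) = counit H h" if "h \<in> carrier H" for h
  proof (rule algebra_hom_eqI[where f = "\<lambda>h. counit L (f h)", OF k(1) S
      algebra_hom_comp[OF f hopf_algebra.counit_algebra_hom[OF L]]
      hopf_algebra.counit_algebra_hom[OF H] _ that])
    fix y assume "y \<in> S"
    from gens[OF this] show "counit L (f y) = counit H y"
      by (auto simp: grouplike_def skew_primitive_def)
  qed
  from 1 2 f show ?thesis by (simp add: hopf_homs_def)
qed

lemma hopf_hom_grouplike:
  assumes "f \<in> hopf_homs H L" "hopf_algebra H" "hopf_algebra L" "grouplike H g"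
  shows "grouplike L (f g)"
proof -
  note k = hopf_k_algebra[OF assms(2)] hopf_k_algebra[OF assms(3)]
  note f = hopf_homs_algebra[OF assms(1)]
  note p = tensor_map_pure[OF k(1) k(1) k(2) k(2) algebra_hom_linear[OF f] algebra_hom_linear[OF f]]
  show ?thesis using assms(1,4) f by (auto simp: grouplike_def hopf_homs_def p algebra_hom_closed)
qed

lemma hopf_hom_skew_primitive:
  assumes "f \<in> hopf_homs H L" "hopf_algebra H" "hopf_algebra L" "skew_primitive H g y" "g \<in> carrier H"
  shows "skew_primitive L (f g) (f y)"
proof -
  note k = hopf_k_algebra[OF assms(2)] hopf_k_algebra[OF assms(3)]
  interpret H: k_algebra H by fact
  interpret HH: tensor H H by (intro tensorI k)
  note f = hopf_homs_algebra[OF assms(1)]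
  note m = tensor_map_linear[OF k(1) k(1) k(2) k(2) algebra_hom_linear[OF f] algebra_hom_linear[OF f]]
  note p = tensor_map_pure[OF k(1) k(1) k(2) k(2) algebra_hom_linear[OF f] algebra_hom_linear[OF f]]
  show ?thesis using assms(1,4,5) f
    by (auto simp: skew_primitive_def hopf_homs_def p algebra_hom_closed linear_map_add[OF m] algebra_hom_one[OF f])
qed

lemma grouplike_one: "hopf_algebra H \<Longrightarrow> grouplike H \<one>\<^bsub>H\<^esub>"
proof -
  assume H: "hopf_algebra H"
  note k = hopf_k_algebra[OF H]
  interpret H: k_algebra H by fact
  interpret HH: tensor H H by (intro tensorI k)
  show ?thesis
    using algebra_hom_one[OF hopf_algebra.comult_algebra_hom[OF H]]
      algebra_hom_one[OF hopf_algebra.counit_algebra_hom[OF H]]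
    by (simp add: grouplike_def HH.one_eq_pure)
qed

lemma grouplike_mult:
  assumes H: "hopf_algebra H" and gh: "grouplike H g" "grouplike H h"
  shows "grouplike H (g \<otimes>\<^bsub>H\<^esub> h)"
proof -
  note k = hopf_k_algebra[OF H]
  interpret H: k_algebra H by fact
  interpret HH: tensor H H by (intro tensorI k)
  show ?thesis
    using gh algebra_hom_mult[OF hopf_algebra.comult_algebra_hom[OF H]]
      algebra_hom_mult[OF hopf_algebra.counit_algebra_hom[OF H]]
    by (simp add: grouplike_def HH.pure_mult)
qed

lemma grouplike_pow:
  assumes H: "hopf_algebra H" and "grouplike H g"
  shows "grouplike H (g [^]\<^bsub>H\<^esub> (m::nat))"
  by (induct m) (simp_all add: pow_0 pow_Suc grouplike_one[OF H] grouplike_mult[OF H] assms(2))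

section \<open>Isomorphism is an equivalence relation\<close>

lemma hopf_hom_id:
  assumes H: "hopf_algebra H"
  shows "id \<in> hopf_homs H H"
proof -
  note k = hopf_k_algebra[OF H]
  interpret HH: tensor H H by (intro tensorI k)
  have "tensor_map H H id id t = t" if "t \<in> carrier HH.T" for t
    using HH.linear_map_eqI[OF tensor_map_linear[OF k k k k linear_map_id linear_map_id] linear_map_id _ that]
      tensor_map_pure[OF k k k k linear_map_id linear_map_id] by simp
  then show ?thesis
    using algebra_hom_closed[OF hopf_algebra.comult_algebra_hom[OF H]]
    by (simp add: hopf_homs_def algebra_hom_id)
qed

lemma tensor_map_comp:
  assumes k: "k_algebra H" "k_algebra L" "k_algebra M"
    and f: "f \<in> linear_maps H L" and g: "g \<in> linear_maps L M" and t: "t \<in> carrier (tensor_algebra H H)"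
  shows "tensor_map M M g g (tensor_map L L f f t) = tensor_map M M (\<lambda>x. g (f x)) (\<lambda>x. g (f x)) t"
proof -
  interpret HH: tensor H H by (intro tensorI k)
  note gf = linear_map_comp[OF f g]
  note l = tensor_map_linear[OF k(1,1,2,2) f f] tensor_map_linear[OF k(2,2,3,3) g g]
    tensor_map_linear[OF k(1,1,3,3) gf gf]
  note p = tensor_map_pure[OF k(1,1,2,2) f f] tensor_map_pure[OF k(2,2,3,3) g g]
    tensor_map_pure[OF k(1,1,3,3) gf gf]
  show ?thesis
    by (rule HH.linear_map_eqI[OF linear_map_comp[OF l(1,2)] l(3) _ t])
      (simp add: p linear_map_closed[OF f])
qed

lemma hopf_hom_comp:
  assumes H: "hopf_algebra H" and L: "hopf_algebra L" and M: "hopf_algebra M"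
    and f: "f \<in> hopf_homs H L" and g: "g \<in> hopf_homs L M"
  shows "(\<lambda>x. g (f x)) \<in> hopf_homs H M"
proof -
  note k = hopf_k_algebra[OF H] hopf_k_algebra[OF L] hopf_k_algebra[OF M]
  note fg = hopf_homs_algebra[OF f] hopf_homs_algebra[OF g]
  note c = tensor_map_comp[OF k algebra_hom_linear[OF fg(1)] algebra_hom_linear[OF fg(2)]]
  show ?thesis
    using f g algebra_hom_comp[OF fg] c algebra_hom_closed[OF hopf_algebra.comult_algebra_hom[OF H]]
      algebra_hom_closed[OF fg(1)]
    by (simp add: hopf_homs_def)
qed

lemma inv_into_linear:
  assumes V: "k_algebra V" and f: "f \<in> linear_maps V W" and bij: "bij_betw f (carrier V) (carrier W)"
  shows "inv_into (carrier V) f \<in> linear_maps W V"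
proof -
  interpret V: k_algebra V by fact
  let ?i = "inv_into (carrier V) f"
  have ic: "?i y \<in> carrier V" if "y \<in> carrier W" for y
    using bij that by (metis bij_betw_def inv_into_into)
  have fi: "f (?i y) = y" if "y \<in> carrier W" for y
    using bij that by (simp add: bij_betw_inv_into_right)
  have if': "?i (f x) = x" if "x \<in> carrier V" for x
    using bij that by (simp add: bij_betw_inv_into_left)
  show ?thesis
  proof (rule linear_mapsI)
    fix x y a assume x: "x \<in> carrier W"
    show "?i x \<in> carrier V" using ic x .
    have "f (a \<odot>\<^bsub>V\<^esub> ?i x) = a \<odot>\<^bsub>W\<^esub> x" using linear_map_scale[OF f ic[OF x]] fi[OF x] by simp
    then show "?i (a \<odot>\<^bsub>W\<^esub> x) = a \<odot>\<^bsub>V\<^esub> ?i x" using if'[of "a \<odot>\<^bsub>V\<^esub> ?i x"] ic[OF x] by simp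
    assume y: "y \<in> carrier W"
    have "f (?i x \<oplus>\<^bsub>V\<^esub> ?i y) = x \<oplus>\<^bsub>W\<^esub> y" using linear_map_add[OF f ic[OF x] ic[OF y]] fi x y by simp
    then show "?i (x \<oplus>\<^bsub>W\<^esub> y) = ?i x \<oplus>\<^bsub>V\<^esub> ?i y" using if'[of "?i x \<oplus>\<^bsub>V\<^esub> ?i y"] ic x y by simp
  qed
qed

lemma hopf_hom_inv_into:
  assumes H: "hopf_algebra H" and L: "hopf_algebra L"
    and f: "f \<in> hopf_homs H L" and bij: "bij_betw f (carrier H) (carrier L)"
  shows "inv_into (carrier H) f \<in> hopf_homs L H"
proof -
  note k = hopf_k_algebra[OF H] hopf_k_algebra[OF L]
  interpret H: k_algebra H by fact
  interpret L: k_algebra L by fact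
  interpret HH: tensor H H by (intro tensorI k)
  note fa = hopf_homs_algebra[OF f]
  let ?i = "inv_into (carrier H) f"
  note i = inv_into_linear[OF k(1) algebra_hom_linear[OF fa] bij]
  note ic = linear_map_closed[OF i]
  have fi: "f (?i y) = y" if "y \<in> carrier L" for y
    using bij that by (simp add: bij_betw_inv_into_right)
  have if': "?i (f x) = x" if "x \<in> carrier H" for x
    using bij that by (simp add: bij_betw_inv_into_left)
  have ia: "?i \<in> algebra_homs L H"
  proof (rule algebra_homsI[OF i])
    show "?i \<one>\<^bsub>L\<^esub> = \<one>\<^bsub>H\<^esub>" using if'[of "\<one>\<^bsub>H\<^esub>"] algebra_hom_one[OF fa] by simp
    fix x y assume "x \<in> carrier L" "y \<in> carrier L"
    then show "?i (x \<otimes>\<^bsub>L\<^esub> y) = ?i x \<otimes>\<^bsub>H\<^esub> ?i y"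
      using if'[of "?i x \<otimes>\<^bsub>H\<^esub> ?i y"] algebra_hom_mult[OF fa ic ic] ic fi by simp
  qed
  have eq: "tensor_map H H ?i ?i (tensor_map L L f f t) = t" if t: "t \<in> carrier HH.T" for t
  proof -
    note l = linear_map_comp[OF algebra_hom_linear[OF fa] i]
    have "tensor_map H H (\<lambda>x. ?i (f x)) (\<lambda>x. ?i (f x)) t = id t"
      by (rule HH.linear_map_eqI[OF tensor_map_linear[OF k(1,1,1,1) l l] linear_map_id _ t])
        (simp add: tensor_map_pure[OF k(1,1,1,1) l l] if')
    then show ?thesis using tensor_map_comp[OF k k(1) algebra_hom_linear[OF fa] i t] by simp
  qed
  have "comult H (?i y) = tensor_map H H ?i ?i (comult L y) \<and> counit H (?i y) = counit L y"
    if y: "y \<in> carrier L" for y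
  proof -
    have "comult L (f (?i y)) = tensor_map L L f f (comult H (?i y))" "counit L (f (?i y)) = counit H (?i y)"
      using f ic[OF y] by (simp_all add: hopf_homs_def)
    then show ?thesis
      using algebra_hom_closed[OF hopf_algebra.comult_algebra_hom[OF H] ic[OF y]] fi[OF y] eq by simp
  qed
  with ia show ?thesis by (simp add: hopf_homs_def)
qed

lemma hopf_isomorphic_refl: "hopf_algebra H \<Longrightarrow> hopf_isomorphic H H"
  unfolding hopf_isomorphic_def using hopf_hom_id by (auto intro!: bexI[of _ id])

lemma hopf_isomorphic_sym: "hopf_isomorphic H L \<Longrightarrow> hopf_isomorphic L H"
  unfolding hopf_isomorphic_def using hopf_hom_inv_into bij_betw_inv_into by metis

lemma hopf_isomorphic_trans: "hopf_isomorphic H L \<Longrightarrow> hopf_isomorphic L M \<Longrightarrow> hopf_isomorphic H M"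
  unfolding hopf_isomorphic_def
proof (elim conjE bexE, intro conjI)
  fix f g assume fg: "f \<in> hopf_homs H L" "g \<in> hopf_homs L M" and HLM: "hopf_algebra H" "hopf_algebra L" "hopf_algebra M"
    and bij: "bij_betw f (carrier H) (carrier L)" "bij_betw g (carrier L) (carrier M)"
  show "\<exists>h\<in>hopf_homs H M. bij_betw h (carrier H) (carrier M)"
    using hopf_hom_comp[OF HLM fg] bij_betw_trans[OF bij] by (auto simp: comp_def)
qed

lemma hopf_type_eq_iff: "hopf_algebra H \<Longrightarrow> hopf_type H = hopf_type L \<longleftrightarrow> hopf_isomorphic H L"
  unfolding hopf_type_def
  using hopf_isomorphic_refl hopf_isomorphic_sym hopf_isomorphic_trans
  by (metis (mono_tags, lifting) Collect_cong mem_Collect_eq hopf_isomorphic_def)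

text \<open>
  The two composites are algebra homomorphisms that agree with the identity on generators. This yields
  bijectivity without any knowledge of bases.
\<close>

lemma hopf_isomorphicI_generators:
  assumes H: "hopf_algebra H" and L: "hopf_algebra L"
    and f: "f \<in> hopf_homs H L" and g: "g \<in> algebra_homs L H"
    and S: "S \<subseteq> carrier H" "\<And>h. h \<in> carrier H \<Longrightarrow> generated H S h" "\<And>y. y \<in> S \<Longrightarrow> g (f y) = y"
    and S': "S' \<subseteq> carrier L" "\<And>h. h \<in> carrier L \<Longrightarrow> generated L S' h" "\<And>y. y \<in> S' \<Longrightarrow> f (g y) = y"
  shows "hopf_isomorphic H L"
proof -
  note k = hopf_k_algebra[OF H] hopf_k_algebra[OF L]
  note fa = hopf_homs_algebra[OF f]
  have "g (f h) = id h" if "h \<in> carrier H" for h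
    by (rule algebra_hom_eqI[where f = "\<lambda>h. g (f h)", OF k(1) S(1,2) algebra_hom_comp[OF fa g] algebra_hom_id _ that])
      (simp_all add: S(3))
  moreover have "f (g h) = id h" if "h \<in> carrier L" for h
    by (rule algebra_hom_eqI[where f = "\<lambda>h. f (g h)", OF k(2) S'(1,2) algebra_hom_comp[OF g fa] algebra_hom_id _ that])
      (simp_all add: S'(3))
  ultimately have "bij_betw f (carrier H) (carrier L)"
    using algebra_hom_closed[OF fa] algebra_hom_closed[OF g]
    by (intro bij_betw_byWitness[where f' = g]) auto
  with f H L show ?thesis by (auto simp: hopf_isomorphic_def)
qed

section \<open>Bases with dual functionals\<close>

inductive linspan :: "('k::field, 'a, 'm) module_scheme \<Rightarrow> 'a set \<Rightarrow> 'a \<Rightarrow> bool" for V S where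
  zero: "linspan V S \<zero>\<^bsub>V\<^esub>"
| gen: "x \<in> S \<Longrightarrow> linspan V S x"
| add: "linspan V S x \<Longrightarrow> linspan V S y \<Longrightarrow> linspan V S (x \<oplus>\<^bsub>V\<^esub> y)"
| scale: "linspan V S x \<Longrightarrow> linspan V S (a \<odot>\<^bsub>V\<^esub> x)"

text \<open>
  A finite basis is recorded together with its coordinate functionals \<open>\<phi>\<close>. Linear independence is then the
  existence of the functionals, and it is carried along homomorphisms by composing them.
\<close>

definition dual_basis ::
    "('k::field, 'a, 'm) module_scheme \<Rightarrow> 'i set \<Rightarrow> ('i \<Rightarrow> 'a) \<Rightarrow> ('i \<Rightarrow> 'a \<Rightarrow> 'k) \<Rightarrow> bool" where
  "dual_basis V I b \<phi> \<longleftrightarrow> finite I \<and> b \<in> I \<rightarrow> carrier V \<and> (\<forall>x\<in>carrier V. linspan V (b ` I) x) \<and>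
     (\<forall>i\<in>I. \<phi> i \<in> linear_maps V scalars) \<and> (\<forall>i\<in>I. \<forall>j\<in>I. \<phi> i (b j) = (if i = j then 1 else 0))"

lemma dual_basisD:
  assumes "dual_basis V I b \<phi>"
  shows "finite I" "i \<in> I \<Longrightarrow> b i \<in> carrier V" "x \<in> carrier V \<Longrightarrow> linspan V (b ` I) x"
    "i \<in> I \<Longrightarrow> \<phi> i \<in> linear_maps V scalars" "i \<in> I \<Longrightarrow> j \<in> I \<Longrightarrow> \<phi> i (b j) = (if i = j then 1 else 0)"
  using assms by (auto simp: dual_basis_def)

lemma linspan_closed:
  assumes "k_algebra V" "S \<subseteq> carrier V" "linspan V S x"
  shows "x \<in> carrier V"
proof -
  interpret V: k_algebra V by fact
  show ?thesis using assms(3) by induct (use assms(2) in auto)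
qed

lemma linspan_map:
  assumes "k_algebra V" "k_algebra W" "f \<in> linear_maps V W" "S \<subseteq> carrier V" "linspan V S x"
  shows "linspan W (f ` S) (f x)"
  using assms(5)
  by induct (auto intro: linspan.intros simp: linear_map_zero[OF assms(3,1,2)] linear_map_add[OF assms(3)]
    linear_map_scale[OF assms(3)] linspan_closed[OF assms(1,4)])

lemma linear_map_eqI_basis:
  assumes V: "k_algebra V" and W: "k_algebra W" and b: "dual_basis V I b \<phi>"
    and f: "f \<in> linear_maps V W" and g: "g \<in> linear_maps V W"
    and eq: "\<And>i. i \<in> I \<Longrightarrow> f (b i) = g (b i)" and x: "x \<in> carrier V"
  shows "f x = g x"
proof -
  have s: "b ` I \<subseteq> carrier V" using dual_basisD(2)[OF b] by auto
  show ?thesis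
    using dual_basisD(3)[OF b x]
    by induct (auto simp: eq linear_map_zero[OF f V W] linear_map_zero[OF g V W] linear_map_add[OF f]
      linear_map_add[OF g] linear_map_scale[OF f] linear_map_scale[OF g] linspan_closed[OF V s])
qed

lemma basis_expansion:
  assumes V: "k_algebra V" and b: "dual_basis V I b \<phi>" and x: "x \<in> carrier V"
  shows "x = (\<Oplus>\<^bsub>V\<^esub>i\<in>I. \<phi> i x \<odot>\<^bsub>V\<^esub> b i)"
proof -
  interpret V: k_algebra V by fact
  note d = dual_basisD[OF b]
  let ?e = "\<lambda>x. \<Oplus>\<^bsub>V\<^esub>i\<in>I. \<phi> i x \<odot>\<^bsub>V\<^esub> b i"
  have "?e \<in> linear_maps V V"
  proof (rule linear_mapsI)
    fix x y a assume x: "x \<in> carrier V"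
    show "?e x \<in> carrier V" using d(2) by (intro V.finsum_closed) auto
    show "?e (a \<odot>\<^bsub>V\<^esub> x) = a \<odot>\<^bsub>V\<^esub> ?e x"
      using d(1,2) x by (subst V.finsum_scale) (auto intro!: V.finsum_cong' simp: linear_map_scale[OF d(4)])
    assume y: "y \<in> carrier V"
    have "?e (x \<oplus>\<^bsub>V\<^esub> y) = (\<Oplus>\<^bsub>V\<^esub>i\<in>I. \<phi> i x \<odot>\<^bsub>V\<^esub> b i \<oplus>\<^bsub>V\<^esub> \<phi> i y \<odot>\<^bsub>V\<^esub> b i)"
      using d(2) x y by (intro V.finsum_cong') (auto simp: linear_map_add[OF d(4)] V.scale_add_left)
    also have "\<dots> = ?e x \<oplus>\<^bsub>V\<^esub> ?e y"
      using d(2) by (intro V.finsum_addf) auto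
    finally show "?e (x \<oplus>\<^bsub>V\<^esub> y) = ?e x \<oplus>\<^bsub>V\<^esub> ?e y" .
  qed
  moreover have "(\<lambda>x. x) (b j) = ?e (b j)" if j: "j \<in> I" for j
  proof -
    have "?e (b j) = (\<Oplus>\<^bsub>V\<^esub>i\<in>I. if j = i then b i else \<zero>\<^bsub>V\<^esub>)"
      using d(2,5) j by (intro V.finsum_cong') auto
    also have "\<dots> = b j" using d(1,2) j by (intro V.finsum_singleton) auto
    finally show ?thesis by simp
  qed
  ultimately show ?thesis
    using linear_map_eqI_basis[OF V V b linear_map_ident _ _ x, of ?e] by simp
qed

lemma coordinates_eqI:
  assumes V: "k_algebra V" and b: "dual_basis V I b \<phi>" and x: "x \<in> carrier V" and y: "y \<in> carrier V"
    and eq: "\<And>i. i \<in> I \<Longrightarrow> \<phi> i x = \<phi> i y"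
  shows "x = y"
proof -
  interpret V: k_algebra V by fact
  have "(\<Oplus>\<^bsub>V\<^esub>i\<in>I. \<phi> i x \<odot>\<^bsub>V\<^esub> b i) = (\<Oplus>\<^bsub>V\<^esub>i\<in>I. \<phi> i y \<odot>\<^bsub>V\<^esub> b i)"
    using dual_basisD(2)[OF b] by (intro V.finsum_cong') (auto simp: eq)
  then show ?thesis using basis_expansion[OF V b x] basis_expansion[OF V b y] by simp
qed

lemma dual_basis_cong:
  assumes "dual_basis V I b \<phi>" "\<And>i. i \<in> I \<Longrightarrow> b i = b' i"
  shows "dual_basis V I b' \<phi>"
proof -
  have "b' ` I = b ` I" using assms(2) by auto
  then show ?thesis using assms by (auto simp: dual_basis_def Pi_iff)
qed

text \<open>
  The coordinates of \<open>f x\<close> in the basis of \<open>W\<close> are coordinates of \<open>x\<close>, so \<open>f\<close> is injective; its image is a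
  subspace that contains a spanning set.
\<close>

lemma basis_to_basis_bij:
  assumes V: "k_algebra V" and W: "k_algebra W" and f: "f \<in> linear_maps V W"
    and b: "dual_basis V I b \<phi>" and c: "dual_basis W I (\<lambda>i. f (b i)) \<psi>"
  shows "bij_betw f (carrier V) (carrier W)"
proof (rule bij_betwI')
  have b': "dual_basis V I b (\<lambda>i x. \<psi> i (f x))"
    using b c by (auto simp: dual_basis_def intro: linear_map_comp[OF f])
  fix x y assume "x \<in> carrier V" "y \<in> carrier V"
  then show "(f x = f y) = (x = y)" using coordinates_eqI[OF V b'] by metis
next
  fix x assume "x \<in> carrier V" then show "f x \<in> carrier W" by (rule linear_map_closed[OF f])
next
  interpret V: k_algebra V by fact
  fix y assume "y \<in> carrier W"
  from dual_basisD(3)[OF c this] show "\<exists>x\<in>carrier V. y = f x"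
  proof induct
    case zero
    show ?case using linear_map_zero[OF f V W] by force
  next
    case (gen x)
    then show ?case using dual_basisD(2)[OF b] by auto
  next
    case (add x y)
    then show ?case using linear_map_add[OF f] V.a_closed by metis
  next
    case (scale x a)
    then show ?case using linear_map_scale[OF f] V.scale_closed by metis
  qed
qed

lemma dual_basis_transport:
  assumes V: "k_algebra V" and W: "k_algebra W" and f: "f \<in> linear_maps V W"
    and bij: "bij_betw f (carrier V) (carrier W)" and b: "dual_basis V I b \<phi>"
  shows "dual_basis W I (\<lambda>i. f (b i)) (\<lambda>i y. \<phi> i (inv_into (carrier V) f y))"
proof -
  note d = dual_basisD[OF b]
  have inv: "inv_into (carrier V) f (f x) = x" if "x \<in> carrier V" for x
    using bij that by (simp add: bij_betw_inv_into_left)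
  have s: "b ` I \<subseteq> carrier V" using d(2) by auto
  have "linspan W ((\<lambda>i. f (b i)) ` I) y" if y: "y \<in> carrier W" for y
  proof -
    obtain x where x: "x \<in> carrier V" "y = f x" using bij y by (auto simp: bij_betw_def)
    then have "linspan W (f ` b ` I) (f x)" using linspan_map[OF V W f s d(3)] by simp
    with x show ?thesis by (simp add: image_image)
  qed
  then show ?thesis
    using d linear_map_closed[OF f] inv linear_map_comp[OF inv_into_linear[OF V f bij] d(4)]
    unfolding dual_basis_def by auto
qed

lemma dual_basis_tensor:
  assumes A: "k_algebra A" and B: "k_algebra B" and b: "dual_basis A I b \<phi>" and c: "dual_basis B J c \<psi>"
  shows "dual_basis (tensor_algebra A B) (I \<times> J) (\<lambda>(i, j). pure_tensor A B (b i) (c j))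
    (\<lambda>(i, j). tensor_lift scalars (\<lambda>u v. \<phi> i u * \<psi> j v))"
proof -
  interpret T: tensor A B by (intro tensorI A B)
  note db = dual_basisD[OF b] and dc = dual_basisD[OF c]
  have bil: "(\<lambda>u v. \<phi> i u * \<psi> j v) \<in> bilinear_maps A B scalars" if "i \<in> I" "j \<in> J" for i j
    using linear_map_add[OF db(4)[OF that(1)]] linear_map_add[OF dc(4)[OF that(2)]]
      linear_map_scale[OF db(4)[OF that(1)]] linear_map_scale[OF dc(4)[OF that(2)]]
    by (intro bilinear_mapsI linear_mapsI) (auto simp: algebra_simps)
  note lift = T.lift_linear[OF k_algebra_scalars bil] T.lift_pure[OF k_algebra_scalars bil]
  let ?S = "(\<lambda>(i, j). T.pure (b i) (c j)) ` (I \<times> J)"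
  have sc: "?S \<subseteq> carrier T.T" using db(2) dc(2) by auto
  have s: "b ` I \<subseteq> carrier A" "c ` J \<subseteq> carrier B" using db(2) dc(2) by auto
  have "linspan T.T ?S t" if t: "t \<in> carrier T.T" for t
    using t
  proof (induct rule: T.tensor_induct)
    case (pure x y)
    have 1: "linspan T.T ?S (T.pure (b i) y)" if i: "i \<in> I" for i
      using dc(3)[OF pure(2)]
    proof induct
      case (gen z)
      then show ?case using i by (auto intro!: linspan.gen)
    qed (use db(2)[OF i] in \<open>auto simp: T.pure_zero T.pure_add_right T.pure_scale linspan_closed[OF B s(2)]
      intro: linspan.intros\<close>)
    from db(3)[OF pure(1)] show ?case
      by induct (use 1 pure(2) in \<open>auto simp: T.pure_zero T.pure_add_left T.pure_scale linspan_closed[OF A s(1)]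
        intro: linspan.intros\<close>)
  qed (auto intro: linspan.intros)
  then show ?thesis
    using db(1,2,5) dc(1,2,5) lift unfolding dual_basis_def by auto
qed

lemma dual_basis_monoid_algebra:
  assumes M: "monoid M" and fin: "finite (carrier M)"
  shows "dual_basis (monoid_algebra M :: ('k::field, 'g \<Rightarrow>\<^sub>0 'k) module) (carrier M)
    (\<lambda>g. Poly_Mapping.single g 1) (\<lambda>g p. Poly_Mapping.lookup p g)"
proof -
  let ?A = "monoid_algebra M :: ('k, 'g \<Rightarrow>\<^sub>0 'k) module"
  let ?S = "(\<lambda>g. Poly_Mapping.single g 1 :: 'g \<Rightarrow>\<^sub>0 'k) ` carrier M"
  have "linspan ?A ?S p" if "Poly_Mapping.keys p \<subseteq> carrier M" for p :: "'g \<Rightarrow>\<^sub>0 'k"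
    using that
  proof (induct p rule: poly_mapping_induct_on_keys)
    case zero
    show ?case using linspan.zero[of ?A ?S] by simp
  next
    case (single g c)
    then have "linspan ?A ?S (c \<odot>\<^bsub>?A\<^esub> Poly_Mapping.single g 1)" by (intro linspan.scale linspan.gen) auto
    then show ?case by simp
  next
    case (add p q)
    then show ?case using linspan.add[of ?A ?S p q] by simp
  qed
  then show ?thesis
    using fin by (auto simp: dual_basis_def lookup_add lookup_scale lookup_single when_def intro!: linear_mapsI)
qed


section \<open>Records with the same algebra structure\<close>

text \<open>
  The Hopf algebras are records that extend the record of an algebra by further fields. All notions about algebras
  look at the first fields only, but they have to be transferred from one record type to the other.
\<close>

definition same_algebra :: "('k::field, 'a, 'm) module_scheme \<Rightarrow> ('k, 'a, 'n) module_scheme \<Rightarrow> bool" where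
  "same_algebra A B \<longleftrightarrow> carrier A = carrier B \<and> monoid.mult A = monoid.mult B \<and> one A = one B \<and>
     ring.zero A = ring.zero B \<and> add A = add B \<and> module.smult A = module.smult B"

lemma same_algebra_extend [simp]: "same_algebra (module.extend A m) A"
  by (simp add: same_algebra_def module.defs)

lemma same_algebra_sym: "same_algebra A B \<Longrightarrow> same_algebra B A"
  by (simp add: same_algebra_def)

lemma same_algebraD:
  assumes "same_algebra A B"
  shows "carrier A = carrier B" "monoid.mult A = monoid.mult B" "one A = one B"
    "ring.zero A = ring.zero B" "add A = add B" "module.smult A = module.smult B"
  using assms by (simp_all add: same_algebra_def)

lemma k_algebra_same:
  assumes A: "k_algebra A" and s: "same_algebra B A"
  shows "k_algebra B"
proof -
  interpret A: k_algebra A by fact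
  note sd = same_algebraD[OF s]
  have neg: "\<exists>y\<in>carrier A. y \<oplus>\<^bsub>A\<^esub> x = \<zero>\<^bsub>A\<^esub>" if "x \<in> carrier A" for x
    using that by (intro bexI[of _ "\<ominus>\<^bsub>A\<^esub> x"]) (auto simp: A.l_neg)
  show ?thesis
  proof (intro k_algebra.intro k_algebra_axioms.intro)
    show "ring B"
      by (rule ringI, rule abelian_groupI)
        (auto simp: sd A.a_ac A.l_distr A.r_distr A.m_assoc neg intro!: monoidI)
  qed (auto simp: sd A.scale_add_left A.scale_add_right)
qed

lemma
  assumes "same_algebra A A'"
  shows linear_maps_same_left: "linear_maps A U = linear_maps A' U"
    and algebra_homs_same_left: "algebra_homs A U = algebra_homs A' U"
    and algebra_homs_same_right: "algebra_homs U A = algebra_homs U A'"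
  using same_algebraD[OF assms] by (simp_all add: linear_maps_def algebra_homs_def ring_hom_def)

lemma opposite_same: "same_algebra A A' \<Longrightarrow> same_algebra (opposite A) (opposite A')"
  by (simp add: same_algebra_def opposite_def)

lemma generated_same:
  assumes "same_algebra A A'"
  shows "generated A S x \<longleftrightarrow> generated A' S x"
proof
  show "generated A S x \<Longrightarrow> generated A' S x"
    by (induct rule: generated.induct) (simp_all only: same_algebraD[OF assms] generated.intros)
  show "generated A' S x \<Longrightarrow> generated A S x"
    by (induct rule: generated.induct) (simp_all only: same_algebraD[OF same_algebra_sym[OF assms]] generated.intros)
qed

lemma tensor_null_same:
  assumes "same_algebra A A'" "same_algebra B B'"
  shows "tensor_null A B = tensor_null A' B'"
proof (intro equalityI subsetI)
  note s = same_algebraD[OF assms(1)] same_algebraD[OF assms(2)]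
  note s' = same_algebraD[OF same_algebra_sym[OF assms(1)]] same_algebraD[OF same_algebra_sym[OF assms(2)]]
  show "p \<in> tensor_null A B \<Longrightarrow> p \<in> tensor_null A' B'" for p
    by (induct rule: tensor_null.induct) (simp_all only: s tensor_null.intros)
  show "p \<in> tensor_null A' B' \<Longrightarrow> p \<in> tensor_null A B" for p
    by (induct rule: tensor_null.induct) (simp_all only: s' tensor_null.intros)
qed

lemma
  assumes "same_algebra A A'" "same_algebra B B'"
  shows tensor_algebra_same: "tensor_algebra A B = tensor_algebra A' B'"
    and pure_tensor_same: "pure_tensor A B = pure_tensor A' B'"
proof -
  note s = same_algebraD[OF assms(1)] same_algebraD[OF assms(2)]
  have "A \<times>\<times> B = A' \<times>\<times> B'" by (simp add: DirProd_def s)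
  then show "tensor_algebra A B = tensor_algebra A' B'" "pure_tensor A B = pure_tensor A' B'"
    using tensor_null_same[OF assms] by (auto simp: tensor_algebra_def pure_tensor_def fun_eq_iff)
qed

lemma lin_ext_opposite: "lin_ext (opposite A) f = lin_ext A f"
  by (simp add: lin_ext_def finsum_def opposite_def fun_eq_iff)


section \<open>Group Hopf algebras\<close>

lemma group_hopf_simps:
  fixes G :: "('g, 'm) monoid_scheme"
  defines "A \<equiv> monoid_algebra G :: ('k::field, 'g \<Rightarrow>\<^sub>0 'k) module"
  shows "same_algebra (group_hopf G) A"
    "comult (group_hopf G) = lin_ext (tensor_algebra A A)
      (\<lambda>g. pure_tensor A A (Poly_Mapping.single g 1) (Poly_Mapping.single g 1))"
    "counit (group_hopf G) = lin_ext scalars (\<lambda>g. 1)"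
    "antipode (group_hopf G) = lin_ext A (\<lambda>g. Poly_Mapping.single (inv\<^bsub>G\<^esub> g) 1)"
  unfolding group_hopf_def Let_def A_def by (simp_all, simp_all add: module.defs hopf.defs)

lemma
  fixes G :: "('g, 'm) monoid_scheme"
  assumes G: "group G"
  shows hopf_algebra_group_hopf: "hopf_algebra (group_hopf G :: ('k::field, 'g \<Rightarrow>\<^sub>0 'k) hopf)"
    and grouplike_group_hopf: "g \<in> carrier G \<Longrightarrow>
      grouplike (group_hopf G :: ('k::field, 'g \<Rightarrow>\<^sub>0 'k) hopf) (Poly_Mapping.single g 1)"
    and generated_group_hopf: "p \<in> carrier (group_hopf G :: ('k::field, 'g \<Rightarrow>\<^sub>0 'k) hopf) \<Longrightarrow>
      generated (group_hopf G) ((\<lambda>g. Poly_Mapping.single g 1) ` carrier G) p"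
proof -
  interpret G: group G by fact
  let ?A = "monoid_algebra G :: ('k, 'g \<Rightarrow>\<^sub>0 'k) module" and ?H = "group_hopf G :: ('k, 'g \<Rightarrow>\<^sub>0 'k) hopf"
  let ?e = "\<lambda>g. Poly_Mapping.single g (1::'k)"
  note s = group_hopf_simps(1)[of G] and sd = same_algebraD[OF group_hopf_simps(1)[of G]]
  note A = k_algebra_monoid_algebra[OF G.monoid_axioms]
  interpret A: k_algebra ?A by (rule A)
  interpret AA: tensor ?A ?A by (intro tensorI A)
  have t: "tensor_algebra ?H ?H = AA.T" "pure_tensor ?H ?H = AA.pure"
    by (intro tensor_algebra_same pure_tensor_same s)+
  have comult: "comult ?H (?e g) = AA.pure (?e g) (?e g)" if "g \<in> carrier G" for g
    unfolding group_hopf_simps(2) using that by (subst lin_ext_single[OF AA.k_algebra_tensor]) auto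
  have counit: "counit ?H (?e g) = 1" if "g \<in> carrier G" for g
    unfolding group_hopf_simps(3) using that by (subst lin_ext_single[OF k_algebra_scalars]) auto
  have antipode: "antipode ?H (?e g) = ?e (inv\<^bsub>G\<^esub> g)" if "g \<in> carrier G" for g
    unfolding group_hopf_simps(4) using that by (subst lin_ext_single[OF A]) auto
  show gl: "grouplike ?H (?e g)" if "g \<in> carrier G" for g
    using that by (simp add: grouplike_def sd t comult counit)
  show gen: "generated ?H (?e ` carrier G) p" if "p \<in> carrier ?H" for p
  proof -
    from that have "Poly_Mapping.keys p \<subseteq> carrier G" by (simp add: sd)
    then show ?thesis
    proof (induct p rule: poly_mapping_induct_on_keys)
      case zero
      have "generated ?H (?e ` carrier G) (0 \<odot>\<^bsub>?H\<^esub> \<one>\<^bsub>?H\<^esub>)" by (intro generated.intros)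
      then show ?case by (simp add: sd)
    next
      case (single g c)
      then have "generated ?H (?e ` carrier G) (c \<odot>\<^bsub>?H\<^esub> ?e g)" by (intro generated.scale generated.gen) auto
      then show ?case by (simp add: sd)
    next
      case (add p q)
      then show ?case using generated.add[of ?H "?e ` carrier G" p q] by (simp add: sd)
    qed
  qed
  have "hopf_generators ?H (?e ` carrier G)"
  proof (intro hopf_generators.intro hopf_generators_axioms.intro gen)
    show "k_algebra ?H" by (rule k_algebra_same[OF A s])
    show "comult ?H \<in> algebra_homs ?H (tensor_algebra ?H ?H)"
      unfolding t algebra_homs_same_left[OF s] group_hopf_simps(2)
      by (rule lin_ext_algebra_hom[OF AA.k_algebra_tensor G.monoid_axioms])
        (simp_all add: AA.one_eq_pure AA.pure_mult)
    show "counit ?H \<in> algebra_homs ?H scalars"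
      unfolding algebra_homs_same_left[OF s] group_hopf_simps(3)
      by (rule lin_ext_algebra_hom[OF k_algebra_scalars G.monoid_axioms]) simp_all
    show "antipode ?H \<in> algebra_homs ?H (opposite ?H)"
      unfolding algebra_homs_same_left[OF s] algebra_homs_same_right[OF opposite_same[OF s]]
        group_hopf_simps(4)
      by (subst lin_ext_opposite[symmetric], rule lin_ext_algebra_hom[OF k_algebra_opposite[OF A] G.monoid_axioms])
        (simp_all add: G.inv_mult_group)
    show "?e ` carrier G \<subseteq> carrier ?H" by (auto simp: sd)
    fix y assume "y \<in> ?e ` carrier G"
    then obtain g where "g \<in> carrier G" "y = ?e g" by auto
    then show "grouplike ?H y \<and> antipode ?H y \<otimes>\<^bsub>?H\<^esub> y = \<one>\<^bsub>?H\<^esub> \<and> y \<otimes>\<^bsub>?H\<^esub> antipode ?H y = \<one>\<^bsub>?H\<^esub> \<or>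
      (\<exists>g. grouplike ?H g \<and> antipode ?H g \<otimes>\<^bsub>?H\<^esub> g = \<one>\<^bsub>?H\<^esub> \<and> g \<otimes>\<^bsub>?H\<^esub> antipode ?H g = \<one>\<^bsub>?H\<^esub> \<and>
        skew_primitive ?H g y \<and> antipode ?H y = \<ominus>\<^bsub>?H\<^esub> (antipode ?H g \<otimes>\<^bsub>?H\<^esub> y))"
      by (intro disjI1) (simp add: gl antipode sd)
  qed
  then show "hopf_algebra ?H" by (rule hopf_generators.hopf_algebra)
qed

section \<open>Algebras given by generators and relations\<close>

abbreviation word_monoid :: "'g set \<Rightarrow> 'g list monoid" where
  "word_monoid S \<equiv> \<lparr>carrier = lists S, monoid.mult = (@), one = []\<rparr>"

lemma monoid_word_monoid: "monoid (word_monoid S)"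
  by (rule monoidI) auto

lemma word_eval_Nil [simp]: "word_eval U f [] = \<one>\<^bsub>U\<^esub>"
  and word_eval_Cons [simp]: "word_eval U f (y # w) = f y \<otimes>\<^bsub>U\<^esub> word_eval U f w"
  by (simp_all add: word_eval_def)

lemma word_eval_closed:
  assumes "k_algebra U" "f \<in> S \<rightarrow> carrier U" "w \<in> lists S"
  shows "word_eval U f w \<in> carrier U"
proof -
  interpret U: k_algebra U by fact
  show ?thesis using assms(3) by induct (use assms(2) in auto)
qed

lemma word_eval_append:
  assumes "k_algebra U" "f \<in> S \<rightarrow> carrier U" "v \<in> lists S" "w \<in> lists S"
  shows "word_eval U f (v @ w) = word_eval U f v \<otimes>\<^bsub>U\<^esub> word_eval U f w"
proof -
  interpret U: k_algebra U by fact
  show ?thesis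
    using assms(3)
    by induct (use assms(2,4) word_eval_closed[OF assms(1,2)] in \<open>auto simp: U.m_assoc Pi_iff\<close>)
qed

lemma word_eval_replicate:
  assumes "k_algebra U" "f y \<in> carrier U"
  shows "word_eval U f (replicate m y) = f y [^]\<^bsub>U\<^esub> m"
proof -
  interpret U: k_algebra U by fact
  show ?thesis by (induct m) (use assms(2) U.nat_pow_Suc2 in \<open>simp_all add: pow_0 del: U.nat_pow_Suc\<close>)
qed

locale presentation =
  fixes S :: "'g set" and R :: "('g list \<Rightarrow>\<^sub>0 'k::field) set"
  assumes relators: "R \<subseteq> carrier (free_algebra S)"
begin

abbreviation "Fr \<equiv> monoid_algebra (word_monoid S) :: ('k, 'g list \<Rightarrow>\<^sub>0 'k) module"
abbreviation "I \<equiv> genideal Fr R"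
abbreviation "Quo \<equiv> quotient_algebra Fr I"
abbreviation "cls \<equiv> (\<lambda>p. I +>\<^bsub>Fr\<^esub> p)"

lemma free_algebra_eq: "free_algebra S = Fr"
  by (simp add: free_algebra_def)

sublocale Fr: k_algebra Fr by (intro k_algebra_monoid_algebra monoid_word_monoid)

lemma relator_keys: "r \<in> R \<Longrightarrow> Poly_Mapping.keys r \<subseteq> lists S"
  using relators by (auto simp: free_algebra_eq)

sublocale Q: algebra_ideal Fr I
  by (intro algebra_ideal.intro Fr.k_algebra_axioms Fr.genideal_ideal) (use relators in \<open>simp add: free_algebra_eq\<close>)

lemma k_algebra_quo: "k_algebra Quo" by (rule Q.k_algebra_quotient)

sublocale Quo: k_algebra Quo by (rule k_algebra_quo)

lemma
  assumes U: "k_algebra U" and f: "f \<in> S \<rightarrow> carrier U"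
  shows word_lin_linear: "lin_ext U (word_eval U f) \<in> linear_maps Fr U"
    and word_lin_single: "w \<in> lists S \<Longrightarrow> lin_ext U (word_eval U f) (Poly_Mapping.single w a) = a \<odot>\<^bsub>U\<^esub> word_eval U f w"
    and word_lin_word: "w \<in> lists S \<Longrightarrow> lin_ext U (word_eval U f) (word w) = word_eval U f w"
    and word_lin_hom: "lin_ext U (word_eval U f) \<in> algebra_homs Fr U"
proof -
  interpret U: k_algebra U by fact
  show "lin_ext U (word_eval U f) \<in> linear_maps Fr U"
    using word_eval_closed[OF U f] by (intro lin_ext_linear U) auto
  show "w \<in> lists S \<Longrightarrow> lin_ext U (word_eval U f) (Poly_Mapping.single w a) = a \<odot>\<^bsub>U\<^esub> word_eval U f w" for a
    using lin_ext_single[OF U, of "word_eval U f" w a] word_eval_closed[OF U f, of w] by blast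
  from this[of 1] show "w \<in> lists S \<Longrightarrow> lin_ext U (word_eval U f) (word w) = word_eval U f w"
    using word_eval_closed[OF U f] by (simp add: word_def)
  show "lin_ext U (word_eval U f) \<in> algebra_homs Fr U"
    using word_eval_closed[OF U f] word_eval_append[OF U f]
    by (intro lin_ext_algebra_hom U monoid_word_monoid) auto
qed

text \<open>
  The kernel of the homomorphism that evaluates words in \<open>U\<close> is an ideal, so it contains the ideal generated
  by the relators as soon as it contains the relators.
\<close>

lemma ideal_vanishes:
  assumes U: "k_algebra U" and f: "f \<in> S \<rightarrow> carrier U"
    and van: "\<And>r. r \<in> R \<Longrightarrow> lin_ext U (word_eval U f) r = \<zero>\<^bsub>U\<^esub>" and i: "i \<in> I"
  shows "lin_ext U (word_eval U f) i = \<zero>\<^bsub>U\<^esub>"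
proof -
  interpret U: k_algebra U by fact
  let ?F = "lin_ext U (word_eval U f)"
  have "?F \<in> ring_hom Fr U" using word_lin_hom[OF U f] by (simp add: algebra_homs_def)
  then have "ring_hom_ring Fr U ?F"
    by (intro ring_hom_ringI2 Fr.ring_axioms U.ring_axioms)
  then have "ideal (a_kernel Fr U ?F) Fr" by (rule ring_hom_ring.kernel_is_ideal)
  then have "I \<subseteq> a_kernel Fr U ?F"
  proof (rule Fr.genideal_minimal)
    show "R \<subseteq> a_kernel Fr U ?F"
    proof
      fix r assume "r \<in> R"
      then show "r \<in> a_kernel Fr U ?F" using relator_keys[of r] van[of r] by (simp add: a_kernel_def')
    qed
  qed
  then have "i \<in> a_kernel Fr U ?F" using i by (rule subsetD)
  then show ?thesis by (simp add: a_kernel_def')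
qed

lemma
  assumes U: "k_algebra U" and f: "f \<in> S \<rightarrow> carrier U"
    and van: "\<And>r. r \<in> R \<Longrightarrow> lin_ext U (word_eval U f) r = \<zero>\<^bsub>U\<^esub>"
  shows word_ext_hom: "coset_ext U (word_eval U f) \<in> algebra_homs Quo U"
    and word_ext_word: "w \<in> lists S \<Longrightarrow> coset_ext U (word_eval U f) (cls (word w)) = word_eval U f w"
proof -
  interpret E: monoid_algebra_ideal "word_monoid S" I U "word_eval U f"
    using word_eval_closed[OF U f]
    by (intro monoid_algebra_ideal.intro monoid_word_monoid Q.algebra_ideal_axioms
      monoid_algebra_ideal_axioms.intro U ideal_vanishes[OF U f van]) auto
  show "coset_ext U (word_eval U f) \<in> algebra_homs Quo U"
    using word_eval_append[OF U f] by (intro E.coset_ext_hom) auto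
  show "w \<in> lists S \<Longrightarrow> coset_ext U (word_eval U f) (cls (word w)) = word_eval U f w"
    using word_lin_word[OF U f] by (subst E.coset_ext_coset) (auto simp: word_def)
qed

abbreviation "letter y \<equiv> cls (word [y])"

lemma letter_closed: "letter \<in> S \<rightarrow> carrier Quo"
  by (auto simp: word_def intro!: Q.coset_closed)

lemma cls_word: "w \<in> lists S \<Longrightarrow> cls (word w) = word_eval Quo letter w"
proof (induct rule: lists.induct)
  case (Cons y w)
  have "cls (word [y]) \<otimes>\<^bsub>Quo\<^esub> cls (word w) = cls (word [y] \<otimes>\<^bsub>Fr\<^esub> word w)"
    using Cons by (intro Q.quotient_mult) (auto simp: word_def)
  with Cons show ?case by (simp add: word_def)
qed (simp add: word_def)

lemma lin_ext_letter:
  assumes p: "Poly_Mapping.keys p \<subseteq> lists S"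
  shows "lin_ext Quo (word_eval Quo letter) p = cls p"
proof (rule linear_map_eqI_monoid_algebra[OF k_algebra_quo monoid_word_monoid
    word_lin_linear[OF k_algebra_quo letter_closed] algebra_hom_linear[OF Q.coset_hom]])
  fix w assume "w \<in> carrier (word_monoid S)"
  then show "lin_ext Quo (word_eval Quo letter) (Poly_Mapping.single w 1) = cls (Poly_Mapping.single w 1)"
    using word_lin_word[OF k_algebra_quo letter_closed, of w] cls_word[of w] by (simp add: word_def)
qed (use p in simp)

text \<open>
  Evaluating a combination of words at the generators of the quotient gives its coset. So the same
  criterion that describes homomorphisms into other algebras shows that the
  generators satisfy the relations.
\<close>

lemma relators_vanish: "r \<in> R \<Longrightarrow> lin_ext Quo (word_eval Quo letter) r = \<zero>\<^bsub>Quo\<^esub>"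
  using Fr.genideal_self[of R] relators Fr.a_rcos_zero[OF Q.ideal_axioms, of r] relator_keys[of r]
  by (auto simp: lin_ext_letter free_algebra_eq)

lemma generated_letters:
  assumes "q \<in> carrier Quo"
  shows "generated Quo (letter ` S) q"
proof -
  from assms obtain p where q: "q = cls p" and p: "Poly_Mapping.keys p \<subseteq> lists S"
    by (auto simp: Q.quotient_carrier)
  have w: "generated Quo (letter ` S) (cls (word w))" if "w \<in> lists S" for w
    unfolding cls_word[OF that] using that
  proof induct
    case Nil
    show ?case by (simp only: word_eval_Nil generated.one)
  next
    case (Cons y w)
    then show ?case unfolding word_eval_Cons by (intro generated.mult imageI)
  qed
  from p have "generated Quo (letter ` S) (cls p)"
  proof (induct p rule: poly_mapping_induct_on_keys)
    case zero
    have "generated Quo (letter ` S) (0 \<odot>\<^bsub>Quo\<^esub> \<one>\<^bsub>Quo\<^esub>)" by (intro generated.intros)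
    then show ?case using algebra_hom_scale[OF Q.coset_hom, of "Poly_Mapping.single [] 1" 0] by simp
  next
    case (single v c)
    then have "generated Quo (letter ` S) (c \<odot>\<^bsub>Quo\<^esub> cls (word v))" by (intro generated.scale w)
    moreover have "c \<odot>\<^bsub>Quo\<^esub> cls (word v) = cls (Poly_Mapping.single v c)"
      using algebra_hom_scale[OF Q.coset_hom, of "word v" c] single by (simp add: word_def)
    ultimately show ?case by simp
  next
    case (add p q)
    then show ?case using algebra_hom_add[OF Q.coset_hom, of p q] generated.add by fastforce
  qed
  with q show ?thesis by simp
qed

lemma presented_hopf_simps:
  fixes d e s
  defines "H \<equiv> presented_hopf S R d e s"
  shows "same_algebra H Quo"
    and "comult H = coset_ext (tensor_algebra Quo Quo) (word_eval (tensor_algebra Quo Quo)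
      (\<lambda>y. lin_ext (tensor_algebra Quo Quo) (\<lambda>(v, w). pure_tensor Quo Quo (cls (word v)) (cls (word w))) (d y)))"
    and "counit H = coset_ext scalars (word_eval scalars e)"
    and "antipode H = coset_ext (opposite Quo) (word_eval (opposite Quo) (\<lambda>y. cls (s y)))"
  unfolding H_def presented_hopf_def Let_def free_algebra_eq
  by (simp_all, simp_all add: module.defs hopf.defs, simp add: coset_ext_def lin_ext_opposite fun_eq_iff)

end


section \<open>Sweedler's relations\<close>

definition sweedler_rels :: "('k::field, 'a, 'm) module_scheme \<Rightarrow> 'a \<Rightarrow> 'a \<Rightarrow> bool" where
  "sweedler_rels U g x \<longleftrightarrow> g \<in> carrier U \<and> x \<in> carrier U \<and> g \<otimes>\<^bsub>U\<^esub> g = \<one>\<^bsub>U\<^esub> \<and> x \<otimes>\<^bsub>U\<^esub> x = \<zero>\<^bsub>U\<^esub> \<and>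
     x \<otimes>\<^bsub>U\<^esub> g \<oplus>\<^bsub>U\<^esub> g \<otimes>\<^bsub>U\<^esub> x = \<zero>\<^bsub>U\<^esub>"

definition smash_rels :: "('k::field, 'a, 'm) module_scheme \<Rightarrow> nat \<Rightarrow> 'k \<Rightarrow> 'a \<Rightarrow> 'a \<Rightarrow> 'a \<Rightarrow> bool" where
  "smash_rels U n \<omega> g x c \<longleftrightarrow> sweedler_rels U g x \<and> c \<in> carrier U \<and> c [^]\<^bsub>U\<^esub> n = \<one>\<^bsub>U\<^esub> \<and>
     c \<otimes>\<^bsub>U\<^esub> g = g \<otimes>\<^bsub>U\<^esub> c \<and> c \<otimes>\<^bsub>U\<^esub> x = \<omega> \<odot>\<^bsub>U\<^esub> (x \<otimes>\<^bsub>U\<^esub> c)"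

context k_algebra
begin

lemma minus_eq_zero_iff: "a \<in> carrier A \<Longrightarrow> b \<in> carrier A \<Longrightarrow> a \<ominus> b = \<zero> \<longleftrightarrow> a = b"
  using r_right_minus_eq by simp

lemma sweedler_relsD:
  assumes "sweedler_rels A g x"
  shows "g \<in> carrier A" "x \<in> carrier A" "g \<otimes> g = \<one>" "x \<otimes> x = \<zero>" "x \<otimes> g = \<ominus> (g \<otimes> x)"
  using assms minus_equality[of "x \<otimes> g" "g \<otimes> x"] by (auto simp: sweedler_rels_def)

lemma sweedler_rels_assoc:
  assumes "sweedler_rels A g x" "y \<in> carrier A"
  shows "g \<otimes> (g \<otimes> y) = y" "x \<otimes> (x \<otimes> y) = \<zero>" "x \<otimes> (g \<otimes> y) = \<ominus> (g \<otimes> (x \<otimes> y))"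
  using sweedler_relsD[OF assms(1)] assms(2) by (simp_all flip: m_assoc add: l_minus)

lemma smash_relsD:
  assumes "smash_rels A n \<omega> g x c"
  shows "sweedler_rels A g x" "c \<in> carrier A" "c [^] n = \<one>" "c \<otimes> g = g \<otimes> c" "c \<otimes> x = \<omega> \<odot> (x \<otimes> c)"
  using assms by (auto simp: smash_rels_def)

lemma pow_commute:
  assumes "c \<in> carrier A" "g \<in> carrier A" "c \<otimes> g = g \<otimes> c"
  shows "c [^] (m::nat) \<otimes> g = g \<otimes> c [^] m"
  using assms
proof (induct m)
  case (Suc m)
  then have "c [^] m \<otimes> c \<otimes> g = g \<otimes> c [^] m \<otimes> c"
    by (simp add: m_assoc) (simp flip: m_assoc)
  with Suc show ?case by (simp add: m_assoc)
qed simp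

lemma pow_skew_commute:
  assumes "c \<in> carrier A" "x \<in> carrier A" "c \<otimes> x = \<omega> \<odot> (x \<otimes> c)"
  shows "c [^] (m::nat) \<otimes> x = \<omega> ^ m \<odot> (x \<otimes> c [^] m)"
  using assms
proof (induct m)
  case (Suc m)
  have "c [^] m \<otimes> c \<otimes> x = c [^] m \<otimes> (c \<otimes> x)" using Suc(2-) by (intro m_assoc) auto
  also have "\<dots> = \<omega> \<odot> (c [^] m \<otimes> x \<otimes> c)" using Suc(2-) by (simp add: m_assoc)
  also have "\<dots> = (\<omega> * \<omega> ^ m) \<odot> (x \<otimes> c [^] m \<otimes> c)" using Suc by (simp del: nat_pow_Suc)
  finally show ?case using Suc(2-) by (simp add: m_assoc)
qed simp

lemma sweedler_rels_opposite:
  assumes "sweedler_rels A g x"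
  shows "sweedler_rels (opposite A) g (\<ominus> (g \<otimes> x))"
  using sweedler_relsD[OF assms] sweedler_rels_assoc[OF assms]
  by (simp add: sweedler_rels_def l_minus r_minus m_assoc l_neg r_neg)

text \<open>
  The anti-homomorphism property of the antipode: the proposed values satisfy the relations in the opposite
  algebra. Reversing the order of \<open>c^(n-1) x\<close> costs the factor \<open>\<omega>^(n-1)\<close>, the inverse of \<open>\<omega>\<close>.
\<close>

lemma smash_rels_opposite:
  assumes r: "smash_rels A n \<omega> g x c" and n: "0 < n" "\<omega> ^ n = 1"
  shows "smash_rels (opposite A) n \<omega> g (\<ominus> (g \<otimes> x)) (c [^] (n - 1))"
proof -
  note d = smash_relsD[OF r] sweedler_relsD[OF smash_relsD(1)[OF r]]
  let ?c = "c [^] (n - 1)"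
  have c: "?c \<in> carrier A" using d by simp
  have "?c [^] n = (c [^] n) [^] (n - 1)" using d(2) by (simp add: nat_pow_pow mult.commute)
  then have "?c [^] n = \<one>" using d by simp
  then have 1: "?c [^]\<^bsub>opposite A\<^esub> n = \<one>" using opposite_pow[OF k_algebra_axioms c] by simp
  have g: "?c \<otimes> g = g \<otimes> ?c" using pow_commute d by simp
  have "?c \<otimes> x = \<omega> ^ (n - 1) \<odot> (x \<otimes> ?c)" using pow_skew_commute d by simp
  then have "?c \<otimes> (g \<otimes> x) = \<omega> ^ (n - 1) \<odot> (g \<otimes> x \<otimes> ?c)"
    using g c d by (simp flip: m_assoc) (simp add: m_assoc)
  moreover have "\<omega> * \<omega> ^ (n - 1) = 1" using n by (cases n) auto
  ultimately have "\<omega> \<odot> (?c \<otimes> (g \<otimes> x)) = g \<otimes> x \<otimes> ?c" using c d by simp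
  then have "(\<ominus> (g \<otimes> x)) \<otimes> ?c = \<omega> \<odot> (?c \<otimes> (\<ominus> (g \<otimes> x)))"
    using c d by (simp add: l_minus r_minus scale_minus_right scale_minus_left)
  with 1 c g sweedler_rels_opposite[OF d(1)] show ?thesis by (simp add: smash_rels_def)
qed

end

lemma sweedler_rels_tensor:
  assumes A: "k_algebra A" and r: "sweedler_rels A g x"
  shows "sweedler_rels (tensor_algebra A A) (pure_tensor A A g g)
    (pure_tensor A A x \<one>\<^bsub>A\<^esub> \<oplus>\<^bsub>tensor_algebra A A\<^esub> pure_tensor A A g x)"
proof -
  interpret A: k_algebra A by fact
  interpret T: tensor A A by (intro tensorI A)
  note d = A.sweedler_relsD[OF r]
  have 1: "(T.pure x \<one>\<^bsub>A\<^esub> \<oplus>\<^bsub>T.T\<^esub> T.pure g x) \<otimes>\<^bsub>T.T\<^esub> (T.pure x \<one>\<^bsub>A\<^esub> \<oplus>\<^bsub>T.T\<^esub> T.pure g x) = \<zero>\<^bsub>T.T\<^esub>"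
    using d by (simp add: T.T.l_distr T.T.r_distr T.pure_mult T.pure_zero T.pure_minus T.T.l_neg T.T.r_neg)
  have 2: "(T.pure x \<one>\<^bsub>A\<^esub> \<oplus>\<^bsub>T.T\<^esub> T.pure g x) \<otimes>\<^bsub>T.T\<^esub> T.pure g g \<oplus>\<^bsub>T.T\<^esub>
      T.pure g g \<otimes>\<^bsub>T.T\<^esub> (T.pure x \<one>\<^bsub>A\<^esub> \<oplus>\<^bsub>T.T\<^esub> T.pure g x) = \<zero>\<^bsub>T.T\<^esub>"
    using d by (simp add: T.T.l_distr T.T.r_distr T.pure_mult T.pure_minus T.T.minus_add[symmetric] T.T.l_neg T.T.r_neg)
  show ?thesis using 1 2 d by (simp add: sweedler_rels_def T.pure_mult T.one_eq_pure)
qed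

text \<open>
  This and \<open>sweedler_rels_tensor\<close> make the comultiplication well defined on the presented algebras.
\<close>

lemma smash_rels_tensor:
  assumes A: "k_algebra A" and r: "smash_rels A n \<omega> g x c"
  shows "smash_rels (tensor_algebra A A) n \<omega> (pure_tensor A A g g)
    (pure_tensor A A x \<one>\<^bsub>A\<^esub> \<oplus>\<^bsub>tensor_algebra A A\<^esub> pure_tensor A A g x) (pure_tensor A A c c)"
proof -
  interpret A: k_algebra A by fact
  interpret T: tensor A A by (intro tensorI A)
  note d = A.smash_relsD[OF r] A.sweedler_relsD[OF A.smash_relsD(1)[OF r]]
  have "T.pure c c [^]\<^bsub>T.T\<^esub> m = T.pure (c [^]\<^bsub>A\<^esub> m) (c [^]\<^bsub>A\<^esub> m)" for m :: nat
    by (induct m) (use d in \<open>simp_all add: pow_0 pow_Suc T.one_eq_pure T.pure_mult del: A.nat_pow_Suc T.T.nat_pow_Suc\<close>)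
  moreover have "T.pure c c \<otimes>\<^bsub>T.T\<^esub> (T.pure x \<one>\<^bsub>A\<^esub> \<oplus>\<^bsub>T.T\<^esub> T.pure g x) =
      \<omega> \<odot>\<^bsub>T.T\<^esub> ((T.pure x \<one>\<^bsub>A\<^esub> \<oplus>\<^bsub>T.T\<^esub> T.pure g x) \<otimes>\<^bsub>T.T\<^esub> T.pure c c)"
    using d by (simp add: T.T.l_distr T.T.r_distr T.pure_mult T.pure_scale T.T.scale_add_right)
  ultimately show ?thesis
    using d sweedler_rels_tensor[OF A d(1)] by (simp add: smash_rels_def T.pure_mult T.one_eq_pure)
qed

section \<open>The Hopf algebras of Sweedler and their extensions by a cyclic group\<close>

lemma a_inv_same: "same_algebra A B \<Longrightarrow> \<ominus>\<^bsub>A\<^esub> x = \<ominus>\<^bsub>B\<^esub> x"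
  by (simp add: same_algebra_def a_inv_def m_inv_def)

lemma sweedler_rels_same: "same_algebra A B \<Longrightarrow> sweedler_rels A g x \<longleftrightarrow> sweedler_rels B g x"
  by (simp add: same_algebra_def sweedler_rels_def)

lemma smash_rels_same: "same_algebra A B \<Longrightarrow> smash_rels A n \<omega> g x c \<longleftrightarrow> smash_rels B n \<omega> g x c"
  by (simp add: sweedler_rels_same smash_rels_def) (simp add: same_algebra_def nat_pow_def)

text \<open>
  \<open>H4\<close> and \<open>H4n n \<omega>\<close> are treated together. For \<open>H4\<close> the set \<open>S\<close> lacks \<open>gC\<close>, and the parameters are set to
  \<open>n = 1\<close> and \<open>\<omega> = 1\<close>.
\<close>

definition relators :: "gen set \<Rightarrow> nat \<Rightarrow> 'k \<Rightarrow> (gen list \<Rightarrow>\<^sub>0 'k::field) set" where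
  "relators S n \<omega> = sweedler_relations \<union> (if gC \<in> S then
     {word (replicate n gC) - word [], word [gC, gG] - word [gG, gC],
      word [gC, gX] - Poly_Mapping.single [gX, gC] \<omega>} else {})"

locale sweedler_presentation =
  fixes S :: "gen set" and n :: nat and \<omega> :: "'k::field"
  assumes letters: "S = {gG, gX} \<or> S = {gG, gX, gC}" and n: "0 < n" and root: "\<omega> ^ n = 1"
begin

lemma gG: "gG \<in> S" and gX: "gX \<in> S"
  using letters by auto

lemma keys_word: "w \<in> lists S \<Longrightarrow> Poly_Mapping.keys (word w :: gen list \<Rightarrow>\<^sub>0 'k) \<subseteq> lists S"
  by (simp add: word_def)

lemma relators_closed: "relators S n \<omega> \<subseteq> carrier (free_algebra S)"
proof -
  have "\<forall>r\<in>sweedler_relations. Poly_Mapping.keys (r :: gen list \<Rightarrow>\<^sub>0 'k) \<subseteq> lists S"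
    using gG gX by (simp add: sweedler_relations_def keys_diff_subset keys_add_subset keys_word)
  moreover have "\<forall>r\<in>{word (replicate n gC) - word [], word [gC, gG] - word [gG, gC],
      word [gC, gX] - Poly_Mapping.single [gX, gC] \<omega>}. Poly_Mapping.keys r \<subseteq> lists S" if "gC \<in> S"
    using gG gX that by (simp add: keys_diff_subset keys_word in_lists_conv_set)
  ultimately show ?thesis
    unfolding relators_def by (simp add: free_algebra_def subset_iff)
qed

sublocale presentation S "relators S n \<omega>"
  by (rule presentation.intro[OF relators_closed])

text \<open>
  The bridge between formal relators and equations in an algebra. One direction is used for the universal
  property, the other for the relations between the generators themselves.
\<close>

lemma relators_vanish_iff:
  assumes U: "k_algebra U" and f: "f \<in> S \<rightarrow> carrier U"
  shows "(\<forall>r\<in>relators S n \<omega>. lin_ext U (word_eval U f) r = \<zero>\<^bsub>U\<^esub>) \<longleftrightarrow>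
    sweedler_rels U (f gG) (f gX) \<and> (gC \<in> S \<longrightarrow> smash_rels U n \<omega> (f gG) (f gX) (f gC))"
proof -
  interpret U: k_algebra U by fact
  let ?F = "lin_ext U (word_eval U f)"
  note lin = word_lin_linear[OF U f] and ww = word_lin_word[OF U f] and ws = word_lin_single[OF U f]
  have diff: "?F (word v - word w) = ?F (word v) \<ominus>\<^bsub>U\<^esub> ?F (word w)" if "v \<in> lists S" "w \<in> lists S" for v w
    using linear_map_diff[OF U lin, of "word v" "word w"] that keys_word by simp
  have add: "?F (word v + word w) = ?F (word v) \<oplus>\<^bsub>U\<^esub> ?F (word w)" if "v \<in> lists S" "w \<in> lists S" for v w
    using linear_map_add[OF lin, of "word v" "word w"] that keys_word by simp
  have fc: "f gG \<in> carrier U" "f gX \<in> carrier U" using f gG gX by auto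
  have 1: "(\<forall>r\<in>sweedler_relations. ?F r = \<zero>\<^bsub>U\<^esub>) \<longleftrightarrow> sweedler_rels U (f gG) (f gX)"
    using gG gX fc
    by (simp add: sweedler_relations_def sweedler_rels_def diff add ww U.minus_eq_zero_iff)
  have 2: "?F (word (replicate n gC) - word []) = \<zero>\<^bsub>U\<^esub> \<and> ?F (word [gC, gG] - word [gG, gC]) = \<zero>\<^bsub>U\<^esub> \<and>
      ?F (word [gC, gX] - Poly_Mapping.single [gX, gC] \<omega>) = \<zero>\<^bsub>U\<^esub> \<longleftrightarrow>
      f gC [^]\<^bsub>U\<^esub> n = \<one>\<^bsub>U\<^esub> \<and> f gC \<otimes>\<^bsub>U\<^esub> f gG = f gG \<otimes>\<^bsub>U\<^esub> f gC \<and>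
      f gC \<otimes>\<^bsub>U\<^esub> f gX = \<omega> \<odot>\<^bsub>U\<^esub> (f gX \<otimes>\<^bsub>U\<^esub> f gC)" if C: "gC \<in> S"
  proof -
    have fC: "f gC \<in> carrier U" using f C by auto
    have "?F (word [gC, gX] - Poly_Mapping.single [gX, gC] \<omega>) =
        ?F (word [gC, gX]) \<ominus>\<^bsub>U\<^esub> ?F (Poly_Mapping.single [gX, gC] \<omega>)"
      using linear_map_diff[OF U lin, of "word [gC, gX]" "Poly_Mapping.single [gX, gC] \<omega>"] C gX keys_word[of "[gC, gX]"]
      by simp
    then show ?thesis
      using gG gX C fC fc
      by (simp add: diff ww ws U.minus_eq_zero_iff word_eval_replicate[OF U] in_lists_conv_set)
  qed
  show ?thesis
    using 1 2 f by (auto simp: relators_def smash_rels_def)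
qed

abbreviation "Hp \<equiv> presented_hopf S (relators S n \<omega>) gen_comult gen_counit (gen_antipode n)"

lemma same_Hp: "same_algebra Hp Quo"
  by (rule presented_hopf_simps)

lemmas Hp_simps = same_algebraD[OF same_Hp]

lemma letter_in: "y \<in> S \<Longrightarrow> letter y \<in> carrier Quo"
  using letter_closed by auto

lemma quo_rels: "sweedler_rels Quo (letter gG) (letter gX)"
    "gC \<in> S \<Longrightarrow> smash_rels Quo n \<omega> (letter gG) (letter gX) (letter gC)"
  using relators_vanish_iff[OF k_algebra_quo letter_closed] relators_vanish by auto

lemma Hp_rels: "sweedler_rels Hp (letter gG) (letter gX)"
    "gC \<in> S \<Longrightarrow> smash_rels Hp n \<omega> (letter gG) (letter gX) (letter gC)"
  using quo_rels by (simp_all add: sweedler_rels_same[OF same_Hp] smash_rels_same[OF same_Hp])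

lemma Hp_universal:
  assumes U: "k_algebra U" and f: "f \<in> S \<rightarrow> carrier U"
    and "sweedler_rels U (f gG) (f gX)" "gC \<in> S \<Longrightarrow> smash_rels U n \<omega> (f gG) (f gX) (f gC)"
  shows "coset_ext U (word_eval U f) \<in> algebra_homs Hp U"
    and "y \<in> S \<Longrightarrow> coset_ext U (word_eval U f) (letter y) = f y"
proof -
  interpret U: k_algebra U by fact
  have van: "r \<in> relators S n \<omega> \<Longrightarrow> lin_ext U (word_eval U f) r = \<zero>\<^bsub>U\<^esub>" for r
    using relators_vanish_iff[OF U f] assms(3,4) by blast
  show "coset_ext U (word_eval U f) \<in> algebra_homs Hp U"
    unfolding algebra_homs_same_left[OF same_Hp] by (rule word_ext_hom[OF U f van])
  show "y \<in> S \<Longrightarrow> coset_ext U (word_eval U f) (letter y) = f y"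
    using word_ext_word[OF U f van, of "[y]"] f by (auto simp: Pi_iff)
qed

sublocale QQ: tensor Quo Quo by (intro tensorI k_algebra_quo)

lemma tensor_Hp: "tensor_algebra Hp Hp = QQ.T" "pure_tensor Hp Hp = QQ.pure"
  by (intro tensor_algebra_same pure_tensor_same same_Hp)+

abbreviation "comult_letter y \<equiv>
  lin_ext QQ.T (\<lambda>(v, w). QQ.pure (cls (word v)) (cls (word w))) (gen_comult y)"

lemma comult_letter:
  "comult_letter gG = QQ.pure (letter gG) (letter gG)"
  "comult_letter gX = QQ.pure (letter gX) \<one>\<^bsub>Quo\<^esub> \<oplus>\<^bsub>QQ.T\<^esub> QQ.pure (letter gG) (letter gX)"
  "gC \<in> S \<Longrightarrow> comult_letter gC = QQ.pure (letter gC) (letter gC)"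
proof -
  let ?f = "\<lambda>(v, w). QQ.pure (cls (word v)) (cls (word w))"
  have w: "cls (word v) \<in> carrier Quo" if "v \<in> lists S" for v
    using that by (auto simp: word_def intro!: Q.coset_closed)
  have f: "?f \<in> carrier (word_monoid S \<times>\<times> word_monoid S) \<rightarrow> carrier QQ.T"
    using w by (intro funcsetI) (simp add: split_beta mem_Times_iff QQ.pure_closed)
  have single: "lin_ext QQ.T ?f (Poly_Mapping.single (v, w) 1) = QQ.pure (cls (word v)) (cls (word w))"
    if "v \<in> lists S" "w \<in> lists S" for v w
    using that w lin_ext_single[OF QQ.k_algebra_tensor, of ?f "(v, w)" 1 for v w] by (simp add: QQ.pure_closed)
  have one: "cls (word []) = \<one>\<^bsub>Quo\<^esub>" by (simp add: word_def)
  show "comult_letter gG = QQ.pure (letter gG) (letter gG)" using gG by (simp add: single)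
  show "gC \<in> S \<Longrightarrow> comult_letter gC = QQ.pure (letter gC) (letter gC)" by (simp add: single)
  have "comult_letter gX = lin_ext QQ.T ?f (Poly_Mapping.single ([gX], []) 1) \<oplus>\<^bsub>QQ.T\<^esub>
      lin_ext QQ.T ?f (Poly_Mapping.single ([gG], [gX]) 1)"
    using linear_map_add[OF lin_ext_linear[OF QQ.k_algebra_tensor f],
        of "Poly_Mapping.single ([gX], []) 1" "Poly_Mapping.single ([gG], [gX]) 1"] gG gX
    by simp
  then show "comult_letter gX = QQ.pure (letter gX) \<one>\<^bsub>Quo\<^esub> \<oplus>\<^bsub>QQ.T\<^esub> QQ.pure (letter gG) (letter gX)"
    using gG gX by (simp add: single one del: quotient_algebra_simps)
qed

lemma comult_Hp:
  "comult Hp \<in> algebra_homs Hp QQ.T" "y \<in> S \<Longrightarrow> comult Hp (letter y) = comult_letter y"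
proof -
  have cl: "comult_letter \<in> S \<rightarrow> carrier QQ.T"
  proof
    fix y assume y: "y \<in> S"
    have "comult_letter gG \<in> carrier QQ.T"
      unfolding comult_letter(1) by (intro QQ.pure_closed letter_in gG)
    moreover have "comult_letter gX \<in> carrier QQ.T"
      unfolding comult_letter(2) by (intro QQ.T.a_closed QQ.pure_closed letter_in gG gX Quo.one_closed)
    moreover have "comult_letter gC \<in> carrier QQ.T" if "gC \<in> S"
      unfolding comult_letter(3)[OF that] by (intro QQ.pure_closed letter_in that)
    ultimately show "comult_letter y \<in> carrier QQ.T" using y by (cases y) (simp_all only:)
  qed
  have r: "sweedler_rels QQ.T (comult_letter gG) (comult_letter gX)"
    using sweedler_rels_tensor[OF k_algebra_quo quo_rels(1)] by (simp only: comult_letter)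
  have s: "smash_rels QQ.T n \<omega> (comult_letter gG) (comult_letter gX) (comult_letter gC)" if "gC \<in> S"
    using smash_rels_tensor[OF k_algebra_quo quo_rels(2)] that by (simp only: comult_letter)
  note u = Hp_universal[OF QQ.k_algebra_tensor cl r s]
  show "comult Hp \<in> algebra_homs Hp QQ.T"
    unfolding presented_hopf_simps(2) by (rule u(1))
  show "y \<in> S \<Longrightarrow> comult Hp (letter y) = comult_letter y"
    unfolding presented_hopf_simps(2) by (rule u(2))
qed

lemma counit_Hp:
  "counit Hp \<in> algebra_homs Hp scalars" "y \<in> S \<Longrightarrow> counit Hp (letter y) = gen_counit y"
proof -
  have r: "sweedler_rels scalars (gen_counit gG :: 'k) (gen_counit gX)"
    by (simp add: sweedler_rels_def)
  have s: "smash_rels scalars n \<omega> (gen_counit gG :: 'k) (gen_counit gX) (gen_counit gC)"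
    using r by (simp add: smash_rels_def)
  have c: "gen_counit \<in> S \<rightarrow> carrier (scalars :: ('k, 'k) module)" by simp
  note u = Hp_universal[OF k_algebra_scalars c r s]
  show "counit Hp \<in> algebra_homs Hp scalars"
    unfolding presented_hopf_simps(3) by (rule u(1))
  show "y \<in> S \<Longrightarrow> counit Hp (letter y) = gen_counit y"
    unfolding presented_hopf_simps(3) by (rule u(2))
qed

lemma antipode_Hp:
  "antipode Hp \<in> algebra_homs Hp (opposite Hp)" "antipode Hp (letter gG) = letter gG"
  "antipode Hp (letter gX) = \<ominus>\<^bsub>Hp\<^esub> (letter gG \<otimes>\<^bsub>Hp\<^esub> letter gX)"
  "gC \<in> S \<Longrightarrow> antipode Hp (letter gC) = letter gC [^]\<^bsub>Hp\<^esub> (n - 1)"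
proof -
  let ?s = "\<lambda>y. cls (gen_antipode n y)"
  have G: "?s gG = letter gG" by simp
  have gx: "cls (word [gG, gX]) = letter gG \<otimes>\<^bsub>Quo\<^esub> letter gX"
    using cls_word[of "[gG, gX]"] gG gX letter_in Quo.r_one by (simp del: quotient_algebra_simps)
  have "cls (- word [gG, gX]) = cls ((- 1) \<odot>\<^bsub>Fr\<^esub> word [gG, gX])"
    by (simp add: word_def single_uminus)
  also have "\<dots> = \<ominus>\<^bsub>Quo\<^esub> (letter gG \<otimes>\<^bsub>Quo\<^esub> letter gX)"
    using algebra_hom_scale[OF Q.coset_hom, of "word [gG, gX]" "-1"] gG gX letter_in keys_word[of "[gG, gX]"]
    by (simp add: gx Quo.scale_minus_one)
  finally have x: "?s gX = \<ominus>\<^bsub>Quo\<^esub> (letter gG \<otimes>\<^bsub>Quo\<^esub> letter gX)" by simp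
  have C: "?s gC = letter gC [^]\<^bsub>Quo\<^esub> (n - 1)" if "gC \<in> S"
    using cls_word[of "replicate (n - 1) gC"] that word_eval_replicate[OF k_algebra_quo, of letter gC] letter_in
    by (simp add: in_lists_conv_set)
  have sc: "?s \<in> S \<rightarrow> carrier (opposite Quo)"
  proof
    fix y assume y: "y \<in> S"
    have "?s gG \<in> carrier (opposite Quo)" unfolding G using letter_in[OF gG] by simp
    moreover have "?s gX \<in> carrier (opposite Quo)"
      unfolding x using letter_in[OF gG] letter_in[OF gX] by simp
    moreover have "?s gC \<in> carrier (opposite Quo)" if "gC \<in> S"
      unfolding C[OF that] using letter_in[OF that] by simp
    ultimately show "?s y \<in> carrier (opposite Quo)" using y by (cases y) (simp_all only:)
  qed
  have r: "sweedler_rels (opposite Quo) (?s gG) (?s gX)"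
    unfolding G x by (rule Quo.sweedler_rels_opposite[OF quo_rels(1)])
  have s: "smash_rels (opposite Quo) n \<omega> (?s gG) (?s gX) (?s gC)" if "gC \<in> S"
    unfolding G x C[OF that] by (rule Quo.smash_rels_opposite[OF quo_rels(2)[OF that] n root])
  note u = Hp_universal[OF k_algebra_opposite[OF k_algebra_quo] sc r s]
  show "antipode Hp \<in> algebra_homs Hp (opposite Hp)"
    unfolding presented_hopf_simps(4) algebra_homs_same_right[OF opposite_same[OF same_Hp]] by (rule u)
  have a: "antipode Hp (letter y) = ?s y" if "y \<in> S" for y
    unfolding presented_hopf_simps(4) by (rule u(2)[OF _ that])
  show "antipode Hp (letter gG) = letter gG" using a[OF gG] G by simp
  show "antipode Hp (letter gX) = \<ominus>\<^bsub>Hp\<^esub> (letter gG \<otimes>\<^bsub>Hp\<^esub> letter gX)"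
    unfolding a[OF gX] x by (simp add: a_inv_same[OF same_Hp] Hp_simps)
  show "antipode Hp (letter gC) = letter gC [^]\<^bsub>Hp\<^esub> (n - 1)" if "gC \<in> S"
    unfolding a[OF that] C[OF that] by (simp add: nat_pow_def Hp_simps)
qed

lemma k_algebra_Hp: "k_algebra Hp"
  by (rule k_algebra_same[OF k_algebra_quo same_Hp])

lemma generated_Hp: "h \<in> carrier Hp \<Longrightarrow> generated Hp (letter ` S) h"
  using generated_letters by (simp add: generated_same[OF same_Hp] Hp_simps)

lemma letters_Hp: "letter ` S \<subseteq> carrier Hp"
  using letter_closed by (auto simp: Hp_simps)

lemma grouplike_letters:
  "grouplike Hp (letter gG)" "gC \<in> S \<Longrightarrow> grouplike Hp (letter gC)"
  "skew_primitive Hp (letter gG) (letter gX)"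
  using gG gX letter_in comult_Hp(2) counit_Hp(2)
  by (simp_all add: grouplike_def skew_primitive_def tensor_Hp comult_letter Hp_simps
    del: gen_comult.simps quotient_algebra_simps)

lemma hopf_algebra_Hp: "hopf_algebra Hp"
proof -
  interpret H: k_algebra Hp by (rule k_algebra_Hp)
  note d = H.sweedler_relsD[OF Hp_rels(1)]
  have "hopf_generators Hp (letter ` S)"
  proof (intro hopf_generators.intro hopf_generators_axioms.intro k_algebra_Hp generated_Hp letters_Hp
      antipode_Hp(1) counit_Hp(1))
    show "comult Hp \<in> algebra_homs Hp (tensor_algebra Hp Hp)" using comult_Hp by (simp add: tensor_Hp)
    fix z assume "z \<in> letter ` S"
    then obtain y where z: "z = letter y" and y: "y \<in> S" by auto
    show "grouplike Hp z \<and> antipode Hp z \<otimes>\<^bsub>Hp\<^esub> z = \<one>\<^bsub>Hp\<^esub> \<and> z \<otimes>\<^bsub>Hp\<^esub> antipode Hp z = \<one>\<^bsub>Hp\<^esub> \<or>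
      (\<exists>g. grouplike Hp g \<and> antipode Hp g \<otimes>\<^bsub>Hp\<^esub> g = \<one>\<^bsub>Hp\<^esub> \<and> g \<otimes>\<^bsub>Hp\<^esub> antipode Hp g = \<one>\<^bsub>Hp\<^esub> \<and>
        skew_primitive Hp g z \<and> antipode Hp z = \<ominus>\<^bsub>Hp\<^esub> (antipode Hp g \<otimes>\<^bsub>Hp\<^esub> z))"
    proof (cases y)
      case gG
      then show ?thesis using z d antipode_Hp(2) grouplike_letters(1) by simp
    next
      case gX
      then have "grouplike Hp (letter gG) \<and> antipode Hp (letter gG) \<otimes>\<^bsub>Hp\<^esub> letter gG = \<one>\<^bsub>Hp\<^esub> \<and>
          letter gG \<otimes>\<^bsub>Hp\<^esub> antipode Hp (letter gG) = \<one>\<^bsub>Hp\<^esub> \<and>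
          skew_primitive Hp (letter gG) z \<and> antipode Hp z = \<ominus>\<^bsub>Hp\<^esub> (antipode Hp (letter gG) \<otimes>\<^bsub>Hp\<^esub> z)"
        using z d antipode_Hp(2,3) grouplike_letters(1,3) by simp
      then show ?thesis by blast
    next
      case gC
      with y have C: "gC \<in> S" by simp
      note e = H.smash_relsD[OF Hp_rels(2)[OF C]]
      obtain m where m: "n = Suc m" using n by (cases n) auto
      have "antipode Hp z \<otimes>\<^bsub>Hp\<^esub> z = \<one>\<^bsub>Hp\<^esub>" "z \<otimes>\<^bsub>Hp\<^esub> antipode Hp z = \<one>\<^bsub>Hp\<^esub>"
        using antipode_Hp(4)[OF C] e(2,3) H.nat_pow_Suc2[OF e(2), of m] z gC m by simp_all
      then show ?thesis using z gC grouplike_letters(2)[OF C] by simp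
    qed
  qed
  then show ?thesis by (rule hopf_generators.hopf_algebra)
qed

end

lemma H4_presentation: "H4 = presented_hopf {gG, gX} (relators {gG, gX} 1 1) gen_comult gen_counit (gen_antipode 1)"
  by (simp add: H4_def relators_def)

lemma H4n_presentation: "H4n n \<omega> =
    presented_hopf {gG, gX, gC} (relators {gG, gX, gC} n \<omega>) gen_comult gen_counit (gen_antipode n)"
  by (simp add: H4n_def relators_def)

text \<open>
  The elements \<open>g\<close>, \<open>x\<close> (and \<open>c\<close>) of \<open>H\<close> behave like the generators of \<open>H4\<close> (of \<open>H4n n \<omega>\<close>). Only relations
  and comultiplications are recorded, so the property passes to images under Hopf algebra maps.
\<close>

definition is_H4 :: "('k::field, 'a) hopf \<Rightarrow> 'a \<Rightarrow> 'a \<Rightarrow> bool" where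
  "is_H4 H g x \<longleftrightarrow> hopf_algebra H \<and> sweedler_rels H g x \<and> grouplike H g \<and> skew_primitive H g x"

definition is_H4n :: "nat \<Rightarrow> 'k \<Rightarrow> ('k::field, 'a) hopf \<Rightarrow> 'a \<Rightarrow> 'a \<Rightarrow> 'a \<Rightarrow> bool" where
  "is_H4n n \<omega> H g x c \<longleftrightarrow> is_H4 H g x \<and> smash_rels H n \<omega> g x c \<and> grouplike H c"

definition H4_gen :: "gen \<Rightarrow> (gen list \<Rightarrow>\<^sub>0 'k::field) set" where
  "H4_gen y = genideal (free_algebra {gG, gX}) (relators {gG, gX} 1 1) +>\<^bsub>free_algebra {gG, gX}\<^esub> word [y]"

definition H4n_gen :: "nat \<Rightarrow> 'k \<Rightarrow> gen \<Rightarrow> (gen list \<Rightarrow>\<^sub>0 'k::field) set" where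
  "H4n_gen n \<omega> y = genideal (free_algebra {gG, gX, gC}) (relators {gG, gX, gC} n \<omega>) +>\<^bsub>free_algebra {gG, gX, gC}\<^esub> word [y]"

lemma
  shows is_H4_H4: "is_H4 (H4 :: ('k::field, _) hopf) (H4_gen gG) (H4_gen gX)"
    and generated_H4: "h \<in> carrier (H4 :: ('k, _) hopf) \<Longrightarrow> generated H4 {H4_gen gG, H4_gen gX} h"
    and H4_universal: "k_algebra (U :: ('k, 'a, 'm) module_scheme) \<Longrightarrow> sweedler_rels U g x \<Longrightarrow>
      \<exists>f\<in>algebra_homs H4 U. f (H4_gen gG) = g \<and> f (H4_gen gX) = x"
proof -
  interpret sweedler_presentation "{gG, gX}" 1 "1::'k" by unfold_locales auto
  note eq = H4_presentation[symmetric, where 'a = 'k]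
  have letter: "letter y = H4_gen y" for y by (simp add: H4_gen_def free_algebra_eq)
  show "is_H4 (H4 :: ('k, _) hopf) (H4_gen gG) (H4_gen gX)"
    using hopf_algebra_Hp Hp_rels(1) grouplike_letters(1,3) unfolding is_H4_def eq letter by simp
  show "h \<in> carrier (H4 :: ('k, _) hopf) \<Longrightarrow> generated H4 {H4_gen gG, H4_gen gX} h"
    using generated_Hp[of h] unfolding eq letter by simp
  show "\<exists>f\<in>algebra_homs H4 U. f (H4_gen gG) = g \<and> f (H4_gen gX) = x"
    if U: "k_algebra U" and r: "sweedler_rels U g x"
  proof -
    have f: "(\<lambda>y. if y = gG then g else x) \<in> {gG, gX} \<rightarrow> carrier U"
      using k_algebra.sweedler_relsD[OF U r] by auto
    show ?thesis
      using Hp_universal[OF U f] r unfolding eq letter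
      by (intro bexI[of _ "coset_ext U (word_eval U (\<lambda>y. if y = gG then g else x))"]) simp_all
  qed
qed

lemma
  fixes \<omega> :: "'k::field"
  assumes "0 < n" "\<omega> ^ n = 1"
  shows is_H4n_H4n: "is_H4n n \<omega> (H4n n \<omega>) (H4n_gen n \<omega> gG) (H4n_gen n \<omega> gX) (H4n_gen n \<omega> gC)"
    and generated_H4n: "h \<in> carrier (H4n n \<omega>) \<Longrightarrow>
      generated (H4n n \<omega>) {H4n_gen n \<omega> gG, H4n_gen n \<omega> gX, H4n_gen n \<omega> gC} h"
    and H4n_universal: "k_algebra (U :: ('k, 'a, 'm) module_scheme) \<Longrightarrow> smash_rels U n \<omega> g x c \<Longrightarrow>
      \<exists>f\<in>algebra_homs (H4n n \<omega>) U. f (H4n_gen n \<omega> gG) = g \<and> f (H4n_gen n \<omega> gX) = x \<and> f (H4n_gen n \<omega> gC) = c"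
proof -
  interpret sweedler_presentation "{gG, gX, gC}" n \<omega> using assms by unfold_locales auto
  note eq = H4n_presentation[symmetric, of n \<omega>]
  have letter: "letter y = H4n_gen n \<omega> y" for y by (simp add: H4n_gen_def free_algebra_eq)
  show "is_H4n n \<omega> (H4n n \<omega>) (H4n_gen n \<omega> gG) (H4n_gen n \<omega> gX) (H4n_gen n \<omega> gC)"
    using hopf_algebra_Hp Hp_rels grouplike_letters unfolding is_H4n_def is_H4_def eq letter by simp
  show "h \<in> carrier (H4n n \<omega>) \<Longrightarrow>
      generated (H4n n \<omega>) {H4n_gen n \<omega> gG, H4n_gen n \<omega> gX, H4n_gen n \<omega> gC} h"
    using generated_Hp[of h] unfolding eq letter by simp
  show "\<exists>f\<in>algebra_homs (H4n n \<omega>) U. f (H4n_gen n \<omega> gG) = g \<and> f (H4n_gen n \<omega> gX) = x \<and> f (H4n_gen n \<omega> gC) = c"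
    if U: "k_algebra U" and r: "smash_rels U n \<omega> g x c"
  proof -
    note d = k_algebra.smash_relsD[OF U r]
    have f: "case_gen g x c \<in> {gG, gX, gC} \<rightarrow> carrier U"
      using k_algebra.sweedler_relsD[OF U d(1)] d by auto
    show ?thesis
      using Hp_universal[OF U f] r d(1) unfolding eq letter
      by (intro bexI[of _ "coset_ext U (word_eval U (case_gen g x c))"]) simp_all
  qed
qed

section \<open>The monomial basis\<close>

text \<open>
  Linear endomorphisms of a space of functions.
\<close>

definition end_algebra :: "('k::field, ('i \<Rightarrow> 'k) \<Rightarrow> ('i \<Rightarrow> 'k)) module" where
  "end_algebra =
    \<lparr>carrier = {F. (\<forall>u v. F (\<lambda>i. u i + v i) = (\<lambda>i. F u i + F v i)) \<and> (\<forall>a u. F (\<lambda>i. a * u i) = (\<lambda>i. a * F u i))},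
     monoid.mult = (\<lambda>F G u. F (G u)),
     one = (\<lambda>u. u),
     ring.zero = (\<lambda>u i. 0),
     add = (\<lambda>F G u i. F u i + G u i),
     module.smult = (\<lambda>a F u i. a * F u i)\<rparr>"

lemma end_algebra_simps [simp]:
  "F \<in> carrier end_algebra \<longleftrightarrow>
    (\<forall>u v. F (\<lambda>i. u i + v i) = (\<lambda>i. F u i + F v i)) \<and> (\<forall>a u. F (\<lambda>i. a * u i) = (\<lambda>i. a * F u i))"
  "F \<otimes>\<^bsub>end_algebra\<^esub> G = (\<lambda>u. F (G u))" "\<one>\<^bsub>end_algebra\<^esub> = (\<lambda>u. u)" "\<zero>\<^bsub>end_algebra\<^esub> = (\<lambda>u i. 0)"
  "F \<oplus>\<^bsub>end_algebra\<^esub> G = (\<lambda>u i. F u i + G u i)" "a \<odot>\<^bsub>end_algebra\<^esub> F = (\<lambda>u i. a * F u i)"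
  by (simp_all add: end_algebra_def)

lemma k_algebra_end: "k_algebra (end_algebra :: ('k::field, ('i \<Rightarrow> 'k) \<Rightarrow> ('i \<Rightarrow> 'k)) module)"
proof (intro k_algebra.intro k_algebra_axioms.intro)
  let ?E = "end_algebra :: ('k, ('i \<Rightarrow> 'k) \<Rightarrow> ('i \<Rightarrow> 'k)) module"
  show "ring ?E"
  proof (rule ringI)
    show "abelian_group ?E"
    proof (rule abelian_groupI)
      fix F assume "F \<in> carrier ?E"
      then have "(\<lambda>u i. - F u i) \<in> carrier ?E" by simp
      then show "\<exists>G\<in>carrier ?E. G \<oplus>\<^bsub>?E\<^esub> F = \<zero>\<^bsub>?E\<^esub>" by (rule bexI[rotated]) simp
    qed (auto simp: algebra_simps)
    show "monoid ?E" by (rule monoidI) auto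
  qed (auto simp: algebra_simps)
qed (auto simp: algebra_simps)

text \<open>
  A function \<open>u\<close> of the exponents \<open>((a, b), i)\<close> stands for the linear combination of the monomials \<open>g^a x^b c^i\<close>
  with coefficients \<open>u\<close>. The operators \<open>rep_g\<close>, \<open>rep_x\<close> and \<open>rep_c\<close> are what left multiplication by \<open>g\<close>, \<open>x\<close>
  and \<open>c\<close> has to do with the coefficients.
\<close>

definition rep_g :: "(((bool \<times> bool) \<times> nat) \<Rightarrow> 'k) \<Rightarrow> ((bool \<times> bool) \<times> nat) \<Rightarrow> 'k::field" where
  "rep_g u = (\<lambda>((a, b), i). u ((\<not> a, b), i))"

definition rep_x :: "(((bool \<times> bool) \<times> nat) \<Rightarrow> 'k) \<Rightarrow> ((bool \<times> bool) \<times> nat) \<Rightarrow> 'k::field" where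
  "rep_x u = (\<lambda>((a, b), i). if b then (if a then - 1 else 1) * u ((a, False), i) else 0)"

text \<open>
  Multiplication by \<open>c\<close> shifts the exponents of \<open>c\<close> below \<open>n\<close> cyclically. Larger indices do not occur as
  exponents; they are kept fixed, so that the \<open>n\<close>-th iterate is the identity everywhere.
\<close>

definition cyclic_pred :: "nat \<Rightarrow> nat \<Rightarrow> nat" where
  "cyclic_pred n i = (if i < n then (i + (n - 1)) mod n else i)"

definition rep_c :: "nat \<Rightarrow> 'k \<Rightarrow> (((bool \<times> bool) \<times> nat) \<Rightarrow> 'k) \<Rightarrow> ((bool \<times> bool) \<times> nat) \<Rightarrow> 'k::field" where
  "rep_c n \<omega> u = (\<lambda>((a, b), i). (if b then \<omega> else 1) * u ((a, b), cyclic_pred n i))"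

lemma rep_sweedler_rels: "sweedler_rels end_algebra rep_g rep_x"
  by (auto simp: sweedler_rels_def rep_g_def rep_x_def fun_eq_iff algebra_simps)

lemma cyclic_pred_iterate: "(cyclic_pred n ^^ m) i = (if i < n then (i + m * (n - 1)) mod n else i)"
proof (cases "i < n")
  case True
  show ?thesis
  proof (induct m)
    case (Suc m)
    have "cyclic_pred n ((i + m * (n - 1)) mod n) = ((i + m * (n - 1)) mod n + (n - 1)) mod n"
      using True by (simp add: cyclic_pred_def)
    also have "\<dots> = (i + m * (n - 1) + (n - 1)) mod n" by (rule mod_add_left_eq)
    also have "\<dots> = (i + Suc m * (n - 1)) mod n" by (simp add: ac_simps)
    finally show ?case using Suc True by simp
  qed (use True in simp)
next
  case False
  then show ?thesis by (induct m) (auto simp: cyclic_pred_def)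
qed

lemma rep_c_pow: "rep_c n \<omega> [^]\<^bsub>end_algebra\<^esub> (m::nat) =
    (\<lambda>u ((a, b), i). (if b then \<omega> ^ m else 1) * u ((a, b), (cyclic_pred n ^^ m) i))"
proof (induct m)
  case 0
  show ?case by (simp add: pow_0 fun_eq_iff)
next
  case (Suc m)
  then show ?case by (simp only: pow_Suc) (simp add: fun_eq_iff rep_c_def funpow_swap1)
qed

lemma rep_smash_rels:
  fixes \<omega> :: "'k::field"
  assumes "0 < n" "\<omega> ^ n = 1"
  shows "smash_rels end_algebra n \<omega> rep_g rep_x (rep_c n \<omega>)"
proof -
  have "(cyclic_pred n ^^ n) i = i" for i by (simp add: cyclic_pred_iterate)
  then have "rep_c n \<omega> [^]\<^bsub>end_algebra\<^esub> n = \<one>\<^bsub>end_algebra\<^esub>"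
    using assms by (simp add: rep_c_pow fun_eq_iff)
  then show ?thesis
    by (auto simp: smash_rels_def rep_sweedler_rels)
      (auto simp: rep_g_def rep_x_def rep_c_def fun_eq_iff algebra_simps)
qed

definition monomial :: "('a, 'm) ring_scheme \<Rightarrow> 'a \<Rightarrow> 'a \<Rightarrow> 'a \<Rightarrow> (bool \<times> bool) \<times> nat \<Rightarrow> 'a" where
  "monomial H g x c = (\<lambda>((a, b), i).
     (if a then g else \<one>\<^bsub>H\<^esub>) \<otimes>\<^bsub>H\<^esub> ((if b then x else \<one>\<^bsub>H\<^esub>) \<otimes>\<^bsub>H\<^esub> c [^]\<^bsub>H\<^esub> i))"

lemma monomial_hom:
  assumes "f \<in> algebra_homs H L" "k_algebra H" "g \<in> carrier H" "x \<in> carrier H" "c \<in> carrier H"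
  shows "f (monomial H g x c p) = monomial L (f g) (f x) (f c) p"
proof -
  interpret H: k_algebra H by fact
  obtain a b i where "p = ((a, b), i)" by (cases p, cases "fst p") auto
  then show ?thesis
    using assms(3-) by (simp add: monomial_def algebra_hom_mult[OF assms(1)] algebra_hom_one[OF assms(1)]
      algebra_hom_pow[OF assms(1,2)])
qed

lemma (in k_algebra) monomial_closed:
  "g \<in> carrier A \<Longrightarrow> x \<in> carrier A \<Longrightarrow> c \<in> carrier A \<Longrightarrow> monomial A g x c p \<in> carrier A"
  by (cases p, cases "fst p") (auto simp: monomial_def)

text \<open>
  The span of the monomials contains \<open>1\<close> and is stable under left multiplication by \<open>g\<close>, \<open>x\<close> and \<open>c\<close>, since
  each of these sends a monomial to a multiple of a monomial.
\<close>

lemma linspan_monomials: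
  assumes H: "k_algebra H" and r: "smash_rels H n \<omega> g x c" and n: "0 < n"
    and z: "generated H {g, x, c} z"
  shows "linspan H (monomial H g x c ` (UNIV \<times> {..<n})) z"
proof -
  interpret H: k_algebra H by fact
  note d = H.smash_relsD[OF r] H.sweedler_relsD[OF H.smash_relsD(1)[OF r]]
  note assoc = H.sweedler_rels_assoc[OF d(1)]
  let ?B = "monomial H g x c ` (UNIV \<times> {..<n})" and ?m = "\<lambda>a b i. monomial H g x c ((a, b), i)"
  have B: "?B \<subseteq> carrier H" using d by (auto intro: H.monomial_closed)
  have mon: "linspan H ?B (?m a b i)" if "i < n" for a b i
    using that by (auto intro!: linspan.gen)
  have one: "linspan H ?B \<one>\<^bsub>H\<^esub>"
    using mon[of 0 False False] n by (simp add: monomial_def pow_0)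
  have ci: "c [^]\<^bsub>H\<^esub> i \<in> carrier H" for i :: nat using d by simp
  have ca: "c \<otimes>\<^bsub>H\<^esub> (g \<otimes>\<^bsub>H\<^esub> y) = g \<otimes>\<^bsub>H\<^esub> (c \<otimes>\<^bsub>H\<^esub> y)" "c \<otimes>\<^bsub>H\<^esub> (x \<otimes>\<^bsub>H\<^esub> y) = \<omega> \<odot>\<^bsub>H\<^esub> (x \<otimes>\<^bsub>H\<^esub> (c \<otimes>\<^bsub>H\<^esub> y))"
    if "y \<in> carrier H" for y
    using that d by (simp_all flip: H.m_assoc)
  have cc: "c \<otimes>\<^bsub>H\<^esub> c [^]\<^bsub>H\<^esub> i = c [^]\<^bsub>H\<^esub> Suc i" for i :: nat using H.nat_pow_Suc2[OF d(2)] by simp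
  have step: "linspan H ?B (y \<otimes>\<^bsub>H\<^esub> ?m a b i)" if y: "y \<in> {g, x, c}" and i: "i < n" for y a b i
  proof -
    consider "y = g" | "y = x" | "y = c" using y by auto
    then show ?thesis
    proof cases
      case 1
      have "g \<otimes>\<^bsub>H\<^esub> ?m a b i = ?m (\<not> a) b i"
        using d(6-) ci by (cases b) (auto simp: monomial_def assoc)
      with 1 mon[OF i] show ?thesis by simp
    next
      case 2
      have "x \<otimes>\<^bsub>H\<^esub> ?m a b i = (if b then \<zero>\<^bsub>H\<^esub> else (if a then - 1 else 1) \<odot>\<^bsub>H\<^esub> ?m a True i)"
        using d(6-) ci by (auto simp: monomial_def assoc H.scale_minus_one)
      with 2 mon[OF i] show ?thesis by (auto intro: linspan.zero linspan.scale)
    next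
      case 3
      have "c \<otimes>\<^bsub>H\<^esub> ?m a b i = (if b then \<omega> else 1) \<odot>\<^bsub>H\<^esub> ?m a b (Suc i)"
        using d(2,6-) ci by (auto simp: monomial_def ca cc simp del: H.nat_pow_Suc)
      moreover have "?m a b (Suc i) = ?m a b (Suc i mod n)"
        using i d(3) n by (cases "Suc i = n") (auto simp: monomial_def pow_0)
      moreover have "Suc i mod n < n" using n by simp
      ultimately show ?thesis using 3 mon by (auto intro: linspan.scale)
    qed
  qed
  have left: "linspan H ?B (y \<otimes>\<^bsub>H\<^esub> z)" if y: "y \<in> {g, x, c}" and z: "linspan H ?B z" for y z
    using z
  proof induct
    case zero
    show ?case using y d by (auto intro: linspan.zero)
  next
    case (gen z)
    then show ?case using step[OF y] by auto
  next
    case (add z z')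
    then have "y \<otimes>\<^bsub>H\<^esub> (z \<oplus>\<^bsub>H\<^esub> z') = y \<otimes>\<^bsub>H\<^esub> z \<oplus>\<^bsub>H\<^esub> y \<otimes>\<^bsub>H\<^esub> z'"
      using y d linspan_closed[OF H B] by (intro H.r_distr) auto
    with add show ?case by (simp add: linspan.add)
  next
    case (scale z a)
    then have "y \<otimes>\<^bsub>H\<^esub> (a \<odot>\<^bsub>H\<^esub> z) = a \<odot>\<^bsub>H\<^esub> (y \<otimes>\<^bsub>H\<^esub> z)"
      using y d linspan_closed[OF H B] by (intro H.scale_mult_right) auto
    with scale show ?case by (simp add: linspan.scale)
  qed
  have gens: "linspan H ?B y" if "y \<in> {g, x, c}" for y
    using left[OF that one] that d by auto
  from z show ?thesis
    by induct (auto intro: gens one left linspan.add linspan.scale)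
qed

abbreviation delta_one :: "((bool \<times> bool) \<times> nat) \<Rightarrow> 'k::field" where
  "delta_one \<equiv> \<lambda>p. if p = ((False, False), 0) then 1 else 0"

text \<open>
  Acting with a monomial on the function \<open>delta_one\<close>, which stands for the unit, gives
  the function that stands for this monomial. So the values of \<open>\<rho> h delta_one\<close> are the coordinates of \<open>h\<close>.
\<close>

lemma dual_basis_monomials:
  fixes \<omega> :: "'k::field" and H :: "('k, 'a, 'm) module_scheme"
  assumes H: "k_algebra H" and r: "smash_rels H n \<omega> g x c" and n: "0 < n" "\<omega> ^ n = 1"
    and gen: "\<And>h. h \<in> carrier H \<Longrightarrow> generated H {g, x, c} h"
    and \<rho>: "\<rho> \<in> algebra_homs H end_algebra" "\<rho> g = rep_g" "\<rho> x = rep_x" "\<rho> c = rep_c n \<omega>"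
  shows "dual_basis H (UNIV \<times> {..<n}) (monomial H g x c) (\<lambda>p h. \<rho> h delta_one p)"
proof -
  interpret H: k_algebra H by fact
  note d = H.smash_relsD[OF r] H.sweedler_relsD[OF H.smash_relsD(1)[OF r]]
  have lin: "(\<lambda>h. \<rho> h delta_one p) \<in> linear_maps H scalars" for p
    using algebra_hom_add[OF \<rho>(1)] algebra_hom_scale[OF \<rho>(1)] by (intro linear_mapsI) auto
  have pow: "(cyclic_pred n ^^ i) j = 0 \<longleftrightarrow> i = j" if "i < n" for i j
  proof -
    have "(j + i * (n - 1)) mod n = 0 \<longleftrightarrow> i = j" if j: "j < n"
    proof -
      have eq: "int (j + i * (n - 1)) = int i * int n + (int j - int i)"
      proof -
        have "int (n - 1) = int n - 1" using n by (simp add: of_nat_diff)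
        then show ?thesis by (simp only: of_nat_add of_nat_mult) (simp add: algebra_simps)
      qed
      have "(j + i * (n - 1)) mod n = 0 \<longleftrightarrow> int n dvd int (j + i * (n - 1))"
        by (simp only: mod_eq_0_iff_dvd of_nat_dvd_iff)
      also have "\<dots> \<longleftrightarrow> int n dvd int j - int i" unfolding eq by (rule dvd_add_times_triv_left_iff)
      also have "\<dots> \<longleftrightarrow> int j mod int n = int i mod int n" by (rule mod_eq_dvd_iff[symmetric])
      also have "\<dots> \<longleftrightarrow> i = j" using j \<open>i < n\<close> by auto
      finally show ?thesis .
    qed
    with that show ?thesis by (auto simp: cyclic_pred_iterate)
  qed
  have "\<rho> (monomial H g x c ((a, b), i)) delta_one ((a', b'), j) = (if ((a', b'), j) = ((a, b), i) then 1 else 0)"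
    if "i < n" for a b i a' b' j
    using pow[OF that, of j]
    unfolding monomial_hom[OF \<rho>(1) H d(6,7,2)] unfolding \<rho>(2-) monomial_def
    by (simp add: rep_c_pow) (auto simp: rep_g_def rep_x_def)
  then show ?thesis
    using lin gen H.monomial_closed[OF d(6,7,2)] linspan_monomials[OF H r n(1)]
    unfolding dual_basis_def by (auto simp del: end_algebra_simps)
qed

lemma dual_basis_H4n:
  fixes \<omega> :: "'k::field"
  assumes n: "0 < n" "\<omega> ^ n = 1"
  shows "\<exists>\<phi>. dual_basis (H4n n \<omega>) (UNIV \<times> {..<n})
    (monomial (H4n n \<omega>) (H4n_gen n \<omega> gG) (H4n_gen n \<omega> gX) (H4n_gen n \<omega> gC)) \<phi>"
proof -
  note i = is_H4n_H4n[OF n]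
  have H: "k_algebra (H4n n \<omega>)" using i by (simp add: is_H4n_def is_H4_def hopf_k_algebra)
  obtain \<rho> where "\<rho> \<in> algebra_homs (H4n n \<omega>) end_algebra" "\<rho> (H4n_gen n \<omega> gG) = rep_g"
    "\<rho> (H4n_gen n \<omega> gX) = rep_x" "\<rho> (H4n_gen n \<omega> gC) = rep_c n \<omega>"
    using H4n_universal[OF n k_algebra_end rep_smash_rels[OF n]] by blast
  from dual_basis_monomials[OF H _ n generated_H4n[OF n] this] i show ?thesis
    by (auto simp: is_H4n_def)
qed

lemma generated_mono: "generated A S x \<Longrightarrow> S \<subseteq> T \<Longrightarrow> generated A T x"
  by (induct rule: generated.induct) (auto intro: generated.intros)

lemma dual_basis_reindex:
  assumes b: "dual_basis V I b \<phi>" and r: "bij_betw r J I"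
  shows "dual_basis V J (\<lambda>j. b (r j)) (\<lambda>j. \<phi> (r j))"
proof -
  have im: "r ` J = I" and inj: "inj_on r J" using r by (auto simp: bij_betw_def)
  then have "(\<lambda>j. b (r j)) ` J = b ` I" by (auto simp: image_image[symmetric])
  moreover have "finite J" using dual_basisD(1)[OF b] r bij_betw_finite by blast
  ultimately show ?thesis
    using b im inj unfolding dual_basis_def by (auto simp: inj_on_def)
qed

text \<open>
  Sweedler's algebra satisfies the relations of the extension for \<open>n = 1\<close>, with \<open>c = 1\<close>.
\<close>

lemma dual_basis_H4:
  "\<exists>\<phi>. dual_basis (H4 :: ('k::field, _) hopf) UNIV
    (\<lambda>(a, b). (if a then H4_gen gG else \<one>\<^bsub>H4\<^esub>) \<otimes>\<^bsub>H4\<^esub> (if b then H4_gen gX else \<one>\<^bsub>H4\<^esub>)) \<phi>"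
proof -
  let ?H = "H4 :: ('k, _) hopf"
  note i = is_H4_H4[where 'k = 'k]
  have H: "k_algebra ?H" using i by (simp add: is_H4_def hopf_k_algebra)
  interpret H: k_algebra ?H by fact
  have s: "sweedler_rels ?H (H4_gen gG) (H4_gen gX)" using i by (simp add: is_H4_def)
  then have r: "smash_rels ?H 1 1 (H4_gen gG) (H4_gen gX) \<one>\<^bsub>H4\<^esub>"
    using H.sweedler_relsD[OF s] by (simp add: smash_rels_def)
  obtain \<rho> where \<rho>: "\<rho> \<in> algebra_homs ?H end_algebra" "\<rho> (H4_gen gG) = rep_g" "\<rho> (H4_gen gX) = rep_x"
    using H4_universal[OF k_algebra_end rep_sweedler_rels] by blast
  have "\<rho> \<one>\<^bsub>H4\<^esub> = rep_c 1 1"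
    using algebra_hom_one[OF \<rho>(1)] by (auto simp: fun_eq_iff rep_c_def cyclic_pred_def)
  from dual_basis_monomials[OF H r _ _ generated_mono[OF generated_H4] \<rho> this]
  have "dual_basis ?H (UNIV \<times> {..<1}) (monomial ?H (H4_gen gG) (H4_gen gX) \<one>\<^bsub>H4\<^esub>) (\<lambda>p h. \<rho> h delta_one p)"
    by auto
  then have "dual_basis ?H UNIV (\<lambda>p. monomial ?H (H4_gen gG) (H4_gen gX) \<one>\<^bsub>H4\<^esub> (p, 0)) (\<lambda>p h. \<rho> h delta_one (p, 0))"
    by (rule dual_basis_reindex) (auto simp: bij_betw_def inj_on_def)
  then have "dual_basis ?H UNIV (\<lambda>(a, b). (if a then H4_gen gG else \<one>\<^bsub>H4\<^esub>) \<otimes>\<^bsub>H4\<^esub> (if b then H4_gen gX else \<one>\<^bsub>H4\<^esub>))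
      (\<lambda>p h. \<rho> h delta_one (p, 0))"
    by (rule dual_basis_cong) (use H.sweedler_relsD[OF s] in \<open>auto simp: monomial_def\<close>)
  then show ?thesis by blast
qed

section \<open>Group-like and skew-primitive elements\<close>

lemma hopf_homs_H4n:
  fixes \<omega> :: "'k::field"
  assumes n: "0 < n" "\<omega> ^ n = 1" and L: "is_H4n n \<omega> L g x c"
  shows "\<exists>f\<in>hopf_homs (H4n n \<omega>) L.
    f (H4n_gen n \<omega> gG) = g \<and> f (H4n_gen n \<omega> gX) = x \<and> f (H4n_gen n \<omega> gC) = c"
proof -
  have hL: "hopf_algebra L" and r: "smash_rels L n \<omega> g x c" using L by (auto simp: is_H4n_def is_H4_def)
  note i = is_H4n_H4n[OF n]
  then have hH: "hopf_algebra (H4n n \<omega>)" by (simp add: is_H4n_def is_H4_def)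
  obtain f where f: "f \<in> algebra_homs (H4n n \<omega>) L"
    "f (H4n_gen n \<omega> gG) = g" "f (H4n_gen n \<omega> gX) = x" "f (H4n_gen n \<omega> gC) = c"
    using H4n_universal[OF n hopf_k_algebra[OF hL] r] by blast
  have "f \<in> hopf_homs (H4n n \<omega>) L"
    by (rule hopf_homI_generators[OF hH hL _ generated_H4n[OF n] f(1)])
      (use i L f(2-) in \<open>auto simp: is_H4n_def is_H4_def grouplike_def skew_primitive_def\<close>)
  with f show ?thesis by blast
qed

text \<open>
  The homomorphism given by the universal property sends the monomials, which span \<open>H4n n \<omega>\<close>, to a basis.
\<close>

lemma H4n_hopf_isomorphicI:
  fixes \<omega> :: "'k::field"
  assumes n: "0 < n" "\<omega> ^ n = 1" and L: "is_H4n n \<omega> L g x c"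
    and basis: "dual_basis L (UNIV \<times> {..<n}) (monomial L g x c) \<phi>"
  shows "hopf_isomorphic (H4n n \<omega>) L"
proof -
  have hL: "hopf_algebra L" using L by (auto simp: is_H4n_def is_H4_def)
  note i = is_H4n_H4n[OF n]
  then have hH: "hopf_algebra (H4n n \<omega>)" by (simp add: is_H4n_def is_H4_def)
  note k = hopf_k_algebra[OF hH] hopf_k_algebra[OF hL]
  obtain f where f: "f \<in> hopf_homs (H4n n \<omega>) L"
    "f (H4n_gen n \<omega> gG) = g" "f (H4n_gen n \<omega> gX) = x" "f (H4n_gen n \<omega> gC) = c"
    using hopf_homs_H4n[OF n L] by blast
  obtain \<psi> where b: "dual_basis (H4n n \<omega>) (UNIV \<times> {..<n})
      (monomial (H4n n \<omega>) (H4n_gen n \<omega> gG) (H4n_gen n \<omega> gX) (H4n_gen n \<omega> gC)) \<psi>"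
    using dual_basis_H4n[OF n] by blast
  have "f (monomial (H4n n \<omega>) (H4n_gen n \<omega> gG) (H4n_gen n \<omega> gX) (H4n_gen n \<omega> gC) p) = monomial L g x c p" for p
    using monomial_hom[OF hopf_homs_algebra[OF f(1)] k(1)] i f(2-)
    by (auto simp: is_H4n_def is_H4_def grouplike_def skew_primitive_def)
  then have "bij_betw f (carrier (H4n n \<omega>)) (carrier L)"
    using basis_to_basis_bij[OF k algebra_hom_linear[OF hopf_homs_algebra[OF f(1)]] b] basis by simp
  with f(1) hH hL show ?thesis by (auto simp: hopf_isomorphic_def)
qed

text \<open>
  A Hopf algebra in which the monomials in \<open>g\<close>, \<open>x\<close>, \<open>c\<close> form a basis, while the commutation of \<open>c\<close> with \<open>g\<close> and
  \<open>x\<close> is unknown. The Hopf algebras that factorize through \<open>H4\<close> and \<open>k[C\<^sub>n]\<close> are of this kind.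
\<close>

locale smash_basis =
  fixes n :: nat and E :: "('k::field, 'e) hopf" (structure) and g x c :: 'e and \<phi>
  assumes H4: "is_H4 E g x" and grouplike_c: "grouplike E c" and c_pow: "c [^] n = \<one>" and n: "0 < n"
    and basis: "dual_basis E (UNIV \<times> {..<n}) (monomial E g x c) \<phi>"
begin

lemma hopf: "hopf_algebra E"
  and rels: "sweedler_rels E g x"
  and grouplike_g: "grouplike E g" and skew_x: "skew_primitive E g x"
  using H4 by (auto simp: is_H4_def)

sublocale k_algebra E by (rule hopf_k_algebra[OF hopf])
sublocale EE: tensor E E by (intro tensorI k_algebra_axioms)

lemmas gx = sweedler_relsD[OF rels]
lemmas gx_assoc = sweedler_rels_assoc[OF rels]

lemma c_closed: "c \<in> carrier E" using grouplike_c by (simp add: grouplike_def)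

lemmas comult_hom = hopf_algebra.comult_algebra_hom[OF hopf]
lemmas counit_hom = hopf_algebra.counit_algebra_hom[OF hopf]
lemmas comult_mult = algebra_hom_mult[OF comult_hom]
lemmas \<phi> = dual_basisD[OF basis]

text \<open>
  The basis splits into the group-like elements \<open>u p\<close> and the elements \<open>v p\<close>, which involve \<open>x\<close>. The
  functionals \<open>\<alpha> p\<close> and \<open>\<beta> p\<close> are the corresponding coordinates.
\<close>

definition u :: "bool \<times> nat \<Rightarrow> 'e" where "u p = monomial E g x c ((fst p, False), snd p)"
definition v :: "bool \<times> nat \<Rightarrow> 'e" where "v p = monomial E g x c ((fst p, True), snd p)"
definition \<alpha> :: "bool \<times> nat \<Rightarrow> 'e \<Rightarrow> 'k" where "\<alpha> p = \<phi> ((fst p, False), snd p)"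
definition \<beta> :: "bool \<times> nat \<Rightarrow> 'e \<Rightarrow> 'k" where "\<beta> p = \<phi> ((fst p, True), snd p)"

abbreviation "P \<equiv> (UNIV :: bool set) \<times> {..<n}"
abbreviation flip :: "bool \<times> nat \<Rightarrow> bool \<times> nat" where "flip p \<equiv> (\<not> fst p, snd p)"

lemma uv_closed [simp]: "u p \<in> carrier E" "v p \<in> carrier E"
  using monomial_closed[OF gx(1,2) c_closed] by (simp_all add: u_def v_def)

lemma \<alpha>\<beta>_linear: "p \<in> P \<Longrightarrow> \<alpha> p \<in> linear_maps E scalars" "p \<in> P \<Longrightarrow> \<beta> p \<in> linear_maps E scalars"
  by (auto simp: \<alpha>_def \<beta>_def intro!: \<phi>(4))

lemma \<alpha>\<beta>_uv:
  assumes "p \<in> P" "q \<in> P"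
  shows "\<alpha> p (u q) = (if p = q then 1 else 0)" "\<beta> p (v q) = (if p = q then 1 else 0)"
    "\<alpha> p (v q) = 0" "\<beta> p (u q) = 0"
  using assms by (auto simp: u_def v_def \<alpha>_def \<beta>_def \<phi>(5) prod_eq_iff)

lemma eqI_coordinates:
  assumes "y \<in> carrier E" "z \<in> carrier E" "\<And>p. p \<in> P \<Longrightarrow> \<alpha> p y = \<alpha> p z" "\<And>p. p \<in> P \<Longrightarrow> \<beta> p y = \<beta> p z"
  shows "y = z"
proof (rule coordinates_eqI[OF k_algebra_axioms basis assms(1,2)])
  fix i :: "(bool \<times> bool) \<times> nat" assume i: "i \<in> UNIV \<times> {..<n}"
  obtain a b j where "i = ((a, b), j)" by (cases i, cases "fst i") auto
  then show "\<phi> i y = \<phi> i z"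
    using assms(3,4)[of "(a, j)"] i by (cases b) (auto simp: \<alpha>_def \<beta>_def)
qed

lemma functional_eqI:
  assumes "f \<in> linear_maps E scalars" "h \<in> linear_maps E scalars"
    "\<And>p. p \<in> P \<Longrightarrow> f (u p) = h (u p)" "\<And>p. p \<in> P \<Longrightarrow> f (v p) = h (v p)" "y \<in> carrier E"
  shows "f y = h y"
proof (rule linear_map_eqI_basis[OF k_algebra_axioms k_algebra_scalars basis assms(1,2) _ assms(5)])
  fix i :: "(bool \<times> bool) \<times> nat" assume i: "i \<in> UNIV \<times> {..<n}"
  obtain a b j where "i = ((a, b), j)" by (cases i, cases "fst i") auto
  then show "f (monomial E g x c i) = h (monomial E g x c i)"
    using assms(3,4)[of "(a, j)"] i by (cases b) (auto simp: u_def v_def)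
qed

lemma u_one: "u (False, 0) = \<one>" and u_g: "u (True, 0) = g" and v_x: "v (False, 0) = x"
  using gx by (simp_all add: u_def v_def monomial_def)

lemma grouplike_u: "grouplike E (u p)"
  using grouplike_pow[OF hopf grouplike_c] grouplike_one[OF hopf] grouplike_g
  by (auto simp: u_def monomial_def intro!: grouplike_mult[OF hopf])

lemma comult_v: "comult E (v p) = EE.pure (v p) (u p) \<oplus>\<^bsub>EE.T\<^esub> EE.pure (u (flip p)) (v p)"
proof -
  obtain a i where p: "p = (a, i)" by (cases p)
  let ?a = "if a then g else \<one>"
  have a: "?a \<in> carrier E" "comult E ?a = EE.pure ?a ?a"
    using grouplike_g grouplike_one[OF hopf] by (auto simp: grouplike_def)
  have ci: "c [^] i \<in> carrier E" "comult E (c [^] i) = EE.pure (c [^] i) (c [^] i)"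
    using grouplike_pow[OF hopf grouplike_c, of i] by (auto simp: grouplike_def)
  have x: "comult E x = EE.pure x \<one> \<oplus>\<^bsub>EE.T\<^esub> EE.pure g x" using skew_x by (simp add: skew_primitive_def)
  have "?a \<otimes> (g \<otimes> c [^] i) = u (flip p)"
    using gx ci gx_assoc by (simp add: u_def p monomial_def)
  with a ci x gx show ?thesis
    by (simp add: p v_def u_def monomial_def comult_mult EE.T.l_distr EE.T.r_distr EE.pure_mult)
qed

text \<open>
  The product of functionals that is dual to the comultiplication.
\<close>

definition conv :: "('e \<Rightarrow> 'k) \<Rightarrow> ('e \<Rightarrow> 'k) \<Rightarrow> 'e \<Rightarrow> 'k" where
  "conv f h y = tensor_lift scalars (\<lambda>a b. f a * h b) (comult E y)"

lemma
  assumes f: "f \<in> linear_maps E scalars" and h: "h \<in> linear_maps E scalars"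
  shows conv_linear: "conv f h \<in> linear_maps E scalars"
    and conv_grouplike: "grouplike E y \<Longrightarrow> conv f h y = f y * h y"
    and conv_skew_primitive: "w \<in> carrier E \<Longrightarrow> skew_primitive E w y \<Longrightarrow> conv f h y = f y * h \<one> + f w * h y"
    and conv_v: "conv f h (v p) = f (v p) * h (u p) + f (u (flip p)) * h (v p)"
proof -
  have "(\<lambda>a b. f a * h b) \<in> bilinear_maps E E scalars"
    using linear_map_add[OF f] linear_map_add[OF h] linear_map_scale[OF f] linear_map_scale[OF h]
    by (intro bilinear_mapsI linear_mapsI) (auto simp: algebra_simps)
  note l = EE.lift_linear[OF k_algebra_scalars this] EE.lift_pure[OF k_algebra_scalars this]
  show "conv f h \<in> linear_maps E scalars"
    unfolding conv_def[abs_def] by (rule linear_map_comp[OF algebra_hom_linear[OF comult_hom] l(1)])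
  show "grouplike E y \<Longrightarrow> conv f h y = f y * h y"
    by (simp add: conv_def grouplike_def l(2))
  show "w \<in> carrier E \<Longrightarrow> skew_primitive E w y \<Longrightarrow> conv f h y = f y * h \<one> + f w * h y"
    by (simp add: conv_def skew_primitive_def linear_map_add[OF l(1)] l(2))
  show "conv f h (v p) = f (v p) * h (u p) + f (u (flip p)) * h (v p)"
    by (simp add: conv_def comult_v linear_map_add[OF l(1)] l(2))
qed

lemma zero_linear: "(\<lambda>y. 0) \<in> linear_maps E scalars"
  by (intro linear_mapsI) auto

lemma flip_P: "p \<in> P \<Longrightarrow> flip p \<in> P" by auto

text \<open>
  It suffices to evaluate the products on the basis. They encode the comultiplication of \<open>E\<close> as
  equations for coordinates.
\<close>

lemma conv_coordinates:
  assumes p: "p \<in> P" and q: "q \<in> P" and y: "y \<in> carrier E"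
  shows "conv (\<alpha> p) (\<alpha> q) y = (if p = q then \<alpha> p y else 0)"
    and "conv (\<beta> p) (\<alpha> q) y = (if p = q then \<beta> p y else 0)"
    and "conv (\<alpha> p) (\<beta> q) y = (if p = flip q then \<beta> q y else 0)"
    and "conv (\<beta> p) (\<beta> q) y = 0"
proof -
  note l = \<alpha>\<beta>_linear[OF p] \<alpha>\<beta>_linear[OF q]
  have if_linear: "(\<lambda>y. if Q then f y else 0) \<in> linear_maps E scalars" if "f \<in> linear_maps E scalars" for Q f
    using that zero_linear by (cases Q) auto
  note c = conv_grouplike[OF _ _ grouplike_u] conv_v
  show "conv (\<alpha> p) (\<alpha> q) y = (if p = q then \<alpha> p y else 0)"
    by (rule functional_eqI[OF conv_linear[OF l(1,3)] if_linear[OF l(1)] _ _ y])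
      (simp_all add: c l \<alpha>\<beta>_uv[OF p] \<alpha>\<beta>_uv[OF q] flip_P)
  show "conv (\<beta> p) (\<alpha> q) y = (if p = q then \<beta> p y else 0)"
    by (rule functional_eqI[OF conv_linear[OF l(2,3)] if_linear[OF l(2)] _ _ y])
      (simp_all add: c l \<alpha>\<beta>_uv[OF p] \<alpha>\<beta>_uv[OF q] flip_P)
  show "conv (\<alpha> p) (\<beta> q) y = (if p = flip q then \<beta> q y else 0)"
    by (rule functional_eqI[OF conv_linear[OF l(1,4)] if_linear[OF l(4)] _ _ y])
      (auto simp add: c l \<alpha>\<beta>_uv[OF p flip_P] \<alpha>\<beta>_uv[OF p] \<alpha>\<beta>_uv[OF q] flip_P)
  show "conv (\<beta> p) (\<beta> q) y = 0"
    by (rule functional_eqI[OF conv_linear[OF l(2,4)] zero_linear _ _ y])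
      (simp_all add: c l \<alpha>\<beta>_uv[OF p] \<alpha>\<beta>_uv[OF p flip_P] \<alpha>\<beta>_uv[OF q] flip_P)
qed

lemma \<alpha>\<beta>_zero: "p \<in> P \<Longrightarrow> \<alpha> p \<zero> = 0" "p \<in> P \<Longrightarrow> \<beta> p \<zero> = 0"
  using linear_map_zero[OF \<alpha>\<beta>_linear(1) k_algebra_axioms k_algebra_scalars]
    linear_map_zero[OF \<alpha>\<beta>_linear(2) k_algebra_axioms k_algebra_scalars] by simp_all

text \<open>
  For group-like \<open>y\<close> the convolution products of functionals become products of their values. So the \<open>\<beta> p y\<close>
  have square zero, and the \<open>\<alpha> p y\<close> are orthogonal idempotents of the field: exactly one of them is \<open>1\<close>.
\<close>

lemma grouplike_cases:
  assumes y: "grouplike E y"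
  shows "\<exists>p\<in>P. y = u p"
proof -
  have yc: "y \<in> carrier E" "counit E y = 1" using y by (auto simp: grouplike_def)
  have A: "\<alpha> p y * \<alpha> q y = (if p = q then \<alpha> p y else 0)" if "p \<in> P" "q \<in> P" for p q
    using conv_coordinates(1)[OF that yc(1)] conv_grouplike[OF \<alpha>\<beta>_linear(1)[OF that(1)] \<alpha>\<beta>_linear(1)[OF that(2)] y] by simp
  have B: "\<beta> p y = 0" if "p \<in> P" for p
    using conv_coordinates(4)[OF that that yc(1)] conv_grouplike[OF \<alpha>\<beta>_linear(2)[OF that] \<alpha>\<beta>_linear(2)[OF that] y] by simp
  have "\<exists>q\<in>P. \<alpha> q y \<noteq> 0"
  proof (rule ccontr)
    assume "\<not> ?thesis"
    then have "y = \<zero>" using B yc by (intro eqI_coordinates) (auto simp: \<alpha>\<beta>_zero)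
    then show False using yc linear_map_zero[OF algebra_hom_linear[OF counit_hom] k_algebra_axioms k_algebra_scalars] by simp
  qed
  then obtain q where q: "q \<in> P" "\<alpha> q y \<noteq> 0" by blast
  have "\<alpha> q y = 1" using A[OF q(1) q(1)] q(2) by simp
  moreover have "\<alpha> p y = 0" if "p \<in> P" "p \<noteq> q" for p using A[OF that(1) q(1)] that q by simp
  ultimately have "y = u q"
    using B yc q by (intro eqI_coordinates) (auto simp: \<alpha>\<beta>_uv)
  with q show ?thesis by blast
qed

text \<open>
  Write \<open>w = u q\<close> and let \<open>o\<close> be the index of the unit. Evaluating the products of coordinates at \<open>y\<close> shows that \<open>\<beta> p y\<close> vanishes for \<open>p \<noteq> o\<close>,
  that \<open>\<beta> o y \<noteq> 0\<close> forces \<open>u q = g\<close>, that \<open>\<alpha> p y\<close> vanishes for \<open>p\<close> different from \<open>o\<close> and \<open>q\<close>, and that the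
  two remaining values are opposite (the single remaining value is zero if \<open>q = o\<close>).
\<close>

lemma skew_primitive_cases:
  assumes w: "grouplike E w" and y: "skew_primitive E w y"
  shows "\<exists>s t. y = s \<odot> (\<one> \<ominus> w) \<oplus> t \<odot> x \<and> (t \<noteq> 0 \<longrightarrow> w = g)"
proof -
  have yc: "y \<in> carrier E" using y by (simp add: skew_primitive_def)
  obtain q where q: "q \<in> P" and w_q: "w = u q" using grouplike_cases[OF w] by blast
  let ?o = "(False, 0) :: bool \<times> nat"
  have o: "?o \<in> P" "flip ?o \<in> P" using n by auto
  note lin = \<alpha>\<beta>_linear
  note sk = conv_skew_primitive[OF _ _ _ y, of "f" "h" for f h, unfolded w_q u_one[symmetric]]
  have wc: "u q \<in> carrier E" by simp
  have A: "(if p = r then \<alpha> p y else 0) = \<alpha> p y * (if r = ?o then 1 else 0) + (if p = q then 1 else 0) * \<alpha> r y"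
    if "p \<in> P" "r \<in> P" for p r
    using conv_coordinates(1)[OF that yc] sk[OF lin(1)[OF that(1)] lin(1)[OF that(2)] wc] \<alpha>\<beta>_uv(1)[OF that(1) q]
      \<alpha>\<beta>_uv(1)[OF that(2) o(1)] by simp
  have B: "\<beta> p y = 0" if "p \<in> P" "p \<noteq> ?o" for p
    using conv_coordinates(2)[OF that(1) that(1) yc] sk[OF lin(2)[OF that(1)] lin(1)[OF that(1)] wc] \<alpha>\<beta>_uv(4)[OF that(1) q]
      \<alpha>\<beta>_uv(1)[OF that(1) o(1)] that(2) by simp
  have C: "q = flip ?o" if "\<beta> ?o y \<noteq> 0"
    using conv_coordinates(3)[OF q o(1) yc] sk[OF lin(1)[OF q] lin(2)[OF o(1)] wc] \<alpha>\<beta>_uv(1)[OF q q]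
      \<alpha>\<beta>_uv(4)[OF o(1) o(1)] that by (auto split: if_splits)
  define s t where "s = \<alpha> ?o y" and "t = \<beta> ?o y"
  have lc: "\<alpha> p (s \<odot> (\<one> \<ominus> w) \<oplus> t \<odot> x) = s * (\<alpha> p (u ?o) - \<alpha> p (u q)) + t * \<alpha> p (v ?o)"
    "\<beta> p (s \<odot> (\<one> \<ominus> w) \<oplus> t \<odot> x) = s * (\<beta> p (u ?o) - \<beta> p (u q)) + t * \<beta> p (v ?o)" if "p \<in> P" for p
    using linear_map_add[OF lin(1)[OF that]] linear_map_scale[OF lin(1)[OF that]]
      linear_map_minus[OF lin(1)[OF that] k_algebra_axioms k_algebra_scalars]
      linear_map_add[OF lin(2)[OF that]] linear_map_scale[OF lin(2)[OF that]]
      linear_map_minus[OF lin(2)[OF that] k_algebra_axioms k_algebra_scalars]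
    using gx(2) by (simp_all add: w_q u_one minus_eq v_x)
  have "y = s \<odot> (\<one> \<ominus> w) \<oplus> t \<odot> x"
  proof (rule eqI_coordinates[OF yc])
    show "s \<odot> (\<one> \<ominus> w) \<oplus> t \<odot> x \<in> carrier E" using gx w_q by simp
    fix p assume p: "p \<in> P"
    show "\<beta> p y = \<beta> p (s \<odot> (\<one> \<ominus> w) \<oplus> t \<odot> x)"
      unfolding lc(2)[OF p] using B[OF p] \<alpha>\<beta>_uv(2)[OF p o(1)] \<alpha>\<beta>_uv(4)[OF p o(1)] \<alpha>\<beta>_uv(4)[OF p q]
      by (cases "p = ?o") (simp_all add: t_def)
    show "\<alpha> p y = \<alpha> p (s \<odot> (\<one> \<ominus> w) \<oplus> t \<odot> x)"
      unfolding lc(1)[OF p] \<alpha>\<beta>_uv(1)[OF p o(1)] \<alpha>\<beta>_uv(1)[OF p q] \<alpha>\<beta>_uv(3)[OF p o(1)]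
      using A[OF p p] A[OF p o(1)] A[OF o(1) o(1)] by (cases "p = ?o"; cases "p = q") (auto simp: s_def eq_neg_iff_add_eq_0)
  qed
  moreover have "w = g" if "t \<noteq> 0" using C that by (simp add: t_def w_q u_g)
  ultimately show ?thesis by blast
qed

text \<open>
  Both \<open>y g\<close> and \<open>g y\<close> have coordinate \<open>- s\<close> at the unit, because \<open>(1 - g) g = g (1 - g) = g - 1\<close>. Their sum is
  zero, so \<open>2 s = 0\<close>.
\<close>

lemma skew_primitive_anticommuting:
  assumes two: "(2::'k) \<noteq> 0" and y: "y = s \<odot> (\<one> \<ominus> g) \<oplus> t \<odot> x" and ac: "y \<otimes> g = \<ominus> (g \<otimes> y)"
  shows "y = t \<odot> x"
proof -
  let ?o = "(False, 0) :: bool \<times> nat"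
  have o: "?o \<in> P" "flip ?o \<in> P" using n by auto
  have yg: "y \<otimes> g = s \<odot> (g \<ominus> \<one>) \<oplus> t \<odot> (x \<otimes> g)" and gy: "g \<otimes> y = s \<odot> (g \<ominus> \<one>) \<oplus> t \<odot> (g \<otimes> x)"
    unfolding y using gx by (simp_all add: minus_eq l_distr r_distr l_minus r_minus)
  note l = \<alpha>\<beta>_linear(1)[OF o(1)]
  note la = linear_map_add[OF l] linear_map_scale[OF l] linear_map_minus[OF l k_algebra_axioms k_algebra_scalars]
  have gxv: "g \<otimes> x = v (True, 0)" using gx by (simp add: v_def monomial_def)
  have "\<alpha> ?o (y \<otimes> g) = - s"
    unfolding yg using gx o \<alpha>\<beta>_uv(1)[OF o(1) o(1)] \<alpha>\<beta>_uv(1)[OF o(1) o(2)] \<alpha>\<beta>_uv(3)[OF o(1) o(2)]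
    by (simp add: la minus_eq u_one u_g gxv)
  moreover have "\<alpha> ?o (g \<otimes> y) = - s"
    unfolding gy using gx o \<alpha>\<beta>_uv(1)[OF o(1) o(1)] \<alpha>\<beta>_uv(1)[OF o(1) o(2)] \<alpha>\<beta>_uv(3)[OF o(1) o(2)]
    by (simp add: la minus_eq u_one u_g gxv)
  moreover have "g \<otimes> y \<in> carrier E" unfolding y using gx by simp
  ultimately have "- s = - (- s)" using ac la(3) by simp
  then have "2 * s = 0" by (simp add: eq_neg_iff_add_eq_0)
  with two have "s = 0" by simp
  then show ?thesis unfolding y using gx by simp
qed

lemma x_not_grouplike_combination:
  assumes p: "p \<in> P" shows "x \<noteq> s \<odot> (\<one> \<ominus> u p)"
proof
  let ?o = "(False, 0) :: bool \<times> nat"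
  have o: "?o \<in> P" using n by auto
  note l = \<alpha>\<beta>_linear(2)[OF o]
  assume "x = s \<odot> (\<one> \<ominus> u p)"
  then have "\<beta> ?o x = \<beta> ?o (s \<odot> (\<one> \<ominus> u p))" by (rule arg_cong)
  also have "\<dots> = s * (\<beta> ?o \<one> - \<beta> ?o (u p))"
    using linear_map_add[OF l] linear_map_scale[OF l] linear_map_minus[OF l k_algebra_axioms k_algebra_scalars]
    by (simp add: minus_eq)
  finally have "\<beta> ?o (v ?o) = s * (\<beta> ?o (u ?o) - \<beta> ?o (u p))" by (simp only: v_x u_one)
  then show False using \<alpha>\<beta>_uv(2)[OF o o] \<alpha>\<beta>_uv(4)[OF o o] \<alpha>\<beta>_uv(4)[OF o p] by simp
qed

text \<open>
  Conjugation by \<open>c\<close> turns \<open>x\<close> into a skew-primitive element for \<open>c g c^(-1)\<close>. It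
  cannot lie in the span of group-like elements, since \<open>x\<close> does not, and this leaves only the
  possibility that \<open>g\<close> is fixed and \<open>x\<close> is multiplied by a scalar.
\<close>

theorem smash_relations:
  assumes two: "(2::'k) \<noteq> 0"
  shows "\<exists>\<omega>. \<omega> ^ n = 1 \<and> smash_rels E n \<omega> g x c"
proof -
  note cc = c_closed
  define c' where "c' = c [^] (n - 1)"
  have c': "grouplike E c'" "c' \<in> carrier E"
    using grouplike_pow[OF hopf grouplike_c] by (auto simp: c'_def grouplike_def)
  obtain m where m: "n = Suc m" using n by (cases n) auto
  have inv: "c \<otimes> c' = \<one>" "c' \<otimes> c = \<one>"
    using c_pow nat_pow_Suc2[OF cc, of m] by (simp_all add: c'_def m)
  have inv': "c \<otimes> (c' \<otimes> z) = z" "c' \<otimes> (c \<otimes> z) = z" if "z \<in> carrier E" for z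
    using that inv cc c' by (simp_all flip: m_assoc)
  let ?w = "c \<otimes> (g \<otimes> c')" and ?y = "c \<otimes> (x \<otimes> c')"
  have w: "grouplike E ?w" by (intro grouplike_mult[OF hopf] grouplike_c grouplike_g c')
  have yc: "?y \<in> carrier E" and wc: "?w \<in> carrier E" using cc c' gx by simp_all
  have "comult E ?y = EE.pure ?y \<one> \<oplus>\<^bsub>EE.T\<^esub> EE.pure ?w ?y"
    using grouplike_c c' skew_x gx cc inv
    by (simp add: comult_mult grouplike_def skew_primitive_def EE.T.l_distr EE.T.r_distr EE.pure_mult)
  moreover have "counit E ?y = 0"
    using algebra_hom_mult[OF counit_hom] skew_x cc c' gx by (simp add: skew_primitive_def)
  ultimately have y: "skew_primitive E ?w ?y" using yc by (simp add: skew_primitive_def)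
  obtain s t where st: "?y = s \<odot> (\<one> \<ominus> ?w) \<oplus> t \<odot> x" and t: "t \<noteq> 0 \<longrightarrow> ?w = g"
    using skew_primitive_cases[OF w y] by blast
  have "t \<noteq> 0"
  proof
    assume "t = 0"
    then have "?y = s \<odot> (\<one> \<ominus> ?w)" using st gx wc by simp
    then have e1: "c' \<otimes> (?y \<otimes> c) = c' \<otimes> (s \<odot> (\<one> \<ominus> ?w) \<otimes> c)" by simp
    have e2: "c' \<otimes> (?y \<otimes> c) = x" using cc c' gx inv by (simp add: m_assoc inv')
    have e3: "c' \<otimes> (s \<odot> (\<one> \<ominus> ?w) \<otimes> c) = s \<odot> (\<one> \<ominus> g)"
      using cc c' gx inv by (simp add: m_assoc inv' minus_eq l_distr r_distr l_minus r_minus)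
    have "x = s \<odot> (\<one> \<ominus> g)" by (rule trans[OF e2[symmetric] trans[OF e1 e3]])
    then show False using x_not_grouplike_combination[of "(True, 0)" s, unfolded u_g] n by blast
  qed
  with t have wg: "?w = g" by simp
  then have "?w \<otimes> c = g \<otimes> c" by simp
  then have cg: "c \<otimes> g = g \<otimes> c" using cc c' gx inv by (simp add: m_assoc)
  then have c'g: "c' \<otimes> g = g \<otimes> c'" unfolding c'_def using cc gx by (intro pow_commute)
  have cg': "c \<otimes> (g \<otimes> z) = g \<otimes> (c \<otimes> z)" if "z \<in> carrier E" for z
    using that cg cc gx by (simp flip: m_assoc)
  have "?y \<otimes> g = \<ominus> (g \<otimes> ?y)"
    using cc c' gx by (simp add: m_assoc c'g gx_assoc r_minus cg')
  then have y_eq: "?y = t \<odot> x" using skew_primitive_anticommuting[OF two st[unfolded wg]] by simp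
  then have "?y \<otimes> c = t \<odot> (x \<otimes> c)" using gx cc by simp
  then have cx: "c \<otimes> x = t \<odot> (x \<otimes> c)" using cc c' gx inv by (simp add: m_assoc)
  have "c [^] n \<otimes> x = t ^ n \<odot> (x \<otimes> c [^] n)" using cc gx cx by (intro pow_skew_commute)
  then have "x = t ^ n \<odot> x" using c_pow gx by simp
  moreover have o: "(False, 0) \<in> P" using n by auto
  ultimately have "\<beta> (False, 0) x = t ^ n * \<beta> (False, 0) x"
    using linear_map_scale[OF \<alpha>\<beta>_linear(2)[OF o] gx(2), of "t ^ n"] by simp
  then have "t ^ n = 1" using \<alpha>\<beta>_uv(2)[OF o o] by (simp add: v_x)
  with cg cx rels cc c_pow show ?thesis by (auto simp: smash_rels_def)
qed

end

section \<open>Factorizations\<close>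

lemma same_dual_basis:
  assumes s: "same_algebra A B" and b: "dual_basis A I b \<phi>"
  shows "dual_basis B I b \<phi>"
proof -
  have "linspan B S x" if "linspan A S x" for S x
    using that by induct (simp_all only: same_algebraD[OF s] linspan.intros)
  with b show ?thesis
    by (auto simp: dual_basis_def linear_maps_same_left[OF s] same_algebraD[OF s])
qed

lemma mult_bilinear:
  assumes E: "k_algebra E" and i: "i \<in> linear_maps A E" and j: "j \<in> linear_maps B E"
  shows "(\<lambda>a h. i a \<otimes>\<^bsub>E\<^esub> j h) \<in> bilinear_maps A B E"
proof -
  interpret E: k_algebra E by fact
  show ?thesis
    using linear_map_closed[OF i] linear_map_closed[OF j]
    by (intro bilinear_mapsI linear_mapsI)
      (simp_all add: linear_map_add[OF i] linear_map_add[OF j] linear_map_scale[OF i] linear_map_scale[OF j]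
        E.l_distr E.r_distr)
qed

lemma
  fixes K :: "('k::field, int \<Rightarrow>\<^sub>0 'k) hopf"
  assumes n: "0 < n" defines "K \<equiv> cyclic_hopf n"
  defines "e \<equiv> \<lambda>m::nat. Poly_Mapping.single (int m mod int n) (1::'k)"
  shows hopf_algebra_cyclic: "hopf_algebra K"
    and grouplike_cyclic: "grouplike K (e m)"
    and cyclic_zero: "e 0 = \<one>\<^bsub>K\<^esub>"
    and cyclic_pow: "e 1 [^]\<^bsub>K\<^esub> m = e m"
    and generated_cyclic: "p \<in> carrier K \<Longrightarrow> generated K (range e) p"
    and dual_basis_cyclic: "\<exists>\<phi>. dual_basis K {..<n} e \<phi>"
proof -
  let ?G = "integer_mod_group n"
  interpret G: group ?G by simp
  note sd = same_algebraD[OF group_hopf_simps(1)[of ?G]]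
  have c: "carrier ?G = {0..<int n}" using n by (simp add: carrier_integer_mod_group)
  have ec: "int m mod int n \<in> carrier ?G" for m using n by (simp add: c)
  have im: "(\<lambda>g. Poly_Mapping.single g (1::'k)) ` carrier ?G \<subseteq> range e"
  proof
    fix p assume "p \<in> (\<lambda>g. Poly_Mapping.single g (1::'k)) ` carrier ?G"
    then obtain g where "0 \<le> g" "g < int n" "p = Poly_Mapping.single g 1" by (auto simp: c)
    then have "p = e (nat g)" by (simp add: e_def)
    then show "p \<in> range e" by simp
  qed
  show "hopf_algebra K" unfolding K_def by (rule hopf_algebra_group_hopf) simp
  show "grouplike K (e m)" unfolding K_def e_def by (rule grouplike_group_hopf[OF _ ec]) simp
  show z: "e 0 = \<one>\<^bsub>K\<^esub>" by (simp add: K_def e_def sd)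
  show "e 1 [^]\<^bsub>K\<^esub> m = e m"
  proof (induct m)
    case (Suc m)
    have "e m \<otimes>\<^bsub>K\<^esub> e 1 = e (Suc m)"
      by (simp add: K_def e_def sd mod_add_eq add.commute)
    with Suc show ?case by (simp add: pow_Suc)
  qed (simp add: z pow_0)
  show "p \<in> carrier K \<Longrightarrow> generated K (range e) p"
    unfolding K_def using generated_mono[OF generated_group_hopf im] by simp
  have "dual_basis K (carrier ?G) (\<lambda>g. Poly_Mapping.single g 1) (\<lambda>g p. Poly_Mapping.lookup p g)"
    unfolding K_def
    by (rule same_dual_basis[OF same_algebra_sym[OF group_hopf_simps(1)] dual_basis_monoid_algebra])
      (simp_all add: c G.monoid_axioms)
  then have "dual_basis K {..<n} (\<lambda>i. Poly_Mapping.single (int i) 1) (\<lambda>i p. Poly_Mapping.lookup p (int i))"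
    by (rule dual_basis_reindex)
      (auto simp: c bij_betw_def inj_on_def image_iff intro!: bexI[of _ "nat _"])
  then have "dual_basis K {..<n} e (\<lambda>i p. Poly_Mapping.lookup p (int i))"
    by (rule dual_basis_cong) (simp add: e_def)
  then show "\<exists>\<phi>. dual_basis K {..<n} e \<phi>" by blast
qed

lemma sweedler_rels_hom:
  assumes f: "f \<in> algebra_homs H L" and H: "k_algebra H" and L: "k_algebra L" and r: "sweedler_rels H g x"
  shows "sweedler_rels L (f g) (f x)"
proof -
  interpret H: k_algebra H by fact
  note d = H.sweedler_relsD[OF r]
  have "f (x \<otimes>\<^bsub>H\<^esub> g \<oplus>\<^bsub>H\<^esub> g \<otimes>\<^bsub>H\<^esub> x) = f \<zero>\<^bsub>H\<^esub>" using r by (simp add: sweedler_rels_def)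
  then have "f x \<otimes>\<^bsub>L\<^esub> f g \<oplus>\<^bsub>L\<^esub> f g \<otimes>\<^bsub>L\<^esub> f x = \<zero>\<^bsub>L\<^esub>"
    using d(1,2) linear_map_zero[OF algebra_hom_linear[OF f] H L]
    by (simp only: algebra_hom_add[OF f] algebra_hom_mult[OF f] H.m_closed)
  moreover have "f g \<otimes>\<^bsub>L\<^esub> f g = \<one>\<^bsub>L\<^esub>" "f x \<otimes>\<^bsub>L\<^esub> f x = \<zero>\<^bsub>L\<^esub>"
    using d algebra_hom_one[OF f] linear_map_zero[OF algebra_hom_linear[OF f] H L] by (simp_all flip: algebra_hom_mult[OF f])
  ultimately show ?thesis using d algebra_hom_closed[OF f] by (simp add: sweedler_rels_def)
qed

lemma is_H4_hom:
  assumes f: "f \<in> hopf_homs H L" and H: "is_H4 H g x" and L: "hopf_algebra L"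
  shows "is_H4 L (f g) (f x)"
proof -
  have h: "hopf_algebra H" "sweedler_rels H g x" "grouplike H g" "skew_primitive H g x"
    using H by (auto simp: is_H4_def)
  then have "g \<in> carrier H" by (simp add: grouplike_def)
  then show ?thesis
    using sweedler_rels_hom[OF hopf_homs_algebra[OF f] hopf_k_algebra[OF h(1)] hopf_k_algebra[OF L] h(2)]
      hopf_hom_grouplike[OF f h(1) L h(3)] hopf_hom_skew_primitive[OF f h(1) L h(4)] L
    by (simp add: is_H4_def)
qed

text \<open>
  The index has the shape of that of a monomial \<open>g^a x^b c^m\<close>, to which the multiplication map sends this
  tensor.
\<close>

definition factor_basis ::
    "nat \<Rightarrow> (bool \<times> bool) \<times> nat \<Rightarrow> ('k::field, (gen list \<Rightarrow>\<^sub>0 'k) set, int \<Rightarrow>\<^sub>0 'k) tensor" where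
  "factor_basis n = (\<lambda>((a, b), m). pure_tensor H4 (cyclic_hopf n)
    ((if a then H4_gen gG else \<one>\<^bsub>H4\<^esub>) \<otimes>\<^bsub>H4\<^esub> (if b then H4_gen gX else \<one>\<^bsub>H4\<^esub>))
    (Poly_Mapping.single (int m mod int n) 1))"

lemma
  fixes E :: "('k::field, 'e) hopf"
  assumes n: "0 < n" and E: "k_algebra E"
    and i: "i \<in> algebra_homs (H4 :: ('k, _) hopf) E" and j: "j \<in> algebra_homs (cyclic_hopf n) E"
    and c: "c = j (Poly_Mapping.single (1 mod int n) 1)"
  shows factorization_basis: "\<exists>\<phi>. dual_basis (tensor_algebra (H4 :: ('k, _) hopf) (cyclic_hopf n)) (UNIV \<times> {..<n})
      (factor_basis n) \<phi>"
    and factorization_linear: "tensor_lift E (\<lambda>a h. i a \<otimes>\<^bsub>E\<^esub> j h) \<in>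
      linear_maps (tensor_algebra (H4 :: ('k, _) hopf) (cyclic_hopf n)) E"
    and factorization_pure: "a \<in> carrier H4 \<Longrightarrow> h \<in> carrier (cyclic_hopf n) \<Longrightarrow>
      tensor_lift E (\<lambda>a h. i a \<otimes>\<^bsub>E\<^esub> j h) (pure_tensor H4 (cyclic_hopf n) a h) = i a \<otimes>\<^bsub>E\<^esub> j h"
    and factorization_monomial: "tensor_lift E (\<lambda>a h. i a \<otimes>\<^bsub>E\<^esub> j h) (factor_basis n p) =
      monomial E (i (H4_gen gG)) (i (H4_gen gX)) c p"
proof -
  let ?A = "H4 :: ('k, _) hopf" and ?K = "cyclic_hopf n :: ('k, _) hopf"
  have h4: "is_H4 ?A (H4_gen gG) (H4_gen gX)" by (rule is_H4_H4)
  have A: "k_algebra ?A" using h4 by (simp add: is_H4_def hopf_k_algebra)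
  have K: "k_algebra ?K" by (rule hopf_k_algebra[OF hopf_algebra_cyclic[OF n]])
  interpret A: k_algebra ?A by fact
  interpret K: k_algebra ?K by fact
  interpret E: k_algebra E by fact
  interpret T: tensor ?A ?K by (intro tensorI A K)
  have gx: "H4_gen gG \<in> carrier ?A" "H4_gen gX \<in> carrier ?A"
    using h4 by (auto simp: is_H4_def grouplike_def skew_primitive_def)
  show "\<exists>\<phi>. dual_basis T.T (UNIV \<times> {..<n}) (factor_basis n) \<phi>"
  proof -
    obtain \<phi> \<psi> where "dual_basis ?A UNIV
        (\<lambda>(a, b). (if a then H4_gen gG else \<one>\<^bsub>H4\<^esub>) \<otimes>\<^bsub>H4\<^esub> (if b then H4_gen gX else \<one>\<^bsub>H4\<^esub>)) \<phi>"
      "dual_basis ?K {..<n} (\<lambda>m. Poly_Mapping.single (int m mod int n) 1) \<psi>"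
      using dual_basis_H4 dual_basis_cyclic[OF n] by blast
    from dual_basis_tensor[OF A K this] show ?thesis
      by (intro exI) (erule dual_basis_cong, auto simp: factor_basis_def)
  qed
  note bil = mult_bilinear[OF E algebra_hom_linear[OF i] algebra_hom_linear[OF j]]
  show "tensor_lift E (\<lambda>a h. i a \<otimes>\<^bsub>E\<^esub> j h) \<in> linear_maps T.T E" by (rule T.lift_linear[OF E bil])
  note pure = T.lift_pure[OF E bil]
  then show "a \<in> carrier H4 \<Longrightarrow> h \<in> carrier (cyclic_hopf n) \<Longrightarrow>
      tensor_lift E (\<lambda>a h. i a \<otimes>\<^bsub>E\<^esub> j h) (pure_tensor H4 (cyclic_hopf n) a h) = i a \<otimes>\<^bsub>E\<^esub> j h" .
  obtain a b m where p: "p = ((a, b), m)" by (cases p, cases "fst p") auto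
  have ec: "Poly_Mapping.single (int m mod int n) (1::'k) \<in> carrier ?K" for m
    using grouplike_cyclic[OF n, of m, where 'k = 'k] by (simp add: grouplike_def)
  have e1: "Poly_Mapping.single (1 mod int n) (1::'k) \<in> carrier ?K" using ec[of 1] by simp
  have "j (Poly_Mapping.single (int m mod int n) 1) = c [^]\<^bsub>E\<^esub> m"
    using cyclic_pow[OF n, of m, where 'k = 'k] algebra_hom_pow[OF j K e1, of m] by (simp add: c)
  moreover have "c \<in> carrier E" unfolding c by (rule algebra_hom_closed[OF j e1])
  ultimately show "tensor_lift E (\<lambda>a h. i a \<otimes>\<^bsub>E\<^esub> j h) (factor_basis n p) =
      monomial E (i (H4_gen gG)) (i (H4_gen gX)) c p"
    using gx ec[of m] algebra_hom_closed[OF i]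
    by (simp add: p factor_basis_def monomial_def pure algebra_hom_mult[OF i] algebra_hom_one[OF i] E.m_assoc)
qed

text \<open>
  The basis of the tensor product is transported along the multiplication map, which is bijective.
\<close>

theorem factorization_smash_basis:
  fixes E :: "('k::field, 'e) hopf"
  assumes n: "0 < n" and E: "factorizes_through E (H4 :: ('k, _) hopf) (cyclic_hopf n)"
  shows "\<exists>g x c \<phi>. smash_basis n E g x c \<phi>"
proof -
  let ?A = "H4 :: ('k, _) hopf" and ?K = "cyclic_hopf n :: ('k, _) hopf"
  let ?e = "Poly_Mapping.single (1 mod int n) (1::'k)"
  have hE: "hopf_algebra E" using E by (simp add: factorizes_through_def)
  note kE = hopf_k_algebra[OF hE] and hK = hopf_algebra_cyclic[OF n, where 'k = 'k]
  obtain i j where i: "i \<in> hopf_homs ?A E" and j: "j \<in> hopf_homs ?K E"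
    and bij: "bij_betw (tensor_lift E (\<lambda>a h. i a \<otimes>\<^bsub>E\<^esub> j h)) (carrier (tensor_algebra ?A ?K)) (carrier E)"
    using E unfolding factorizes_through_def by blast
  note ij = hopf_homs_algebra[OF i] hopf_homs_algebra[OF j]
  have A: "k_algebra ?A" using is_H4_H4[where 'k = 'k] by (simp add: is_H4_def hopf_k_algebra)
  interpret T: tensor ?A ?K by (intro tensorI A hopf_k_algebra hK)
  note f = factorization_basis[OF n kE ij refl] factorization_linear[OF n kE ij refl]
    factorization_monomial[OF n kE ij refl]
  obtain \<phi> where "dual_basis E (UNIV \<times> {..<n}) (monomial E (i (H4_gen gG)) (i (H4_gen gX)) (j ?e)) \<phi>"
    using f(1) dual_basis_transport[OF T.k_algebra_tensor kE f(2) bij] dual_basis_cong f(3) by blast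
  moreover have e: "grouplike ?K ?e" using grouplike_cyclic[OF n, of 1, where 'k = 'k] by simp
  then have "j ?e [^]\<^bsub>E\<^esub> n = \<one>\<^bsub>E\<^esub>"
    using cyclic_pow[OF n, of n, where 'k = 'k] cyclic_zero[OF n, where 'k = 'k] algebra_hom_one[OF ij(2)]
      algebra_hom_pow[OF ij(2) hopf_k_algebra[OF hK], of ?e n] by (simp add: grouplike_def)
  ultimately have "smash_basis n E (i (H4_gen gG)) (i (H4_gen gX)) (j ?e) \<phi>"
    using is_H4_hom[OF i is_H4_H4 hE] hopf_hom_grouplike[OF j hK hE e] n
    by (intro smash_basis.intro)
  then show ?thesis by blast
qed

corollary factorization_isomorphic:
  fixes E :: "('k::field, 'e) hopf"
  assumes n: "0 < n" and two: "(2::'k) \<noteq> 0"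
    and E: "factorizes_through E (H4 :: ('k, _) hopf) (cyclic_hopf n)"
  shows "\<exists>\<omega>. \<omega> ^ n = 1 \<and> hopf_isomorphic (H4n n \<omega>) E"
proof -
  obtain g x c \<phi> where s: "smash_basis n E g x c \<phi>" using factorization_smash_basis[OF n E] by blast
  then interpret smash_basis n E g x c \<phi> .
  obtain \<omega> where "\<omega> ^ n = 1" "smash_rels E n \<omega> g x c" using smash_relations[OF two] by blast
  moreover from this have "is_H4n n \<omega> E g x c" using H4 grouplike_c by (simp add: is_H4n_def)
  ultimately show ?thesis using H4n_hopf_isomorphicI[OF n _ _ basis] by blast
qed

lemma pow_mod:
  assumes "k_algebra E" "c \<in> carrier E" "c [^]\<^bsub>E\<^esub> n = \<one>\<^bsub>E\<^esub>"
  shows "c [^]\<^bsub>E\<^esub> (m mod n) = c [^]\<^bsub>E\<^esub> (m::nat)"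
proof -
  interpret E: k_algebra E by fact
  have "c [^]\<^bsub>E\<^esub> m = c [^]\<^bsub>E\<^esub> (m mod n + n * (m div n))" by simp
  also have "\<dots> = c [^]\<^bsub>E\<^esub> (m mod n) \<otimes>\<^bsub>E\<^esub> (c [^]\<^bsub>E\<^esub> n) [^]\<^bsub>E\<^esub> (m div n)"
    using assms(2) by (simp only: E.nat_pow_mult E.nat_pow_pow)
  finally show ?thesis using assms(2,3) by simp
qed

lemma smash_basis_H4n:
  fixes \<omega> :: "'k::field"
  assumes n: "0 < n" "\<omega> ^ n = 1"
  shows "\<exists>\<phi>. smash_basis n (H4n n \<omega>) (H4n_gen n \<omega> gG) (H4n_gen n \<omega> gX) (H4n_gen n \<omega> gC) \<phi>"
  using dual_basis_H4n[OF n] is_H4n_H4n[OF n] n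
  by (auto simp: smash_basis_def is_H4n_def smash_rels_def)

text \<open>
  The multiplication map sends a basis of the tensor product to the monomials, so it is bijective. Injectivity of
  the two inclusions then comes for free: \<open>a\<close> can be recovered from \<open>a \<otimes> 1\<close> with the counit of the other
  factor.
\<close>

theorem factorizes_through_H4n:
  fixes \<omega> :: "'k::field"
  assumes n: "0 < n" "\<omega> ^ n = 1"
  shows "factorizes_through (H4n n \<omega>) (H4 :: ('k, _) hopf) (cyclic_hopf n)"
proof -
  let ?E = "H4n n \<omega>" and ?A = "H4 :: ('k, _) hopf" and ?K = "cyclic_hopf n :: ('k, _) hopf"
  let ?g = "H4n_gen n \<omega> gG" and ?x = "H4n_gen n \<omega> gX" and ?c = "H4n_gen n \<omega> gC"
  let ?G = "integer_mod_group n"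
  have e: "is_H4n n \<omega> ?E ?g ?x ?c" by (rule is_H4n_H4n[OF n])
  have h4: "is_H4 ?A (H4_gen gG) (H4_gen gX)" by (rule is_H4_H4)
  have hE: "hopf_algebra ?E" and hA: "hopf_algebra ?A" and hK: "hopf_algebra ?K"
    using e h4 hopf_algebra_cyclic[OF n(1)] by (auto simp: is_H4n_def is_H4_def)
  note k = hopf_k_algebra[OF hE] hopf_k_algebra[OF hA] hopf_k_algebra[OF hK]
  interpret E: k_algebra ?E by (rule k)
  interpret A: k_algebra ?A by (rule k)
  interpret K: k_algebra ?K by (rule k)
  interpret T: tensor ?A ?K by (intro tensorI k)
  have c: "?c \<in> carrier ?E" "?c [^]\<^bsub>?E\<^esub> n = \<one>\<^bsub>?E\<^esub>" using e by (auto simp: is_H4n_def smash_rels_def)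
  obtain i where i: "i \<in> algebra_homs ?A ?E" "i (H4_gen gG) = ?g" "i (H4_gen gX) = ?x"
    using H4_universal[OF k(1)] e by (metis is_H4n_def is_H4_def)
  have gx: "H4_gen gG \<in> carrier ?A" "H4_gen gX \<in> carrier ?A"
    using h4 by (auto simp: is_H4_def grouplike_def skew_primitive_def)
  have ih: "i \<in> hopf_homs ?A ?E"
    by (rule hopf_homI_generators[OF hA hE _ generated_H4 i(1)])
      (use h4 e i(2,3) gx in \<open>auto simp: is_H4n_def is_H4_def\<close>)
  define j where "j = lin_ext ?E (\<lambda>m. ?c [^]\<^bsub>?E\<^esub> nat m)"
  have "j \<in> algebra_homs (monoid_algebra ?G) ?E"
    unfolding j_def
  proof (rule lin_ext_algebra_hom[OF k(1)])
    fix a b assume "a \<in> carrier ?G" "b \<in> carrier ?G"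
    then have "0 \<le> a" "0 \<le> b" using n by (auto simp: carrier_integer_mod_group)
    then have "nat ((a + b) mod int n) = (nat a + nat b) mod n"
      by (simp add: nat_mod_distrib nat_add_distrib)
    then show "?c [^]\<^bsub>?E\<^esub> nat (a \<otimes>\<^bsub>?G\<^esub> b) = ?c [^]\<^bsub>?E\<^esub> nat a \<otimes>\<^bsub>?E\<^esub> ?c [^]\<^bsub>?E\<^esub> nat b"
      using pow_mod[OF k(1) c] c(1) by (simp add: E.nat_pow_mult)
  qed (use c group.is_monoid[OF group_integer_mod_group] in auto)
  then have ja: "j \<in> algebra_homs ?K ?E" by (simp add: algebra_homs_same_left[OF group_hopf_simps(1)])
  have je: "j (Poly_Mapping.single (int m mod int n) 1) = ?c [^]\<^bsub>?E\<^esub> m" for m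
    unfolding j_def using c(1) pow_mod[OF k(1) c, of m]
    by (subst lin_ext_single[OF k(1)]) (simp_all add: nat_mod_distrib)
  have jh: "j \<in> hopf_homs ?K ?E"
  proof (rule hopf_homI_generators[OF hK hE _ generated_cyclic[OF n(1)] ja])
    show "range (\<lambda>m. Poly_Mapping.single (int m mod int n) 1) \<subseteq> carrier ?K"
      using grouplike_cyclic[OF n(1), where 'k = 'k] by (auto simp: grouplike_def)
    fix y :: "int \<Rightarrow>\<^sub>0 'k" assume "y \<in> range (\<lambda>m. Poly_Mapping.single (int m mod int n) 1)"
    then show "grouplike ?K y \<and> grouplike ?E (j y) \<or>
        (\<exists>g\<in>carrier ?K. skew_primitive ?K g y \<and> skew_primitive ?E (j g) (j y))"
      using grouplike_cyclic[OF n(1), where 'k = 'k] grouplike_pow[OF hE, of ?c] e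
      by (auto simp: je is_H4n_def)
  qed
  have j1: "?c = j (Poly_Mapping.single (1 mod int n) 1)" using je[of 1] c(1) by simp
  note f = factorization_basis[OF n(1) k(1) i(1) ja j1] factorization_linear[OF n(1) k(1) i(1) ja j1]
    factorization_pure[OF n(1) k(1) i(1) ja j1] factorization_monomial[OF n(1) k(1) i(1) ja j1]
  let ?m = "tensor_lift ?E (\<lambda>a h. i a \<otimes>\<^bsub>?E\<^esub> j h)"
  have bij: "bij_betw ?m (carrier T.T) (carrier ?E)"
  proof -
    obtain \<phi> \<psi> where b: "dual_basis T.T (UNIV \<times> {..<n}) (factor_basis n) \<phi>"
      and b': "dual_basis ?E (UNIV \<times> {..<n}) (monomial ?E ?g ?x ?c) \<psi>"
      using f(1) dual_basis_H4n[OF n] by blast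
    show ?thesis
      by (rule basis_to_basis_bij[OF T.k_algebra_tensor k(1) f(2) b dual_basis_cong[OF b']])
        (simp only: f(4) i)
  qed
  then have inj: "inj_on ?m (carrier T.T)" by (simp add: bij_betw_def)
  have "inj_on i (carrier ?A)"
  proof (rule inj_onI)
    fix a b assume ab: "a \<in> carrier ?A" "b \<in> carrier ?A" "i a = i b"
    then have "T.pure a \<one>\<^bsub>?K\<^esub> = T.pure b \<one>\<^bsub>?K\<^esub>" using f(3) by (intro inj_onD[OF inj]) auto
    moreover have "(\<lambda>a h. counit ?K h \<odot>\<^bsub>?A\<^esub> a) \<in> bilinear_maps ?A ?K ?A"
      using algebra_hom_add[OF hopf_algebra.counit_algebra_hom[OF hK]]
        algebra_hom_scale[OF hopf_algebra.counit_algebra_hom[OF hK]]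
      by (intro bilinear_mapsI linear_mapsI)
        (simp_all add: A.scale_add_left A.scale_add_right mult.commute)
    note T.lift_pure[OF k(2) this]
    ultimately have "counit ?K \<one>\<^bsub>?K\<^esub> \<odot>\<^bsub>?A\<^esub> a = counit ?K \<one>\<^bsub>?K\<^esub> \<odot>\<^bsub>?A\<^esub> b"
      using ab by (metis K.one_closed)
    then show "a = b" using ab algebra_hom_one[OF hopf_algebra.counit_algebra_hom[OF hK]] by simp
  qed
  moreover have "inj_on j (carrier ?K)"
  proof (rule inj_onI)
    fix a b assume ab: "a \<in> carrier ?K" "b \<in> carrier ?K" "j a = j b"
    then have "T.pure \<one>\<^bsub>?A\<^esub> a = T.pure \<one>\<^bsub>?A\<^esub> b" using f(3) by (intro inj_onD[OF inj]) auto
    moreover have "(\<lambda>h a. counit ?A h \<odot>\<^bsub>?K\<^esub> a) \<in> bilinear_maps ?A ?K ?K"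
      using algebra_hom_add[OF hopf_algebra.counit_algebra_hom[OF hA]]
        algebra_hom_scale[OF hopf_algebra.counit_algebra_hom[OF hA]]
      by (intro bilinear_mapsI linear_mapsI)
        (simp_all add: K.scale_add_left K.scale_add_right mult.commute)
    note T.lift_pure[OF k(3) this]
    ultimately have "counit ?A \<one>\<^bsub>?A\<^esub> \<odot>\<^bsub>?K\<^esub> a = counit ?A \<one>\<^bsub>?A\<^esub> \<odot>\<^bsub>?K\<^esub> b"
      using ab by (metis A.one_closed)
    then show "a = b" using ab algebra_hom_one[OF hopf_algebra.counit_algebra_hom[OF hA]] by simp
  qed
  ultimately show ?thesis
    unfolding factorizes_through_def using hE hA hK ih jh bij by blast
qed


section \<open>Isomorphisms between the extensions\<close>

lemma coprime_inverse_mod: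
  fixes s n :: nat
  assumes "coprime s n"
  shows "\<exists>s'. (s * s') mod n = 1 mod n"
proof (cases "s = 0")
  case True
  with assms show ?thesis by auto
next
  case False
  from bezout_nat[OF this, of n] assms obtain a b where "s * a = n * b + 1" by (auto simp: coprime_iff_gcd_eq_1)
  then have "(s * a) mod n = (1 + n * b) mod n" by simp
  then show ?thesis by (simp only: mod_mult_self2) blast
qed

lemma is_H4n_pow:
  assumes "is_H4n n \<omega> L g x c"
  shows "is_H4n n (\<omega> ^ s) L g x (c [^]\<^bsub>L\<^esub> s)"
proof -
  have L: "hopf_algebra L" and r: "smash_rels L n \<omega> g x c" and c: "grouplike L c" and h4: "is_H4 L g x"
    using assms by (auto simp: is_H4n_def is_H4_def)
  interpret L: k_algebra L by (rule hopf_k_algebra[OF L])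
  note d = L.smash_relsD[OF r] L.sweedler_relsD[OF L.smash_relsD(1)[OF r]]
  have "(c [^]\<^bsub>L\<^esub> s) [^]\<^bsub>L\<^esub> n = (c [^]\<^bsub>L\<^esub> n) [^]\<^bsub>L\<^esub> s" using d(2) by (simp add: L.nat_pow_pow mult.commute)
  then have "smash_rels L n (\<omega> ^ s) g x (c [^]\<^bsub>L\<^esub> s)"
    using d L.pow_commute[OF d(2,6,4)] L.pow_skew_commute[OF d(2,7,5)] by (simp add: smash_rels_def)
  with h4 grouplike_pow[OF L c] show ?thesis by (simp add: is_H4n_def)
qed

lemma is_H4n_neg:
  assumes "is_H4n n \<omega> L g x c" and "even n"
  shows "is_H4n n (- \<omega>) L g x (g \<otimes>\<^bsub>L\<^esub> c)"
proof -
  have L: "hopf_algebra L" and r: "smash_rels L n \<omega> g x c" and c: "grouplike L c" and h4: "is_H4 L g x"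
    and g: "grouplike L g"
    using assms by (auto simp: is_H4n_def is_H4_def)
  interpret L: k_algebra L by (rule hopf_k_algebra[OF L])
  note d = L.smash_relsD[OF r] L.sweedler_relsD[OF L.smash_relsD(1)[OF r]]
  have "g [^]\<^bsub>L\<^esub> n = \<one>\<^bsub>L\<^esub>"
    using pow_mod[OF L.k_algebra_axioms d(6), of 2 n] d(6,8) assms(2) by (simp add: numeral_2_eq_2)
  then have 1: "(g \<otimes>\<^bsub>L\<^esub> c) [^]\<^bsub>L\<^esub> n = \<one>\<^bsub>L\<^esub>"
    using d by (subst L.pow_mult_distrib) auto
  have 2: "g \<otimes>\<^bsub>L\<^esub> c \<otimes>\<^bsub>L\<^esub> g = g \<otimes>\<^bsub>L\<^esub> (g \<otimes>\<^bsub>L\<^esub> c)" using d by (simp add: L.m_assoc)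
  have "g \<otimes>\<^bsub>L\<^esub> c \<otimes>\<^bsub>L\<^esub> x = \<omega> \<odot>\<^bsub>L\<^esub> (g \<otimes>\<^bsub>L\<^esub> x \<otimes>\<^bsub>L\<^esub> c)" using d by (simp add: L.m_assoc)
  also have "g \<otimes>\<^bsub>L\<^esub> x \<otimes>\<^bsub>L\<^esub> c = (- 1) \<odot>\<^bsub>L\<^esub> (x \<otimes>\<^bsub>L\<^esub> (g \<otimes>\<^bsub>L\<^esub> c))"
    using d by (simp add: L.scale_minus_one L.sweedler_rels_assoc[OF d(1)] L.m_assoc)
  finally have "g \<otimes>\<^bsub>L\<^esub> c \<otimes>\<^bsub>L\<^esub> x = (- \<omega>) \<odot>\<^bsub>L\<^esub> (x \<otimes>\<^bsub>L\<^esub> (g \<otimes>\<^bsub>L\<^esub> c))" using d by simp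
  with 1 2 d have "smash_rels L n (- \<omega>) g x (g \<otimes>\<^bsub>L\<^esub> c)" by (simp add: smash_rels_def)
  with h4 grouplike_mult[OF L g c] show ?thesis by (simp add: is_H4n_def)
qed

text \<open>
  The isomorphism is \<open>c \<mapsto> c^s\<close>. Its inverse is \<open>c \<mapsto> c^s'\<close> with \<open>s s'\<close> congruent to \<open>1\<close> modulo \<open>n\<close>.
\<close>

theorem H4n_power_isomorphic:
  fixes \<omega> :: "'k::field"
  assumes n: "0 < n" "\<omega> ^ n = 1" and s: "coprime s n"
  shows "hopf_isomorphic (H4n n (\<omega> ^ s)) (H4n n \<omega>)"
proof -
  have ns: "(\<omega> ^ s) ^ n = 1" using n(2) by (metis power_mult mult.commute power_one)
  obtain s' where s': "(s * s') mod n = 1 mod n" using coprime_inverse_mod[OF s] by blast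
  then have "\<omega> ^ (s * s') = \<omega>"
  proof -
    have "\<omega> ^ m = \<omega> ^ (m mod n)" for m
    proof -
      have "\<omega> ^ m = \<omega> ^ (n * (m div n) + m mod n)" by simp
      then show ?thesis by (simp only: power_add power_mult n(2) power_one mult_1)
    qed
    from this[of "s * s'"] this[of 1] show ?thesis using s' by simp
  qed
  then have pw: "(\<omega> ^ s) ^ s' = \<omega>" by (simp add: power_mult)
  let ?H = "H4n n (\<omega> ^ s)" and ?L = "H4n n \<omega>"
  let ?h = "H4n_gen n (\<omega> ^ s)" and ?l = "H4n_gen n \<omega>"
  have H: "is_H4n n (\<omega> ^ s) ?H (?h gG) (?h gX) (?h gC)" by (rule is_H4n_H4n[OF n(1) ns])
  have L: "is_H4n n \<omega> ?L (?l gG) (?l gX) (?l gC)" by (rule is_H4n_H4n[OF n])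
  have hh: "hopf_algebra ?H" "hopf_algebra ?L" using H L by (auto simp: is_H4n_def is_H4_def)
  note k = hopf_k_algebra[OF hh(1)] hopf_k_algebra[OF hh(2)]
  interpret H: k_algebra ?H by (rule k)
  interpret L: k_algebra ?L by (rule k)
  obtain f where f: "f \<in> hopf_homs ?H ?L" "f (?h gG) = ?l gG" "f (?h gX) = ?l gX" "f (?h gC) = ?l gC [^]\<^bsub>?L\<^esub> s"
    using hopf_homs_H4n[OF n(1) ns is_H4n_pow[OF L]] by blast
  obtain f' where f': "f' \<in> hopf_homs ?L ?H" "f' (?l gG) = ?h gG" "f' (?l gX) = ?h gX"
    "f' (?l gC) = ?h gC [^]\<^bsub>?H\<^esub> s'"
    using hopf_homs_H4n[OF n is_H4n_pow[OF H, of s', unfolded pw]] by blast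
  have Hc: "?h gC \<in> carrier ?H" "?h gC [^]\<^bsub>?H\<^esub> n = \<one>\<^bsub>?H\<^esub>" "?h gG \<in> carrier ?H" "?h gX \<in> carrier ?H"
    using H by (auto simp: is_H4n_def smash_rels_def sweedler_rels_def)
  have Lc: "?l gC \<in> carrier ?L" "?l gC [^]\<^bsub>?L\<^esub> n = \<one>\<^bsub>?L\<^esub>" "?l gG \<in> carrier ?L" "?l gX \<in> carrier ?L"
    using L by (auto simp: is_H4n_def smash_rels_def sweedler_rels_def)
  have "?h gC [^]\<^bsub>?H\<^esub> (s' * s) = ?h gC [^]\<^bsub>?H\<^esub> (1::nat)" "?l gC [^]\<^bsub>?L\<^esub> (s * s') = ?l gC [^]\<^bsub>?L\<^esub> (1::nat)"
    using pow_mod[OF k(1) Hc(1,2), of "s' * s"] pow_mod[OF k(1) Hc(1,2), of 1]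
      pow_mod[OF k(2) Lc(1,2), of "s * s'"] pow_mod[OF k(2) Lc(1,2), of 1] s'
    by (simp_all add: mult.commute)
  then have pc: "(?h gC [^]\<^bsub>?H\<^esub> s') [^]\<^bsub>?H\<^esub> s = ?h gC" "(?l gC [^]\<^bsub>?L\<^esub> s) [^]\<^bsub>?L\<^esub> s' = ?l gC"
    using Hc Lc by (simp_all add: H.nat_pow_pow L.nat_pow_pow)
  note fa = hopf_homs_algebra[OF f(1)] hopf_homs_algebra[OF f'(1)]
  show ?thesis
    by (rule hopf_isomorphicI_generators[OF hh f(1) fa(2) _ generated_H4n[OF n(1) ns] _ _ generated_H4n[OF n]])
      (use Hc Lc f f' pc in \<open>auto simp: algebra_hom_pow[OF fa(1) k(1)] algebra_hom_pow[OF fa(2) k(2)]\<close>)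
qed

text \<open>
  The substitution \<open>c \<mapsto> g c\<close> changes the sign of \<open>\<omega>\<close> because \<open>g\<close> anticommutes with \<open>x\<close>; as \<open>n\<close> is even, \<open>g c\<close> is still an
  \<open>n\<close>-th root of the unit. The substitution is its own inverse.
\<close>

theorem H4n_minus_isomorphic:
  fixes \<omega> :: "'k::field"
  assumes n: "0 < n" "\<omega> ^ n = 1" and even: "even n"
  shows "hopf_isomorphic (H4n n (- \<omega>)) (H4n n \<omega>)"
proof -
  have ns: "(- \<omega>) ^ n = 1" using n(2) even by simp
  let ?H = "H4n n (- \<omega>)" and ?L = "H4n n \<omega>"
  let ?h = "H4n_gen n (- \<omega>)" and ?l = "H4n_gen n \<omega>"
  have H: "is_H4n n (- \<omega>) ?H (?h gG) (?h gX) (?h gC)" by (rule is_H4n_H4n[OF n(1) ns])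
  have L: "is_H4n n \<omega> ?L (?l gG) (?l gX) (?l gC)" by (rule is_H4n_H4n[OF n])
  have hh: "hopf_algebra ?H" "hopf_algebra ?L" using H L by (auto simp: is_H4n_def is_H4_def)
  note k = hopf_k_algebra[OF hh(1)] hopf_k_algebra[OF hh(2)]
  interpret H: k_algebra ?H by (rule k)
  interpret L: k_algebra ?L by (rule k)
  obtain f where f: "f \<in> hopf_homs ?H ?L" "f (?h gG) = ?l gG" "f (?h gX) = ?l gX" "f (?h gC) = ?l gG \<otimes>\<^bsub>?L\<^esub> ?l gC"
    using hopf_homs_H4n[OF n(1) ns is_H4n_neg[OF L even]] by blast
  obtain f' where f': "f' \<in> hopf_homs ?L ?H" "f' (?l gG) = ?h gG" "f' (?l gX) = ?h gX"
    "f' (?l gC) = ?h gG \<otimes>\<^bsub>?H\<^esub> ?h gC"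
    using hopf_homs_H4n[OF n is_H4n_neg[OF H even, simplified]] by blast
  have Hs: "sweedler_rels ?H (?h gG) (?h gX)" "?h gC \<in> carrier ?H"
    and Ls: "sweedler_rels ?L (?l gG) (?l gX)" "?l gC \<in> carrier ?L"
    using H L by (auto simp: is_H4n_def smash_rels_def)
  note fa = hopf_homs_algebra[OF f(1)] hopf_homs_algebra[OF f'(1)]
  show ?thesis
    by (rule hopf_isomorphicI_generators[OF hh f(1) fa(2) _ generated_H4n[OF n(1) ns] _ _ generated_H4n[OF n]])
      (use Hs Ls f f' H.sweedler_relsD[OF Hs(1)] L.sweedler_relsD[OF Ls(1)] in
        \<open>auto simp: algebra_hom_mult[OF fa(1)] algebra_hom_mult[OF fa(2)]
          H.sweedler_rels_assoc[OF Hs(1)] L.sweedler_rels_assoc[OF Ls(1)]\<close>)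
qed

text \<open>
  The images of \<open>g\<close> and \<open>c\<close> are group-like and the image of \<open>x\<close> is skew-primitive. Injectivity excludes that
  the latter is a combination of group-like elements, so \<open>g\<close> goes to \<open>g\<close> and \<open>x\<close> to a multiple of \<open>x\<close>. If \<open>c\<close>
  goes to \<open>g^a c^i\<close>, comparing both sides of \<open>c x = \<omega> x c\<close> gives \<open>\<omega> = (-1)^a \<omega>'^i\<close>. For odd \<open>n\<close> the exponent
  \<open>a\<close> is zero, since the image of \<open>c\<close> has trivial \<open>n\<close>-th power.
\<close>

theorem H4n_isomorphic_imp:
  fixes \<omega> \<omega>' :: "'k::field"
  assumes n: "0 < n" "\<omega> ^ n = 1" "\<omega>' ^ n = 1" and two: "(2::'k) \<noteq> 0"
    and iso: "hopf_isomorphic (H4n n \<omega>) (H4n n \<omega>')"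
  shows "\<exists>m. \<omega> = \<omega>' ^ m \<or> even n \<and> \<omega> = - (\<omega>' ^ m)"
proof -
  let ?H = "H4n n \<omega>" and ?L = "H4n n \<omega>'"
  let ?g = "H4n_gen n \<omega> gG" and ?x = "H4n_gen n \<omega> gX" and ?c = "H4n_gen n \<omega> gC"
  let ?g' = "H4n_gen n \<omega>' gG" and ?x' = "H4n_gen n \<omega>' gX" and ?c' = "H4n_gen n \<omega>' gC"
  obtain \<phi> \<psi> where "smash_basis n ?H ?g ?x ?c \<phi>" "smash_basis n ?L ?g' ?x' ?c' \<psi>"
    using smash_basis_H4n[OF n(1)] n by metis
  then interpret H: smash_basis n ?H ?g ?x ?c \<phi> + L: smash_basis n ?L ?g' ?x' ?c' \<psi> .
  have r: "smash_rels ?H n \<omega> ?g ?x ?c" and r': "smash_rels ?L n \<omega>' ?g' ?x' ?c'"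
    using is_H4n_H4n[OF n(1,2)] is_H4n_H4n[OF n(1,3)] by (auto simp: is_H4n_def)
  note d = H.smash_relsD[OF r] H.gx and d' = L.smash_relsD[OF r'] L.gx
  obtain f where f: "f \<in> hopf_homs ?H ?L" and bij: "bij_betw f (carrier ?H) (carrier ?L)"
    using iso by (auto simp: hopf_isomorphic_def)
  note fa = hopf_homs_algebra[OF f]
  note fm = algebra_hom_mult[OF fa] algebra_hom_closed[OF fa] algebra_hom_scale[OF fa] algebra_hom_one[OF fa]
    algebra_hom_add[OF fa] linear_map_minus[OF algebra_hom_linear[OF fa] H.k_algebra_axioms L.k_algebra_axioms]
  have w: "grouplike ?L (f ?g)" by (rule hopf_hom_grouplike[OF f H.hopf L.hopf H.grouplike_g])
  have y: "skew_primitive ?L (f ?g) (f ?x)"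
    by (rule hopf_hom_skew_primitive[OF f H.hopf L.hopf H.skew_x d(6)])
  obtain s t where st: "f ?x = s \<odot>\<^bsub>?L\<^esub> (\<one>\<^bsub>?L\<^esub> \<ominus>\<^bsub>?L\<^esub> f ?g) \<oplus>\<^bsub>?L\<^esub> t \<odot>\<^bsub>?L\<^esub> ?x'" and t: "t \<noteq> 0 \<longrightarrow> f ?g = ?g'"
    using L.skew_primitive_cases[OF w y] by blast
  have wc: "f ?g \<in> carrier ?L" using fm(2) d(6) by blast
  have t0: "t \<noteq> 0"
  proof
    assume "t = 0"
    then have "f ?x = f (s \<odot>\<^bsub>?H\<^esub> (\<one>\<^bsub>?H\<^esub> \<ominus>\<^bsub>?H\<^esub> ?g))"
      using st d(6) d' wc by (simp add: fm H.minus_eq L.minus_eq)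
    then have "?x = s \<odot>\<^bsub>?H\<^esub> (\<one>\<^bsub>?H\<^esub> \<ominus>\<^bsub>?H\<^esub> ?g)"
      using bij d(6,7) by (auto simp: bij_betw_def inj_on_def)
    then show False using H.x_not_grouplike_combination[of "(True, 0)" s, unfolded H.u_g] n by blast
  qed
  with t have g': "f ?g = ?g'" by simp
  have "f ?x \<otimes>\<^bsub>?L\<^esub> f ?g = f (\<ominus>\<^bsub>?H\<^esub> (?g \<otimes>\<^bsub>?H\<^esub> ?x))"
    using d(10) fm(1)[of ?x ?g] d(6,7) by simp
  then have "f ?x \<otimes>\<^bsub>?L\<^esub> ?g' = \<ominus>\<^bsub>?L\<^esub> (?g' \<otimes>\<^bsub>?L\<^esub> f ?x)"
    using d(6,7) by (simp add: fm g')
  then have fx: "f ?x = t \<odot>\<^bsub>?L\<^esub> ?x'"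
    using L.skew_primitive_anticommuting[OF two st[unfolded g']] by blast
  obtain p where p: "p \<in> L.P" and fc: "f ?c = L.u p"
    using L.grouplike_cases[OF hopf_hom_grouplike[OF f H.hopf L.hopf H.grouplike_c]] by blast
  obtain a i where ai: "p = (a, i)" by (cases p)
  let ?ga = "if a then ?g' else \<one>\<^bsub>?L\<^esub>"
  have u: "L.u p = ?ga \<otimes>\<^bsub>?L\<^esub> ?c' [^]\<^bsub>?L\<^esub> i" and v: "L.v p = ?ga \<otimes>\<^bsub>?L\<^esub> (?x' \<otimes>\<^bsub>?L\<^esub> ?c' [^]\<^bsub>?L\<^esub> i)"
    using d' by (simp_all add: L.u_def L.v_def monomial_def ai)
  have ci: "?c' [^]\<^bsub>?L\<^esub> i \<in> carrier ?L" using d' by simp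
  have "f ?c \<otimes>\<^bsub>?L\<^esub> f ?x = \<omega> \<odot>\<^bsub>?L\<^esub> (f ?x \<otimes>\<^bsub>?L\<^esub> f ?c)"
    using d(5) fm(1)[of ?c ?x] d(2,6,7) by (simp add: fm)
  then have eq: "L.u p \<otimes>\<^bsub>?L\<^esub> (t \<odot>\<^bsub>?L\<^esub> ?x') = \<omega> \<odot>\<^bsub>?L\<^esub> ((t \<odot>\<^bsub>?L\<^esub> ?x') \<otimes>\<^bsub>?L\<^esub> L.u p)"
    by (simp only: fc fx)
  have l: "L.u p \<otimes>\<^bsub>?L\<^esub> ?x' = \<omega>' ^ i \<odot>\<^bsub>?L\<^esub> L.v p"
    using L.pow_skew_commute[OF d'(2,7,5), of i] d'(6,7) ci by (simp add: u v L.m_assoc)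
  have r: "?x' \<otimes>\<^bsub>?L\<^esub> L.u p = (if a then - 1 else 1) \<odot>\<^bsub>?L\<^esub> L.v p"
    using d'(6,7) ci by (simp add: u v L.gx_assoc L.scale_minus_one)
  have "(t * \<omega>' ^ i) \<odot>\<^bsub>?L\<^esub> L.v p = (\<omega> * (t * (if a then - 1 else 1))) \<odot>\<^bsub>?L\<^esub> L.v p"
    using eq d'(7) L.uv_closed[of p] l r by simp
  then have "L.\<beta> p ((t * \<omega>' ^ i) \<odot>\<^bsub>?L\<^esub> L.v p) = L.\<beta> p ((\<omega> * (t * (if a then - 1 else 1))) \<odot>\<^bsub>?L\<^esub> L.v p)" by simp
  then have "t * \<omega>' ^ i = \<omega> * (t * (if a then - 1 else 1))"
    using linear_map_scale[OF L.\<alpha>\<beta>_linear(2)[OF p] L.uv_closed(2)] L.\<alpha>\<beta>_uv(2)[OF p p] by simp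
  then have om: "\<omega> = (if a then - (\<omega>' ^ i) else \<omega>' ^ i)" using t0 by (auto split: if_splits)
  have "even n" if a: a
  proof (rule ccontr)
    assume odd: "odd n"
    have "f ?c [^]\<^bsub>?L\<^esub> n = \<one>\<^bsub>?L\<^esub>"
      using algebra_hom_pow[OF fa H.k_algebra_axioms d(2), of n] d(3) fm(4) by simp
    moreover have "(?g' \<otimes>\<^bsub>?L\<^esub> ?c' [^]\<^bsub>?L\<^esub> i) [^]\<^bsub>?L\<^esub> n = ?g' [^]\<^bsub>?L\<^esub> n \<otimes>\<^bsub>?L\<^esub> (?c' [^]\<^bsub>?L\<^esub> i) [^]\<^bsub>?L\<^esub> n"
      using L.pow_commute[OF d'(2,6,4), of i] d'(6) ci by (intro L.pow_mult_distrib) auto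
    moreover have "(?c' [^]\<^bsub>?L\<^esub> i) [^]\<^bsub>?L\<^esub> n = (?c' [^]\<^bsub>?L\<^esub> n) [^]\<^bsub>?L\<^esub> i"
      using d'(2) by (simp add: L.nat_pow_pow mult.commute)
    moreover have "?g' [^]\<^bsub>?L\<^esub> n = ?g'"
    proof -
      have "?g' [^]\<^bsub>?L\<^esub> (2::nat) = \<one>\<^bsub>?L\<^esub>" using d'(6,8) by (simp add: numeral_2_eq_2)
      moreover have "n mod 2 = 1" using odd by presburger
      ultimately show ?thesis using pow_mod[OF L.k_algebra_axioms d'(6), of 2 n] d'(6) by simp
    qed
    ultimately have g1: "?g' = \<one>\<^bsub>?L\<^esub>" using d'(3,6) a fc u by simp
    have "L.u (True, 0) = L.u (False, 0)" by (rule trans[OF L.u_g trans[OF g1 L.u_one[symmetric]]])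
    then show False using L.\<alpha>\<beta>_uv(1)[of "(True, 0)" "(True, 0)"] L.\<alpha>\<beta>_uv(1)[of "(True, 0)" "(False, 0)"] n by simp
  qed
  with om show ?thesis by (cases a) auto
qed

section \<open>Arithmetic of the roots of unity\<close>

text \<open>
  A divisor is the same as a choice, for each prime factor of \<open>m\<close>, of a multiplicity not exceeding that in \<open>m\<close>.
\<close>

lemma card_divisors:
  fixes m :: nat
  assumes m: "0 < m"
  shows "card {d. 0 < d \<and> d dvd m} = (\<Prod>p\<in>prime_factors m. multiplicity p m + 1)"
proof -
  let ?P = "prime_factors m"
  let ?F = "\<Pi>\<^sub>E p\<in>?P. {0..multiplicity p m}"
  let ?v = "\<lambda>d. restrict (\<lambda>p. multiplicity p d) ?P"
  have prime: "Factorial_Ring.prime p" if "p \<in> ?P" for p using that by auto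
  have "bij_betw ?v {d. 0 < d \<and> d dvd m} ?F"
  proof (rule bij_betwI')
    fix d d' assume d: "d \<in> {d. 0 < d \<and> d dvd m}" and d': "d' \<in> {d. 0 < d \<and> d dvd m}"
    show "(?v d = ?v d') = (d = d')"
    proof
      assume eq: "?v d = ?v d'"
      have "multiplicity p d = multiplicity p d'" if p: "Factorial_Ring.prime p" for p
      proof (cases "p \<in> ?P")
        case True
        with eq show ?thesis by (metis restrict_apply')
      next
        case False
        with p m have "\<not> p dvd m" by (auto simp: prime_factors_dvd)
        then have "\<not> p dvd d" "\<not> p dvd d'" using d d' dvd_trans by blast+
        then show ?thesis by (simp add: not_dvd_imp_multiplicity_0)
      qed
      then show "d = d'" using multiplicity_eq_imp_eq[of d d'] d d' by simp
    qed simp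
  next
    fix d assume "d \<in> {d. 0 < d \<and> d dvd m}"
    then show "?v d \<in> ?F" using m by (auto intro: dvd_imp_multiplicity_le)
  next
    fix f assume f: "f \<in> ?F"
    let ?d = "\<Prod>p\<in>?P. p ^ f p"
    have mult: "multiplicity q ?d = (if q \<in> ?P then f q else 0)" if "Factorial_Ring.prime q" for q
      using that by (intro multiplicity_prod_prime_powers) auto
    have pos: "0 < ?d" using prime prime_gt_0_nat by (intro prod_pos) auto
    have "multiplicity q ?d \<le> multiplicity q m" if "Factorial_Ring.prime q" for q
      using mult[OF that] f by (auto simp: PiE_def Pi_def)
    then have "?d dvd m" using pos by (intro multiplicity_le_imp_dvd) auto
    moreover have "f = ?v ?d"
    proof
      fix p show "f p = ?v ?d p"
        using f mult[of p] prime[of p] by (cases "p \<in> ?P") (auto simp: PiE_def extensional_def)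
    qed
    ultimately show "\<exists>d\<in>{d. 0 < d \<and> d dvd m}. f = ?v d" using pos by blast
  qed
  then have "card {d. 0 < d \<and> d dvd m} = card ?F" by (rule bij_betw_same_card)
  also have "\<dots> = (\<Prod>p\<in>?P. multiplicity p m + 1)" by (simp add: card_PiE)
  finally show ?thesis .
qed

text \<open>
  Dividing by \<open>2\<close> lowers the multiplicity of \<open>2\<close> by one and leaves the others unchanged. If \<open>2\<close> stops
  being a prime factor, the additional factor for it is \<open>1\<close>.
\<close>

lemma card_divisors_half:
  fixes m :: nat
  assumes m: "0 < m" "even m"
  shows "card {d. 0 < d \<and> d dvd m div 2} =
    multiplicity 2 m * (\<Prod>p\<in>prime_factors m - {2}. multiplicity p m + 1)"
proof -
  obtain h where h: "m = 2 * h" using m by auto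
  with m have h0: "0 < h" by simp
  have two: "multiplicity 2 m = Suc (multiplicity 2 h)"
    using h0 unfolding h by (subst prime_elem_multiplicity_mult_distrib) auto
  have other: "multiplicity p m = multiplicity p h" if "Factorial_Ring.prime p" "p \<noteq> 2" for p :: nat
    using that h0 unfolding h
    by (subst prime_elem_multiplicity_mult_distrib)
      (auto intro!: prime_multiplicity_other)
  have pf: "prime_factors m = insert 2 (prime_factors h)"
  proof -
    have "p = 2" if "Factorial_Ring.prime p" "p dvd 2" for p :: nat
      using primes_dvd_imp_eq[OF that(1) two_is_prime_nat that(2)] .
    then show ?thesis using h0 by (auto simp: prime_factors_dvd h prime_dvd_mult_iff)
  qed
  have "card {d. 0 < d \<and> d dvd h} = (\<Prod>p\<in>prime_factors h. multiplicity p h + 1)"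
    by (rule card_divisors[OF h0])
  also have "\<dots> = (\<Prod>p\<in>insert 2 (prime_factors h). multiplicity p h + 1)"
  proof (cases "2 \<in> prime_factors h")
    case True
    then show ?thesis by (simp add: insert_absorb)
  next
    case False
    then have "multiplicity 2 h = 0" using h0 by (auto simp: prime_factors_dvd not_dvd_imp_multiplicity_0)
    with False show ?thesis by simp
  qed
  also have "\<dots> = (multiplicity 2 h + 1) * (\<Prod>p\<in>prime_factors m - {2}. multiplicity p h + 1)"
    unfolding pf by (simp add: prod.insert_remove)
  also have "(\<Prod>p\<in>prime_factors m - {2}. multiplicity p h + 1) = (\<Prod>p\<in>prime_factors m - {2}. multiplicity p m + 1)"
    by (intro prod.cong) (auto simp: other in_prime_factors_imp_prime)
  finally show ?thesis by (simp add: h two[unfolded h])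
qed

text \<open>
  Adding to \<open>s\<close> the product of \<open>m\<close> and all primes of \<open>n\<close> that do not divide \<open>s\<close> works: a prime of \<open>n\<close> that
  divides \<open>s\<close> does not divide the summand, and any other one divides the summand but not \<open>s\<close>.
\<close>

lemma coprime_lift:
  fixes s m n :: nat
  assumes n: "0 < n" and s: "coprime s m"
  shows "\<exists>s'. s' mod m = s mod m \<and> coprime s' n"
proof -
  define Q where "Q = {p \<in> prime_factors n. \<not> p dvd s}"
  have Q: "finite Q" by (simp add: Q_def)
  have "gcd (s + m * \<Prod>Q) n = 1"
  proof (rule ccontr)
    assume "gcd (s + m * \<Prod>Q) n \<noteq> 1"
    then obtain p where p: "Factorial_Ring.prime p" "p dvd gcd (s + m * \<Prod>Q) n" using prime_factor_nat by blast
    then have ps: "p dvd s + m * \<Prod>Q" and pn: "p dvd n" by (metis gcd_nat.bounded_iff)+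
    show False
    proof (cases "p dvd s")
      case True
      then have "p dvd m * \<Prod>Q" using ps by (simp add: dvd_add_right_iff)
      then consider "p dvd m" | "p dvd \<Prod>Q" using prime_dvd_multD[OF p(1)] by blast
      then show False
      proof cases
        case 1
        have "is_unit p" by (rule coprime_common_divisor[OF s True 1])
        with p(1) show False using not_prime_unit by blast
      next
        case 2
        then obtain r where r: "r \<in> Q" "p dvd r" using prime_dvd_prod_iff[OF Q p(1), of "\<lambda>x. x"] by auto
        then have "p = r" using primes_dvd_imp_eq[OF p(1)] by (auto simp: Q_def)
        with True r show False by (simp add: Q_def)
      qed
    next
      case False
      then have "p \<in> Q" using p pn n by (simp add: Q_def prime_factors_dvd)
      then have "p dvd \<Prod>Q" using dvd_prodI[OF Q, of p "\<lambda>x. x"] by simp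
      then have "p dvd s" using ps by (simp add: dvd_add_left_iff)
      with False show False by simp
    qed
  qed
  then show ?thesis by (intro exI[of _ "s + m * \<Prod>Q"]) (simp add: coprime_iff_gcd_eq_1)
qed

text \<open>
  Invert \<open>t / gcd t h\<close> modulo \<open>h / gcd t h\<close> and lift the inverse to a number coprime to \<open>n\<close>. The lift is
  needed because exponents \<open>s\<close> of \<open>c\<close> have to be invertible modulo \<open>n\<close>, not only modulo \<open>h\<close>.
\<close>

lemma unit_multiple_is_gcd:
  fixes t h n :: nat
  assumes n: "0 < n" and h: "h dvd n"
  shows "\<exists>s. coprime s n \<and> (t * s) mod h = gcd t h mod h"
proof -
  have h0: "0 < h" using n h by (auto intro: Nat.gr0I)
  define d where "d = gcd t h"
  have d0: "0 < d" using h0 by (simp add: d_def)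
  obtain t' h' where t': "t = t' * d" and h': "h = h' * d" and cop: "coprime t' h'"
    using gcd_coprime_exists[of t h] d0 unfolding d_def by blast
  obtain s0 where s0: "(t' * s0) mod h' = 1 mod h'" using coprime_inverse_mod[OF cop] by blast
  have "coprime s0 h'"
  proof (rule coprimeI)
    fix a assume a: "a dvd s0" "a dvd h'"
    then have "a dvd (t' * s0) mod h'" by (simp add: dvd_mod_iff)
    then show "is_unit a" using a(2) by (simp only: s0 dvd_mod_iff)
  qed
  then obtain s where s: "s mod h' = s0 mod h'" "coprime s n" using coprime_lift[OF n] by blast
  have "(t' * s) mod h' = (t' * (s mod h')) mod h'" by (simp add: mod_mult_right_eq)
  also have "\<dots> = (t' * (s0 mod h')) mod h'" by (simp only: s(1))
  also have "\<dots> = 1 mod h'" using s0 by (simp add: mod_mult_right_eq)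
  finally have "((t' * s) * d) mod (h' * d) = (1 * d) mod (h' * d)" by (simp only: mod_mult_mult2)
  then have "(t * s) mod h = d mod h" by (simp only: t' h' mult_ac mult_1)
  then show ?thesis using s(2) by (auto simp: d_def)
qed

locale root_of_unity_generator =
  fixes n \<nu> :: nat and \<xi> :: "'k::field"
  assumes n: "0 < n" and range: "roots_of_unity n = range (\<lambda>i::nat. \<xi> ^ i)"
    and card: "\<nu> = card (roots_of_unity n :: 'k set)"
begin

lemma root: "(\<xi> ^ i) ^ n = 1"
proof -
  have "\<xi> ^ i \<in> roots_of_unity n" by (simp add: range)
  then show ?thesis by (simp add: roots_of_unity_def)
qed

lemma root_is_power: "\<omega> ^ n = 1 \<Longrightarrow> \<exists>i. \<omega> = \<xi> ^ i"
  using range by (auto simp: roots_of_unity_def)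

lemma order: "0 < \<nu> \<and> (\<forall>i. \<xi> ^ i = 1 \<longleftrightarrow> \<nu> dvd i)"
proof -
  define N where "N = (LEAST i. 0 < i \<and> \<xi> ^ i = 1)"
  have "0 < N \<and> \<xi> ^ N = 1" unfolding N_def by (rule LeastI[of _ n]) (use n root[of 1] in simp)
  then have N: "0 < N" "\<xi> ^ N = 1" by auto
  have least: "N \<le> i" if "0 < i" "\<xi> ^ i = 1" for i unfolding N_def using that by (intro Least_le) auto
  have pow: "\<xi> ^ (i mod N) = \<xi> ^ i" for i
  proof -
    have "\<xi> ^ i = \<xi> ^ (N * (i div N) + i mod N)" by simp
    then show ?thesis by (simp only: power_add power_mult N(2) power_one mult_1)
  qed
  have x0: "\<xi> \<noteq> 0" using N by (metis power_0_left zero_neq_one less_irrefl)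
  have "inj_on (\<lambda>i. \<xi> ^ i) {..<N}"
  proof (rule linorder_inj_onI)
    fix i j assume ij: "i < j" "i \<in> {..<N}" "j \<in> {..<N}"
    show "\<xi> ^ i \<noteq> \<xi> ^ j"
    proof
      assume "\<xi> ^ i = \<xi> ^ j"
      then have "\<xi> ^ (j - i) = 1" using x0 ij by (simp add: power_diff)
      then show False using least[of "j - i"] ij by auto
    qed
  qed auto
  moreover have "roots_of_unity n = (\<lambda>i. \<xi> ^ i) ` {..<N}"
    unfolding range using N(1) pow by (auto simp: image_iff) (metis lessThan_iff mod_less_divisor)
  ultimately have "\<nu> = N" by (simp add: card card_image)
  moreover have "\<xi> ^ i = 1 \<longleftrightarrow> N dvd i" for i
  proof
    assume "\<xi> ^ i = 1"
    then have "\<xi> ^ (i mod N) = 1" by (simp add: pow)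
    then show "N dvd i" using least[of "i mod N"] N(1) by (metis dvd_eq_mod_eq_0 gr0I mod_less_divisor not_le)
  next
    assume "N dvd i"
    then show "\<xi> ^ i = 1" using N by (auto simp: power_mult)
  qed
  ultimately show ?thesis using N by simp
qed

lemma nu_pos: "0 < \<nu>" and power_eq_one_iff: "\<xi> ^ i = 1 \<longleftrightarrow> \<nu> dvd i"
  using order by auto

lemma nu_dvd: "\<nu> dvd n"
  using root[of 1] power_eq_one_iff by simp

lemma power_eq_iff: "\<xi> ^ i = \<xi> ^ j \<longleftrightarrow> i mod \<nu> = j mod \<nu>"
proof -
  have "\<xi> ^ (i mod \<nu>) = \<xi> ^ i" for i
  proof -
    have "\<xi> ^ i = \<xi> ^ (\<nu> * (i div \<nu>) + i mod \<nu>)" by simp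
    then show ?thesis using power_eq_one_iff[of \<nu>] by (simp only: power_add power_mult power_one mult_1) simp
  qed
  moreover have "i = j" if "\<xi> ^ i = \<xi> ^ j" "i < \<nu>" "j < \<nu>" "i \<le> j" for i j
  proof -
    have "\<xi> \<noteq> 0" using power_eq_one_iff[of \<nu>] nu_pos by (metis dvd_refl power_0_left zero_neq_one less_irrefl)
    then have "\<xi> ^ (j - i) = 1" using that by (simp add: power_diff)
    then have "\<nu> dvd j - i" by (simp add: power_eq_one_iff)
    with that show ?thesis using nu_pos by (auto dest: dvd_imp_le)
  qed
  then have "i = j" if "\<xi> ^ i = \<xi> ^ j" "i < \<nu>" "j < \<nu>" for i j using that by (metis nat_le_linear)
  ultimately show ?thesis using nu_pos by (metis mod_less_divisor)
qed

text \<open>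
  For even \<open>n\<close> the element \<open>- 1\<close> is a root of unity of order two, so \<open>2\<close> divides the order \<open>\<nu>\<close> of the group.
\<close>

lemma even_iff:
  assumes two: "(2::'k) \<noteq> 0"
  shows "even n \<longleftrightarrow> even \<nu>"
proof
  assume "even n"
  then obtain k where k: "- 1 = \<xi> ^ k" using root_is_power[of "- 1"] by auto
  have "(- 1 :: 'k) \<noteq> 1" using two by (metis add.right_inverse one_add_one)
  then have 1: "\<not> \<nu> dvd k" using k by (simp flip: power_eq_one_iff)
  have "\<xi> ^ (k * 2) = 1" by (simp add: power_mult k[symmetric])
  then have "\<nu> dvd k * 2" by (simp add: power_eq_one_iff)
  show "even \<nu>"
  proof (rule ccontr)
    assume "odd \<nu>"
    then have "coprime \<nu> 2" by simp
    with \<open>\<nu> dvd k * 2\<close> 1 show False by (simp add: coprime_dvd_mult_left_iff)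
  qed
qed (use nu_dvd dvd_trans in blast)

end

section \<open>Classification\<close>

locale hopf_classification = root_of_unity_generator n \<nu> \<xi> for n \<nu> :: nat and \<xi> :: "'k::field" +
  assumes two: "(2::'k) \<noteq> 0"
begin

text \<open>
  Sign changes multiply a root by \<open>- 1 = \<xi>^(\<nu> / 2)\<close>, so for even \<open>\<nu>\<close> exponents of \<open>\<xi>\<close> matter modulo \<open>\<nu> / 2\<close>
  only.
\<close>

definition modulus :: nat where "modulus = (if even \<nu> then \<nu> div 2 else \<nu>)"

definition representatives :: "('k, (gen list \<Rightarrow>\<^sub>0 'k) set) hopf set" where
  "representatives = (\<lambda>d. H4n n (\<xi> ^ d)) ` {d. 0 < d \<and> d dvd modulus}"

lemma modulus_dvd: "modulus dvd \<nu>"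
  by (auto simp: modulus_def)

lemma hopf_algebra_H4n: "\<omega> ^ n = 1 \<Longrightarrow> hopf_algebra (H4n n \<omega>)" for \<omega> :: 'k
  using is_H4n_H4n[OF n] by (auto simp: is_H4n_def is_H4_def)

lemma H4n_coprime_power: "coprime s n \<Longrightarrow> hopf_isomorphic (H4n n (\<xi> ^ t)) (H4n n (\<xi> ^ (t * s)))"
  using hopf_isomorphic_sym[OF H4n_power_isomorphic[OF n root, of s t]] by (simp add: power_mult)

lemma H4n_gcd: "hopf_isomorphic (H4n n (\<xi> ^ t)) (H4n n (\<xi> ^ gcd t \<nu>))"
proof -
  obtain s where s: "coprime s n" "(t * s) mod \<nu> = gcd t \<nu> mod \<nu>"
    using unit_multiple_is_gcd[OF n nu_dvd, of t] by blast
  then have "\<xi> ^ (t * s) = \<xi> ^ gcd t \<nu>" by (simp add: power_eq_iff)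
  with H4n_coprime_power[OF s(1), of t] show ?thesis by simp
qed

text \<open>
  The exponent \<open>n - 1\<close> inverts roots of unity and is coprime to \<open>n\<close>.
\<close>

lemma H4n_inverse:
  assumes "i < \<nu>"
  shows "hopf_isomorphic (H4n n (\<xi> ^ i)) (H4n n (\<xi> ^ (n - i)))"
proof -
  have i: "i \<le> n" using assms dvd_imp_le[OF nu_dvd n] by simp
  have "\<xi> ^ i \<noteq> 0" using root[of i] n by (metis power_0_left zero_neq_one less_irrefl)
  moreover have "\<xi> ^ (n - i) * \<xi> ^ i = 1" using i root[of 1] by (simp flip: power_add)
  moreover have "\<xi> ^ (i * (n - 1)) * \<xi> ^ i = 1"
  proof -
    have "i * (n - 1) + i = i * n" using n by (cases n) auto
    then have "\<xi> ^ (i * (n - 1)) * \<xi> ^ i = \<xi> ^ (i * n)" by (simp only: power_add[symmetric])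
    then show ?thesis using root[of i] by (simp only: power_mult)
  qed
  ultimately have "\<xi> ^ (i * (n - 1)) = \<xi> ^ (n - i)" by (metis mult_right_cancel)
  then show ?thesis using H4n_coprime_power[OF coprime_diff_one_left_nat[OF n], of i] by simp
qed

text \<open>
  For even \<open>\<nu>\<close> the two powers have equal squares.
\<close>

lemma power_eq_up_to_sign:
  assumes "a mod modulus = b mod modulus"
  shows "\<xi> ^ a = \<xi> ^ b \<or> even n \<and> \<xi> ^ a = - (\<xi> ^ b)"
proof (cases "even \<nu>")
  case True
  then have \<nu>: "modulus * 2 = \<nu>" by (simp add: modulus_def)
  have "(a * 2) mod (modulus * 2) = (b * 2) mod (modulus * 2)" by (simp only: mod_mult_mult2 assms)
  then have "(a * 2) mod \<nu> = (b * 2) mod \<nu>" unfolding \<nu> .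
  then have "(\<xi> ^ a)\<^sup>2 = (\<xi> ^ b)\<^sup>2" by (simp only: power_mult[symmetric] power_eq_iff)
  with True show ?thesis by (simp add: power2_eq_iff even_iff[OF two])
next
  case False
  with assms show ?thesis by (simp add: modulus_def power_eq_iff)
qed

lemma representative_exists:
  assumes "\<omega> ^ n = 1"
  shows "\<exists>d. 0 < d \<and> d dvd modulus \<and> hopf_isomorphic (H4n n \<omega>) (H4n n (\<xi> ^ d))"
proof -
  obtain t where t: "\<omega> = \<xi> ^ t" using root_is_power[OF assms] by blast
  let ?d = "gcd t modulus"
  have "0 < modulus" using nu_pos by (auto simp: modulus_def elim!: evenE)
  then have d: "0 < ?d" "?d dvd modulus" by simp_all
  obtain s where s: "coprime s n" "(t * s) mod modulus = ?d mod modulus"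
    using unit_multiple_is_gcd[OF n dvd_trans[OF modulus_dvd nu_dvd], of t] by blast
  have "hopf_isomorphic (H4n n (\<xi> ^ (t * s))) (H4n n (\<xi> ^ ?d))"
    using power_eq_up_to_sign[OF s(2)] H4n_minus_isomorphic[OF n root] hopf_isomorphic_refl[OF hopf_algebra_H4n[OF root]]
    by auto
  with H4n_coprime_power[OF s(1), of t] d show ?thesis
    unfolding t using hopf_isomorphic_trans by blast
qed

text \<open>
  The root with exponent \<open>d\<close> is, up to sign, a power of the one with exponent \<open>d'\<close>. As \<open>d'\<close> divides the modulus, it
  divides all representatives of a residue or none.
\<close>

lemma representative_dvd:
  assumes d': "d' dvd modulus" and iso: "hopf_isomorphic (H4n n (\<xi> ^ d)) (H4n n (\<xi> ^ d'))"
  shows "d' dvd d"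
proof -
  obtain m where "\<xi> ^ d = \<xi> ^ (d' * m) \<or> even n \<and> \<xi> ^ d = - (\<xi> ^ (d' * m))"
    using H4n_isomorphic_imp[OF n root root two iso] by (auto simp: power_mult)
  then have "d mod modulus = (d' * m) mod modulus"
  proof (elim disjE conjE)
    assume "\<xi> ^ d = \<xi> ^ (d' * m)"
    then have "d mod \<nu> = (d' * m) mod \<nu>" by (simp add: power_eq_iff)
    then show ?thesis using modulus_dvd by (metis mod_mod_cancel)
  next
    assume "even n" and eq: "\<xi> ^ d = - (\<xi> ^ (d' * m))"
    then have \<nu>: "modulus * 2 = \<nu>" by (simp add: modulus_def even_iff[OF two])
    from eq have "(\<xi> ^ d)\<^sup>2 = (\<xi> ^ (d' * m))\<^sup>2" by simp
    then have "(d * 2) mod \<nu> = ((d' * m) * 2) mod \<nu>" by (simp only: power_mult[symmetric] power_eq_iff)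
    then have "(d * 2) mod (modulus * 2) = ((d' * m) * 2) mod (modulus * 2)" unfolding \<nu> .
    then have "(d mod modulus) * 2 = ((d' * m) mod modulus) * 2" by (simp only: mod_mult_mult2)
    then show ?thesis by simp
  qed
  moreover have "d' dvd (d' * m) mod modulus" using d' by (simp add: dvd_mod)
  ultimately have "d' dvd d mod modulus" by simp
  with d' show ?thesis by (simp add: dvd_mod_iff)
qed

lemma representative_unique:
  assumes "d dvd modulus" "d' dvd modulus" "hopf_isomorphic (H4n n (\<xi> ^ d)) (H4n n (\<xi> ^ d'))"
  shows "d = d'"
  using representative_dvd[OF assms(2,3)] representative_dvd[OF assms(1) hopf_isomorphic_sym[OF assms(3)]]
  by (rule dvd_antisym[rotated])

lemma representatives_isomorphic_eq:
  assumes "H \<in> representatives" "L \<in> representatives" "hopf_isomorphic H L"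
  shows "H = L"
  using assms representative_unique unfolding representatives_def by blast

lemma representatives_hopf: "H \<in> representatives \<Longrightarrow> hopf_algebra H"
  using hopf_algebra_H4n[OF root] by (auto simp: representatives_def)

lemma factorization_representative:
  fixes E :: "('k, 'e) hopf"
  assumes "factorizes_through E (H4 :: ('k, _) hopf) (cyclic_hopf n)"
  shows "\<exists>!H. H \<in> representatives \<and> hopf_isomorphic E H"
proof -
  obtain \<omega> where \<omega>: "\<omega> ^ n = 1" "hopf_isomorphic (H4n n \<omega>) E"
    using factorization_isomorphic[OF n two assms] by blast
  obtain d where d: "0 < d" "d dvd modulus" "hopf_isomorphic (H4n n \<omega>) (H4n n (\<xi> ^ d))"
    using representative_exists[OF \<omega>(1)] by blast
  have "hopf_isomorphic E (H4n n (\<xi> ^ d))"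
    by (rule hopf_isomorphic_trans[OF hopf_isomorphic_sym[OF \<omega>(2)] d(3)])
  then have "\<exists>H. H \<in> representatives \<and> hopf_isomorphic E H"
    using d by (auto simp: representatives_def)
  moreover have "H = L" if "H \<in> representatives" "hopf_isomorphic E H" "L \<in> representatives" "hopf_isomorphic E L"
    for H L
    using representatives_isomorphic_eq[OF that(1,3) hopf_isomorphic_trans[OF hopf_isomorphic_sym[OF that(2)] that(4)]] .
  ultimately show ?thesis by blast
qed

lemma bij_betw_types:
  "bij_betw hopf_type representatives (factorizing_types (H4 :: ('k, _) hopf) (cyclic_hopf n))"
proof (rule bij_betwI')
  fix H L assume "H \<in> representatives" "L \<in> representatives"
  then show "(hopf_type H = hopf_type L) = (H = L)"
    using hopf_type_eq_iff[OF representatives_hopf] representatives_isomorphic_eq by blast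
next
  fix H assume "H \<in> representatives"
  then show "hopf_type H \<in> factorizing_types (H4 :: ('k, _) hopf) (cyclic_hopf n)"
    using factorizes_through_H4n[OF n root] by (auto simp: representatives_def factorizing_types_def)
next
  fix y :: "('k, (gen list \<Rightarrow>\<^sub>0 'k) set) hopf set"
  assume "y \<in> factorizing_types (H4 :: ('k, _) hopf) (cyclic_hopf n)"
  then obtain E :: "('k, (gen list \<Rightarrow>\<^sub>0 'k) set) hopf"
    where y: "y = hopf_type E" and E: "factorizes_through E (H4 :: ('k, _) hopf) (cyclic_hopf n)"
    by (auto simp: factorizing_types_def)
  obtain H where H: "H \<in> representatives" "hopf_isomorphic E H"
    using factorization_representative[OF E] by blast
  moreover have "hopf_algebra E" using E by (simp add: factorizes_through_def)
  ultimately show "\<exists>H\<in>representatives. y = hopf_type H" using y hopf_type_eq_iff by blast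
qed

lemma card_types:
  "card (factorizing_types (H4 :: ('k, _) hopf) (cyclic_hopf n) :: ('k, (gen list \<Rightarrow>\<^sub>0 'k) set) hopf set set) =
    card {d. 0 < d \<and> d dvd modulus}"
proof -
  have "inj_on (\<lambda>d. H4n n (\<xi> ^ d)) {d. 0 < d \<and> d dvd modulus}"
    using representative_unique hopf_isomorphic_refl[OF hopf_algebra_H4n[OF root]]
    by (intro inj_onI) (metis (no_types, lifting) mem_Collect_eq)
  then have "card representatives = card {d. 0 < d \<and> d dvd modulus}"
    unfolding representatives_def by (rule card_image)
  then show ?thesis using bij_betw_same_card[OF bij_betw_types] by simp
qed

end

theorem theorem4p10:
  fixes n \<nu> :: nat and \<xi> :: "'k::field"
  assumes "CHAR('k) \<noteq> 2"
    and "n > 0"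
    and "roots_of_unity n = range (\<lambda>i::nat. \<xi> ^ i)"
    and "\<nu> = card (roots_of_unity n :: 'k set)"
  shows
    "(\<forall>t<\<nu>. hopf_isomorphic (H4n n (\<xi> ^ t)) (H4n n (\<xi> ^ gcd t \<nu>))) \<and>
     (\<forall>i<\<nu>. hopf_isomorphic (H4n n (\<xi> ^ i)) (H4n n (\<xi> ^ (n - i)))) \<and>
     (odd \<nu> \<longrightarrow>
       (let Hs = (\<lambda>d. H4n n (\<xi> ^ d)) ` {d. 0 < d \<and> d dvd \<nu>} in
         (\<forall>E :: ('k, 'e) hopf. factorizes_through E (H4 :: ('k, _) hopf) (cyclic_hopf n) \<longrightarrow>
            (\<exists>!H. H \<in> Hs \<and> hopf_isomorphic E H)) \<and>
         bij_betw hopf_type Hs (factorizing_types (H4 :: ('k, _) hopf) (cyclic_hopf n)) \<and>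
         card (factorizing_types (H4 :: ('k, _) hopf) (cyclic_hopf n)
                 :: ('k, (gen list \<Rightarrow>\<^sub>0 'k) set) hopf set set)
           = (\<Prod>p\<in>prime_factors \<nu>. multiplicity p \<nu> + 1))) \<and>
     (even \<nu> \<longrightarrow>
       (let Hs = (\<lambda>d. H4n n (\<xi> ^ d)) ` {d. 0 < d \<and> d dvd \<nu> div 2} in
         (\<forall>E :: ('k, 'e) hopf. factorizes_through E (H4 :: ('k, _) hopf) (cyclic_hopf n) \<longrightarrow>
            (\<exists>!H. H \<in> Hs \<and> hopf_isomorphic E H)) \<and>
         bij_betw hopf_type Hs (factorizing_types (H4 :: ('k, _) hopf) (cyclic_hopf n)) \<and>
         card (factorizing_types (H4 :: ('k, _) hopf) (cyclic_hopf n)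
                 :: ('k, (gen list \<Rightarrow>\<^sub>0 'k) set) hopf set set)
           = multiplicity 2 \<nu> * (\<Prod>p\<in>prime_factors \<nu> - {2}. multiplicity p \<nu> + 1)))"
proof -
  have "(2::'k) \<noteq> 0"
  proof
    assume "(2::'k) = 0"
    then have "CHAR('k) dvd 2" using of_nat_eq_0_iff_char_dvd[of 2, where 'a = 'k] by simp
    then have "CHAR('k) \<le> 2" by (rule dvd_imp_le) simp
    moreover have "CHAR('k) \<noteq> 0" using \<open>CHAR('k) dvd 2\<close> by (intro notI) simp
    ultimately have "CHAR('k) = 1" using assms(1) by linarith
    then show False by simp
  qed
  then interpret hopf_classification n \<nu> \<xi>
    using assms(2-4) by unfold_locales
  have odd: "modulus = \<nu>" if "odd \<nu>" using that by (simp add: modulus_def)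
  have even: "modulus = \<nu> div 2" if "even \<nu>" using that by (simp add: modulus_def)
  note types = factorization_representative bij_betw_types card_types
  show ?thesis
  proof (intro conjI allI impI)
    show "hopf_isomorphic (H4n n (\<xi> ^ t)) (H4n n (\<xi> ^ gcd t \<nu>))" for t by (rule H4n_gcd)
    show "hopf_isomorphic (H4n n (\<xi> ^ i)) (H4n n (\<xi> ^ (n - i)))" if "i < \<nu>" for i
      using that by (rule H4n_inverse)
  next
    assume "odd \<nu>"
    note m = odd[OF this]
    show "let Hs = (\<lambda>d. H4n n (\<xi> ^ d)) ` {d. 0 < d \<and> d dvd \<nu>} in
         (\<forall>E :: ('k, 'e) hopf. factorizes_through E (H4 :: ('k, _) hopf) (cyclic_hopf n) \<longrightarrow>
            (\<exists>!H. H \<in> Hs \<and> hopf_isomorphic E H)) \<and>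
         bij_betw hopf_type Hs (factorizing_types (H4 :: ('k, _) hopf) (cyclic_hopf n)) \<and>
         card (factorizing_types (H4 :: ('k, _) hopf) (cyclic_hopf n)
                 :: ('k, (gen list \<Rightarrow>\<^sub>0 'k) set) hopf set set)
           = (\<Prod>p\<in>prime_factors \<nu>. multiplicity p \<nu> + 1)"
      unfolding Let_def card_divisors[OF nu_pos, symmetric]
      using types[unfolded representatives_def m] by blast
  next
    assume "even \<nu>"
    note m = even[OF this]
    show "let Hs = (\<lambda>d. H4n n (\<xi> ^ d)) ` {d. 0 < d \<and> d dvd \<nu> div 2} in
         (\<forall>E :: ('k, 'e) hopf. factorizes_through E (H4 :: ('k, _) hopf) (cyclic_hopf n) \<longrightarrow>
            (\<exists>!H. H \<in> Hs \<and> hopf_isomorphic E H)) \<and>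
         bij_betw hopf_type Hs (factorizing_types (H4 :: ('k, _) hopf) (cyclic_hopf n)) \<and>
         card (factorizing_types (H4 :: ('k, _) hopf) (cyclic_hopf n)
                 :: ('k, (gen list \<Rightarrow>\<^sub>0 'k) set) hopf set set)
           = multiplicity 2 \<nu> * (\<Prod>p\<in>prime_factors \<nu> - {2}. multiplicity p \<nu> + 1)"
      unfolding Let_def card_divisors_half[OF nu_pos \<open>even \<nu>\<close>, symmetric]
      using types[unfolded representatives_def m] by blast
  qed
qed

end
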